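(* Let $V$ be a potential satisfying the standing assumptions in the context, and for small $\varepsilon>0$ let $\widetilde W^{\varepsilon}(\xi,\eta,t)$ be the solution of the dilated Wigner equation $$\frac{\partial}{\partial t}\widetilde W^{\varepsilon}(\xi,\eta,t)+\widetilde L^{\varepsilon}\,\widetilde W^{\varepsilon}(\xi,\eta,t)=0,\quad (\xi,\eta)\in\mathbb R^2,\ t>0,\qquad \widetilde W^{\varepsilon}|_{t=0}=\widetilde f_0,$$ where $\widetilde f_0\in\mathcal S(\mathbb R^2)$ (Schwartz space) does not depend on $\varepsilon$. Let $\widetilde W^{\varepsilon}_h$ and $\widetilde Z^{\varepsilon,(l)}$, $l\ge1$, be the harmonic term and the correctors defined in the context from the initial datum $\widetilde f_0$. For $N\in\mathbb N$ define the remainder $R^{N+1}$ by $$\widetilde W^{\varepsilon}(\xi,\eta,t)=\widetilde W^{\varepsilon}_h(\xi,\eta,t)+\sum_{l=1}^{N}\varepsilon^{l/2}\,\widetilde Z^{\varepsilon,(l)}(\xi,\eta,t)+R^{N+1}(\xi,\eta,t).$$ Then for every $N\in\mathbb N$ there is a constant $C_N>0$, independent of $\varepsilon$ and $t$, such that for all $t>0$ and all sufficiently small $\varepsilon>0$ (with a threshold independent of $t$) $$\|R^{N+1}(t)\|_{L^2(\mathbb R^2_{\xi\eta})}\le C_N\,e^{t}\,\varepsilon^{(N+1)/2}.$$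
   Context: Standing assumptions on the potential $V:\mathbb R\to\mathbb R$: (i) $V\in C^\infty(\mathbb R)$; (ii) $V\ge0$ and $\inf_{|x|>R}V(x)>0$ for some $R>0$; (iii) $V'$ has exactly one zero, located at $x=0$, and $V(0)=0$; (iv) $V''(0)=1$; (v) $V$ is polynomially bounded, $|V(x)|\le c(1+|x|^m)$ for some $c,m$; moreover $V(x)\to\infty$ as $|x|\to\infty$ (so that $-\frac{\varepsilon^2}{2}\partial_x^2+V$ has purely discrete spectrum). Dilated Wigner operator: for $F=F(\xi,\eta)$, $$\widetilde L^{\varepsilon}F(\xi,\eta)=\eta\,\partial_\xi F(\xi,\eta)-\frac{i}{2\pi\varepsilon}\int_{\mathbb R}\int_{\mathbb R}e^{i(\eta-\eta')z}F(\xi,\eta')\Big[V\big(\sqrt\varepsilon(\xi+\tfrac z2)\big)-V\big(\sqrt\varepsilon(\xi-\tfrac z2)\big)\Big]dz\,d\eta'.$$ This is the Wigner (quantum Liouville) operator for the Hamiltonian $k^2/2+V(x)$ written in the variables $\xi=x/\sqrt\varepsilon$, $\eta=k/\sqrt\varepsilon$; solutions of the evolution equation are understood in $L^2(\mathbb R^2)$. Operators $\mathcal B_\nu$: for $\nu\ge1$, $$\mathcal B_\nu=-V^{(\nu+2)}(0)\sum_{j=0}^{\lfloor(\nu-1)/2\rfloor+1}\Big(\frac i2\Big)^{2j}\frac{1}{(2j+1)!}\,\frac{\xi^{\nu+1-2j}}{(\nu+1-2j)!}\,\frac{\partial^{2j+1}}{\partial\eta^{2j+1}}.$$ Harmonic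 flow: $g_h^t(q,p)=(q\cos t+p\sin t,\;p\cos t-q\sin t)$, with inverse $g_h^{-t}(\xi,\eta)=(\xi\cos t-\eta\sin t,\;\eta\cos t+\xi\sin t)$. Harmonic term and correctors (for initial datum $\widetilde f_0$): $\widetilde W^\varepsilon_h(\xi,\eta,t)=\widetilde f_0(g_h^{-t}(\xi,\eta))$ and, recursively for $l\ge1$, $$\widetilde Z^{\varepsilon,(l)}(\xi,\eta,t)=\int_0^tD^{\varepsilon,(l)}\big(g_h^{-(t-s)}(\xi,\eta),s\big)\,ds,\qquad D^{\varepsilon,(l)}=-\mathcal B_l\widetilde W^\varepsilon_h-\sum_{\nu=1}^{l-1}\mathcal B_\nu\widetilde Z^{\varepsilon,(l-\nu)}.$$ *)

theory Defs
  imports "HOL-Analysis.Analysis"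
begin

section \<open>Potentials\<close>

definition smooth_real :: "(real \<Rightarrow> real) \<Rightarrow> bool" where
  "smooth_real V \<longleftrightarrow> (\<forall>k x. ((deriv ^^ k) V) field_differentiable (at x))"

definition admissible_potential :: "(real \<Rightarrow> real) \<Rightarrow> bool" where
  "admissible_potential V \<longleftrightarrow>
     smooth_real V \<and>
     (\<forall>x. V x \<ge> 0) \<and>
     (\<exists>R>0. (INF x\<in>{x. \<bar>x\<bar> > R}. V x) > 0) \<and>
     (\<forall>x. deriv V x = 0 \<longleftrightarrow> x = 0) \<and>
     V 0 = 0 \<and>
     deriv (deriv V) 0 = 1 \<and>
     (\<exists>c. \<exists>m::nat. \<forall>x. \<bar>V x\<bar> \<le> c * (1 + \<bar>x\<bar> ^ m)) \<and>
     filterlim V at_top at_infinity"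

section \<open>Functions on phase space\<close>

text \<open>A phase space function is a function of the pair \<open>(\<xi>, \<eta>)\<close>, with complex values.\<close>

type_synonym phase_fun = "real \<times> real \<Rightarrow> complex"

definition d_xi :: "phase_fun \<Rightarrow> phase_fun" where
  "d_xi F = (\<lambda>(\<xi>, \<eta>). vector_derivative (\<lambda>x. F (x, \<eta>)) (at \<xi>))"

definition d_eta :: "phase_fun \<Rightarrow> phase_fun" where
  "d_eta F = (\<lambda>(\<xi>, \<eta>). vector_derivative (\<lambda>y. F (\<xi>, y)) (at \<eta>))"

text \<open>Total differentiability of all the derivatives below makes \<open>F\<close> of class \<open>C\<^sup>\<infinity>\<close>
  (and the order of the two partial derivatives irrelevant).\<close>

definition schwartz :: "phase_fun set" where
  "schwartz = {F. \<forall>a b.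
     (\<forall>p. ((d_xi ^^ a) ((d_eta ^^ b) F)) differentiable (at p)) \<and>
     (\<forall>j k. \<exists>C. \<forall>\<xi> \<eta>. \<bar>\<xi>\<bar> ^ j * \<bar>\<eta>\<bar> ^ k * cmod ((d_xi ^^ a) ((d_eta ^^ b) F) (\<xi>, \<eta>)) \<le> C)}"

definition L2 :: "phase_fun set" where
  "L2 = {F. F \<in> borel_measurable lborel \<and> integrable lborel (\<lambda>p. (cmod (F p))\<^sup>2)}"

text \<open>Meaningful for members of \<open>L2\<close> only: the Bochner integral of a non-integrable function
  is \<open>0\<close>.\<close>

definition L2_norm :: "phase_fun \<Rightarrow> real" where
  "L2_norm F = sqrt (\<integral>p. (cmod (F p))\<^sup>2 \<partial>lborel)"

section \<open>The dilated Wigner equation\<close>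

text \<open>The double integral is an oscillatory one.  It is read with the \<open>\<eta>'\<close>-integration, a Fourier
  transform, performed first; for a Schwartz function \<open>F\<close> and a polynomially bounded \<open>V\<close>
  both integrals then converge absolutely.\<close>

definition wigner_op :: "(real \<Rightarrow> real) \<Rightarrow> real \<Rightarrow> phase_fun \<Rightarrow> phase_fun" where
  "wigner_op V \<epsilon> F = (\<lambda>(\<xi>, \<eta>).
     of_real \<eta> * d_xi F (\<xi>, \<eta>)
     - \<i> / of_real (2 * pi * \<epsilon>) *
       (\<integral>z. (\<integral>\<eta>'. exp (\<i> * of_real ((\<eta> - \<eta>') * z)) * F (\<xi>, \<eta>') *
          of_real (V (sqrt \<epsilon> * (\<xi> + z / 2)) - V (sqrt \<epsilon> * (\<xi> - z / 2))) \<partial>lborel) \<partial>lborel))"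

text \<open>The graph of the realization of the Wigner operator in \<open>L\<^sup>2\<close>: the closure of
  \<open>wigner_op\<close> on Schwartz functions.  (Under the assumptions on \<open>V\<close> the Hamiltonian is
  essentially self-adjoint, so this is the skew-adjoint generator of the quantum Liouville group.)\<close>

definition wigner_graph :: "(real \<Rightarrow> real) \<Rightarrow> real \<Rightarrow> (phase_fun \<times> phase_fun) set" where
  "wigner_graph V \<epsilon> = {(F, G). F \<in> L2 \<and> G \<in> L2 \<and>
     (\<exists>\<Phi> :: nat \<Rightarrow> phase_fun.
        (\<forall>n. \<Phi> n \<in> schwartz \<and> wigner_op V \<epsilon> (\<Phi> n) \<in> L2) \<and>
        (\<lambda>n. L2_norm (\<lambda>p. \<Phi> n p - F p)) \<longlonglongrightarrow> 0 \<and>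
        (\<lambda>n. L2_norm (\<lambda>p. wigner_op V \<epsilon> (\<Phi> n) p - G p)) \<longlonglongrightarrow> 0)}"

text \<open>Solutions are classical solutions in \<open>L\<^sup>2\<close>: for \<open>t > 0\<close> the time derivative is the limit of
  difference quotients in the \<open>L\<^sup>2\<close>-norm, and the initial value is attained in the \<open>L\<^sup>2\<close>-norm.\<close>

definition wigner_solution ::
  "(real \<Rightarrow> real) \<Rightarrow> real \<Rightarrow> phase_fun \<Rightarrow> (real \<Rightarrow> phase_fun) \<Rightarrow> bool" where
  "wigner_solution V \<epsilon> f0 W \<longleftrightarrow>
     (\<forall>t>0. \<exists>G. (W t, G) \<in> wigner_graph V \<epsilon> \<and>
        ((\<lambda>h. L2_norm (\<lambda>p. (W (t + h) p - W t p) / of_real h + G p)) \<longlongrightarrow> 0) (at 0)) \<and>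
     ((\<lambda>t. L2_norm (\<lambda>p. W t p - f0 p)) \<longlongrightarrow> 0) (at_right 0)"

section \<open>Harmonic term, correctors and remainder\<close>

definition harmonic_flow :: "real \<Rightarrow> real \<times> real \<Rightarrow> real \<times> real" where
  "harmonic_flow t = (\<lambda>(q, p). (q * cos t + p * sin t, p * cos t - q * sin t))"

definition harmonic_term :: "phase_fun \<Rightarrow> real \<Rightarrow> phase_fun" where
  "harmonic_term f0 t = (\<lambda>p. f0 (harmonic_flow (- t) p))"

text \<open>Only used for \<open>\<nu> \<ge> 1\<close>; then no natural number subtraction below is truncated.\<close>

definition B_op :: "(real \<Rightarrow> real) \<Rightarrow> nat \<Rightarrow> phase_fun \<Rightarrow> phase_fun" where
  "B_op V \<nu> F = (\<lambda>(\<xi>, \<eta>).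
     - of_real ((deriv ^^ (\<nu> + 2)) V 0) *
       (\<Sum>j = 0..(\<nu> - 1) div 2 + 1.
          (\<i> / 2) ^ (2 * j) * (1 / fact (2 * j + 1)) *
          (of_real \<xi> ^ (\<nu> + 1 - 2 * j) / fact (\<nu> + 1 - 2 * j)) *
          (d_eta ^^ (2 * j + 1)) F (\<xi>, \<eta>)))"

text \<open>The correctors \<open>Z\<close> do not depend on \<open>\<epsilon>\<close>, since neither \<open>f0\<close> nor the operators \<open>B\<close> do.
  Only the values at \<open>l \<ge> 1\<close> are used.\<close>

function corrector :: "(real \<Rightarrow> real) \<Rightarrow> phase_fun \<Rightarrow> nat \<Rightarrow> real \<Rightarrow> phase_fun" where
  "corrector V f0 l = (\<lambda>t p. integral {0..t} (\<lambda>s.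
     (let q = harmonic_flow (- (t - s)) p in
       - B_op V l (harmonic_term f0 s) q
       - (\<Sum>\<nu>\<in>{1..<l}. B_op V \<nu> (corrector V f0 (l - \<nu>) s) q))))"
  by pat_completeness auto
termination
  by (relation "Wellfounded.measure (\<lambda>(V, f0, l). l)") auto

declare corrector.simps [simp del]

definition remainder ::
  "(real \<Rightarrow> real) \<Rightarrow> phase_fun \<Rightarrow> nat \<Rightarrow> real \<Rightarrow> (real \<Rightarrow> phase_fun) \<Rightarrow> real \<Rightarrow> phase_fun" where
  "remainder V f0 N \<epsilon> W t = (\<lambda>p.
     W t p - harmonic_term f0 t p
     - (\<Sum>l = 1..N. of_real (\<epsilon> powr (real l / 2)) * corrector V f0 l t p))"

end

theory Submission
  imports Defs "HOL-Probability.Probability" "HOL-Real_Asymp.Real_Asymp"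
begin

text \<open>
  Conjugating a differential operator with polynomial coefficients by the harmonic flow produces
  coefficients that are trigonometric polynomials in \<open>t\<close>.  Hence every corrector is a finite sum of
  terms \<open>c t * \<phi> (harmonic_flow (- t) p)\<close> with \<open>\<phi>\<close> Schwartz and \<open>c\<close> of at most exponential growth:
  Duhamel's formula merely integrates \<open>c\<close>, and all seminorms are \<open>O(exp t)\<close>.

  Replacing \<open>V\<close> in the Wigner operator by its Taylor polynomial gives the operators \<open>B_op\<close>, by Fourier
  inversion.  The Taylor remainder is \<open>O(\<bar>x\<bar> ^ (N + 3) * (1 + \<bar>x\<bar> ^ m))\<close> on the whole line, although
  nothing is known about the growth of the derivatives of \<open>V\<close>, and by Plancherel it contributes
  \<open>O(sqrt \<epsilon> ^ (N + 1))\<close> in \<open>L\<^sup>2\<close>.  So the truncated expansion solves the equation up to a residual of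
  norm \<open>O(sqrt \<epsilon> ^ (N + 1) * exp t)\<close>, and since the Wigner operator is skew-symmetric on the closure
  of the Schwartz functions, the energy estimate integrates this bound over time.
\<close>

section \<open>Square integrable functions on phase space\<close>

text \<open>The obstacle is that the solution has no regularity of its own: it is only a limit, in
  the graph norm, of Schwartz functions. All moments and derivatives therefore have to fall on the
  explicit expansion, whose terms are Schwartz, so that subtracting it from an approximating
  sequence stays inside the class on which skew-symmetry can be computed. The prefactor 1/\<epsilon>
  of the Wigner operator costs two powers of \<open>sqrt \<epsilon>\<close>. This fixes the degree N
  + 2 of the Taylor polynomial: its remainder vanishes to order N + 3 at 0 and contributes
  \<open>sqrt \<epsilon> ^ (N + 3) / \<epsilon>\<close>. The remaining part of the residual consists
  of the products of B-operators with expansion terms whose total order exceeds N. The rate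
  \<open>exp t\<close> is chosen because it reproduces itself: the integral of
  \<open>K * exp s\<close> over \<open>{0..t}\<close> is \<open>K * (exp t - 1)\<close>, while
  cosines and sines do not enlarge the bound. Neither the recursion over the correctors nor the last
  integration in time changes the rate.\<close>

lemma integrable_inverse_one_plus_square:
  "integrable lborel (\<lambda>x::real. inverse (1 + x^2))" "(\<integral>x. inverse (1 + x^2) \<partial>lborel) = pi"
  using integrable_inverse_1_plus_square LBINT_inverse_1_plus_square
  by (simp_all add: set_integrable_def interval_lebesgue_integral_def set_lebesgue_integral_def)

lemma borel_measurable_cnj [measurable (raw)]:
  "f \<in> borel_measurable M \<Longrightarrow> (\<lambda>x. cnj (f x)) \<in> borel_measurable M"
  by (rule borel_measurable_continuous_on[of cnj]) (auto intro: continuous_intros)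

lemma L2_measurable: "F \<in> L2 \<Longrightarrow> F \<in> borel_measurable lborel"
  by (simp add: L2_def)

lemma L2_integrable_square: "F \<in> L2 \<Longrightarrow> integrable lborel (\<lambda>p. (cmod (F p))^2)"
  by (simp add: L2_def)

lemma L2_add:
  assumes "F \<in> L2" "G \<in> L2"
  shows "(\<lambda>p. F p + G p) \<in> L2"
proof -
  note [measurable] = assms[THEN L2_measurable]
  have "integrable lborel (\<lambda>p. (cmod (F p + G p))^2)"
  proof (rule Bochner_Integration.integrable_bound)
    show "integrable lborel (\<lambda>p. 2 * (cmod (F p))^2 + 2 * (cmod (G p))^2)"
      using assms by (intro Bochner_Integration.integrable_add integrable_mult_right L2_integrable_square)
    have "(cmod (F p + G p))^2 \<le> 2 * (cmod (F p))^2 + 2 * (cmod (G p))^2" for p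
    proof -
      have "(cmod (F p + G p))^2 \<le> (cmod (F p) + cmod (G p))^2"
        by (intro power_mono norm_triangle_ineq) simp
      also have "\<dots> \<le> 2 * (cmod (F p))^2 + 2 * (cmod (G p))^2"
        using sum_squares_bound[of "cmod (F p)" "cmod (G p)"] by (simp add: power2_sum)
      finally show ?thesis .
    qed
    then show "AE p in lborel. norm ((cmod (F p + G p))^2) \<le> norm (2 * (cmod (F p))^2 + 2 * (cmod (G p))^2)"
      by simp
  qed simp
  then show ?thesis by (simp add: L2_def)
qed

lemma L2_cmult:
  assumes "F \<in> L2" shows "(\<lambda>p. c * F p) \<in> L2"
  using assms by (auto simp: L2_def norm_mult power_mult_distrib)

lemma L2_diff: "F \<in> L2 \<Longrightarrow> G \<in> L2 \<Longrightarrow> (\<lambda>p. F p - G p) \<in> L2"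
  using L2_add[OF _ L2_cmult, of F G "-1"] by simp

lemma L2_zero: "(\<lambda>p. 0) \<in> L2"
  by (simp add: L2_def)

lemma L2_norm_nonneg: "0 \<le> L2_norm F"
  by (simp add: L2_norm_def)

lemma L2_norm_square: "(L2_norm F)^2 = (\<integral>p. (cmod (F p))^2 \<partial>lborel)"
  by (simp add: L2_norm_def)

lemma L2_norm_cmult: "L2_norm (\<lambda>p. c * F p) = cmod c * L2_norm F"
  by (simp add: L2_norm_def norm_mult power_mult_distrib real_sqrt_mult)

lemma L2_integrable_mult:
  assumes "F \<in> L2" "G \<in> L2"
  shows "integrable lborel (\<lambda>p. F p * cnj (G p))"
proof (rule Bochner_Integration.integrable_bound)
  note [measurable] = assms[THEN L2_measurable]
  show "(\<lambda>p. F p * cnj (G p)) \<in> borel_measurable lborel" by measurable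
  show "integrable lborel (\<lambda>p. (cmod (F p))^2 + (cmod (G p))^2)"
    using assms by (intro Bochner_Integration.integrable_add L2_integrable_square)
  have "cmod (F p) * cmod (G p) \<le> (cmod (F p))^2 + (cmod (G p))^2" for p
    using sum_squares_bound[of "cmod (F p)" "cmod (G p)"] mult_nonneg_nonneg[of "cmod (F p)" "cmod (G p)"] 
    by (simp del: mult_nonneg_nonneg) 
  then show "AE p in lborel. norm (F p * cnj (G p)) \<le> norm ((cmod (F p))^2 + (cmod (G p))^2)"
    by (simp add: norm_mult)
qed

definition L2_inner :: "phase_fun \<Rightarrow> phase_fun \<Rightarrow> complex" where
  "L2_inner F G = (\<integral>p. F p * cnj (G p) \<partial>lborel)"

lemma L2_Cauchy_Schwarz:
  assumes "F \<in> L2" "G \<in> L2"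
  shows "cmod (L2_inner F G) \<le> L2_norm F * L2_norm G"
proof (rule power2_le_imp_le)
  note [measurable] = assms[THEN L2_measurable]
  have sq: "(\<integral>\<^sup>+p. ennreal (cmod (H p)) ^ 2 \<partial>lborel) = ennreal ((L2_norm H)^2)" if "H \<in> L2" for H
    unfolding L2_norm_square using that
    by (subst nn_integral_eq_integral[symmetric]) (auto simp: ennreal_power L2_integrable_square)
  have "ennreal (cmod (L2_inner F G)) \<le> (\<integral>\<^sup>+p. ennreal (cmod (F p)) * ennreal (cmod (G p)) \<partial>lborel)"
    using integral_norm_bound_ennreal[OF L2_integrable_mult[OF assms]]
    by (simp add: L2_inner_def norm_mult ennreal_mult)
  then have "ennreal (cmod (L2_inner F G)) ^ 2 \<le> (\<integral>\<^sup>+p. ennreal (cmod (F p)) * ennreal (cmod (G p)) \<partial>lborel) ^ 2"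
    by (rule power_mono) simp
  also have "\<dots> \<le> ennreal ((L2_norm F)^2) * ennreal ((L2_norm G)^2)"
    unfolding sq[OF assms(1), symmetric] sq[OF assms(2), symmetric] by (rule Cauchy_Schwarz_nn_integral) measurable
  finally show "(cmod (L2_inner F G))^2 \<le> (L2_norm F * L2_norm G)^2"
    by (simp add: ennreal_power power_mult_distrib flip: ennreal_mult)
qed (simp add: L2_norm_nonneg)

lemma L2_inner_add_left:
  assumes "F \<in> L2" "G \<in> L2" "H \<in> L2"
  shows "L2_inner (\<lambda>p. F p + G p) H = L2_inner F H + L2_inner G H"
  using assms by (simp add: L2_inner_def distrib_right L2_integrable_mult)

lemma L2_inner_diff_left:
  assumes "F \<in> L2" "G \<in> L2" "H \<in> L2"
  shows "L2_inner (\<lambda>p. F p - G p) H = L2_inner F H - L2_inner G H"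
  using assms by (simp add: L2_inner_def left_diff_distrib L2_integrable_mult)

lemma L2_inner_diff_right:
  assumes "F \<in> L2" "G \<in> L2" "H \<in> L2"
  shows "L2_inner H (\<lambda>p. F p - G p) = L2_inner H F - L2_inner H G"
  using assms by (simp add: L2_inner_def right_diff_distrib L2_integrable_mult)

lemma L2_inner_cmult_left: "L2_inner (\<lambda>p. c * F p) G = c * L2_inner F G"
  by (simp add: L2_inner_def mult.assoc)

lemma L2_norm_add_square:
  assumes "F \<in> L2" "G \<in> L2"
  shows "(L2_norm (\<lambda>p. F p + G p))^2 = (L2_norm F)^2 + 2 * Re (L2_inner G F) + (L2_norm G)^2"
proof -
  have *: "(cmod (F p + G p))^2 = (cmod (F p))^2 + 2 * Re (G p * cnj (F p)) + (cmod (G p))^2" for p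
    by (simp add: cmod_power2) (simp add: power2_eq_square algebra_simps)
  have i: "integrable lborel (\<lambda>p. Re (G p * cnj (F p)))"
    using L2_integrable_mult[OF assms(2,1)] by (rule Bochner_Integration.integrable_Re)
  have "Re (L2_inner G F) = (\<integral>p. Re (G p * cnj (F p)) \<partial>lborel)"
    using L2_integrable_mult[OF assms(2,1)] by (simp only: L2_inner_def integral_Re)
  then show ?thesis
    unfolding L2_norm_square * using i assms[THEN L2_integrable_square]
    by (subst Bochner_Integration.integral_add | simp del: times_complex.sel complex_cnj)+
qed

lemma L2_norm_triangle:
  assumes "F \<in> L2" "G \<in> L2"
  shows "L2_norm (\<lambda>p. F p + G p) \<le> L2_norm F + L2_norm G"
proof (rule power2_le_imp_le)
  have "Re (L2_inner G F) \<le> L2_norm G * L2_norm F"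
    using L2_Cauchy_Schwarz[OF assms(2,1)] complex_Re_le_cmod order_trans by blast
  then show "(L2_norm (\<lambda>p. F p + G p))^2 \<le> (L2_norm F + L2_norm G)^2"
    unfolding L2_norm_add_square[OF assms] power2_sum by (simp add: mult_ac)
qed (simp add: L2_norm_nonneg)

lemma L2_norm_triangle_diff:
  assumes "F \<in> L2" "G \<in> L2"
  shows "L2_norm (\<lambda>p. F p - G p) \<le> L2_norm F + L2_norm G"
  using L2_norm_triangle[OF assms(1) L2_cmult[OF assms(2), of "-1"]]
  by (simp add: L2_norm_cmult[of "-1", simplified])

section \<open>Square integrability from weighted pointwise bounds\<close>

definition weight :: "real \<times> real \<Rightarrow> real" where
  "weight = (\<lambda>(x, y). inverse (1 + x^2) * inverse (1 + y^2))"

lemma weight_nonneg: "0 \<le> weight p" and weight_le_1: "weight p \<le> 1"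
  unfolding weight_def case_prod_beta by (auto intro!: mult_le_one simp: inverse_le_1_iff)

lemma has_bochner_integral_weight: "has_bochner_integral lborel weight (pi^2)"
proof -
  have "has_bochner_integral (lborel \<Otimes>\<^sub>M lborel) weight (pi^2)"
  proof -
    have "integrable (lborel \<Otimes>\<^sub>M lborel) (\<lambda>(x, y). inverse (1 + x^2) * inverse (1 + y^2) :: real)"
      by (intro lborel_pair.Fubini_integrable)
        (auto simp: abs_mult intro!: integrable_mult_right integrable_mult_left integrable_inverse_one_plus_square)
    then show ?thesis
      unfolding has_bochner_integral_iff weight_def
      by (auto simp: lborel_pair.integral_fst'[symmetric] integrable_inverse_one_plus_square power2_eq_square[of pi])
  qed
  then show ?thesis by (simp add: lborel_prod)
qed

text \<open>Since \<open>weight\<close> is at most 1, its square is dominated by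
  \<open>weight\<close> itself, whose integral is \<pi>^2; this is the origin of the constant \<pi>.
  The norms of all explicitly known smooth functions and difference quotients are estimated in this
  way.\<close>

lemma L2_weight_bound:
  assumes "F \<in> borel_measurable lborel" "\<And>p. cmod (F p) \<le> K * weight p"
  shows "F \<in> L2" "L2_norm F \<le> K * pi"
proof -
  have K: "K \<ge> 0"
    using order_trans[OF norm_ge_zero assms(2)[of "(0, 0)"]] by (simp add: weight_def)
  have le: "(cmod (F p))^2 \<le> K^2 * weight p" for p
  proof -
    have "(cmod (F p))^2 \<le> (K * weight p)^2" by (intro power_mono assms) simp
    also have "\<dots> = K^2 * (weight p * weight p)" by (simp add: power2_eq_square)
    also have "\<dots> \<le> K^2 * weight p"
      using weight_nonneg[of p] weight_le_1[of p] by (intro mult_left_mono mult_left_le) auto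
    finally show ?thesis .
  qed
  have iw: "integrable lborel (\<lambda>p. K^2 * weight p)"
    using has_bochner_integral_weight by (auto simp: has_bochner_integral_iff)
  have "integrable lborel (\<lambda>p. (cmod (F p))^2)"
  proof (rule Bochner_Integration.integrable_bound[OF iw])
    show "(\<lambda>p. (cmod (F p))^2) \<in> borel_measurable lborel" using assms(1) by simp
    show "AE p in lborel. norm ((cmod (F p))^2) \<le> norm (K^2 * weight p)"
      using le weight_nonneg by (auto simp: abs_mult)
  qed
  then show "F \<in> L2" using assms(1) by (simp add: L2_def)
  have "(\<integral>p. (cmod (F p))^2 \<partial>lborel) \<le> (\<integral>p. K^2 * weight p \<partial>lborel)"
    by (intro integral_mono iw \<open>integrable lborel (\<lambda>p. (cmod (F p))^2)\<close> le)
  also have "\<dots> = (K * pi)^2"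
    using has_bochner_integral_weight by (simp add: has_bochner_integral_iff power_mult_distrib)
  finally have "(L2_norm F)^2 \<le> (K * pi)^2" by (simp add: L2_norm_square)
  then show "L2_norm F \<le> K * pi" by (rule power2_le_imp_le) (simp add: K)
qed

section \<open>Differentiation in the norm of L2\<close>

definition has_L2_derivative :: "(real \<Rightarrow> phase_fun) \<Rightarrow> phase_fun \<Rightarrow> real \<Rightarrow> bool" where
  "has_L2_derivative Z X t \<longleftrightarrow>
     ((\<lambda>h. L2_norm (\<lambda>p. (Z (t + h) p - Z t p) / of_real h - X p)) \<longlongrightarrow> 0) (at 0)"

text \<open>Membership in L2 is asked at positive times, which is all that a solution provides. It
  is what makes \<open>L2_norm\<close> meaningful and the triangle inequality valid; since
  \<open>t > 0\<close>, the time \<open>t + h\<close> is positive for all small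
  \<open>h\<close>.\<close>

lemma has_L2_derivative_lincomb:
  assumes Z: "has_L2_derivative Z X t" "has_L2_derivative Z' X' t"
    and L2: "\<And>s. s > 0 \<Longrightarrow> Z s \<in> L2" "\<And>s. s > 0 \<Longrightarrow> Z' s \<in> L2" "X \<in> L2" "X' \<in> L2" "t > 0"
  shows "has_L2_derivative (\<lambda>t p. Z t p + c * Z' t p) (\<lambda>p. X p + c * X' p) t"
proof -
  let ?q = "\<lambda>h p. (Z (t + h) p + c * Z' (t + h) p - (Z t p + c * Z' t p)) / of_real h - (X p + c * X' p)"
  define q where "q Z X h = (\<lambda>p. (Z (t + h) p - Z t p) / of_real h - X p)"
    for Z :: "real \<Rightarrow> phase_fun" and X h
  have q: "((\<lambda>h. L2_norm (q Z X h) + cmod c * L2_norm (q Z' X' h)) \<longlongrightarrow> 0 + cmod c * 0) (at 0)"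
    using Z unfolding has_L2_derivative_def q_def by (intro tendsto_intros)
  have qL2: "q Z X h \<in> L2" if "t + h > 0" "\<And>s. s > 0 \<Longrightarrow> Z s \<in> L2" "X \<in> L2" for Z X h
    unfolding q_def divide_inverse
    using that \<open>t > 0\<close> L2_cmult[OF L2_diff, of "Z (t + h)" "Z t" "inverse (of_real h)"]
    by (intro L2_diff) (simp_all add: mult.commute)
  have ev: "\<forall>\<^sub>F h in at 0. t + h > 0"
    using \<open>t > 0\<close> by (intro eventually_at_in_open'[of "{-t<..}" 0, THEN eventually_mono]) auto
  show ?thesis
    unfolding has_L2_derivative_def
  proof (rule tendsto_sandwich[OF _ _ tendsto_const])
    show "\<forall>\<^sub>F h in at 0. 0 \<le> L2_norm (?q h)"
      by (simp add: L2_norm_nonneg)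
    show "\<forall>\<^sub>F h in at 0. L2_norm (?q h)
      \<le> L2_norm (q Z X h) + cmod c * L2_norm (q Z' X' h)"
      using ev
    proof eventually_elim
      case (elim h)
      have "(?q h)
        = (\<lambda>p. q Z X h p + c * q Z' X' h p)"
        by (simp add: q_def fun_eq_iff diff_divide_distrib add_divide_distrib algebra_simps)
      then show ?case
        using L2_norm_triangle[OF qL2 L2_cmult[OF qL2], of h Z X h Z' X' c] elim L2
        by (simp add: L2_norm_cmult)
    qed
    show "((\<lambda>h. L2_norm (q Z X h) + cmod c * L2_norm (q Z' X' h)) \<longlongrightarrow> 0) (at 0)"
      using q by simp
  qed
qed

lemma has_L2_derivative_cong:
  assumes "has_L2_derivative Z X t" "\<And>s. s > 0 \<Longrightarrow> Y s = Z s" "t > 0"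
  shows "has_L2_derivative Y X t"
proof -
  have ev: "\<forall>\<^sub>F h in at 0. t + h > 0"
    using \<open>t > 0\<close> by (intro eventually_at_in_open'[of "{-t<..}" 0, THEN eventually_mono]) auto
  show ?thesis
    unfolding has_L2_derivative_def
    by (rule tendsto_cong[THEN iffD1, OF _ assms(1)[unfolded has_L2_derivative_def]])
      (use ev in eventually_elim, use assms in simp)
qed

text \<open>The difference quotient of \<open>\<parallel>R\<parallel>^2\<close> is \<open>2 Re \<langle>Q, R\<rangle> + h \<parallel>Q\<parallel>^2\<close> with \<open>Q\<close> the difference quotient of \<open>R\<close>.\<close>

lemma L2_norm_square_has_derivative:
  assumes R: "\<And>s. s > 0 \<Longrightarrow> R s \<in> L2" and X: "X \<in> L2" and t: "t > 0"
    and D: "has_L2_derivative R X t"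
  shows "((\<lambda>t. (L2_norm (R t))^2) has_real_derivative 2 * Re (L2_inner X (R t))) (at t)"
proof -
  define Q where "Q h = (\<lambda>p. (R (t + h) p - R t p) / of_real h)" for h :: real
  have ev: "\<forall>\<^sub>F h in at 0. t + h > 0 \<and> h \<noteq> 0"
    using t by (intro eventually_conj eventually_at_in_open'[of "{-t<..}" 0, THEN eventually_mono]
       eventually_at_ball'[of 1, THEN eventually_mono]) auto
  have QL2: "Q h \<in> L2" if "t + h > 0" for h
    using L2_cmult[OF L2_diff[OF R[OF that] R[OF t]], of "inverse (of_real h)"]
    by (simp add: Q_def divide_inverse mult.commute)
  have lim: "((\<lambda>h. L2_norm (\<lambda>p. Q h p - X p)) \<longlongrightarrow> 0) (at 0)"
    using D by (simp add: has_L2_derivative_def Q_def)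
  have inner: "((\<lambda>h. L2_inner (Q h) (R t)) \<longlongrightarrow> L2_inner X (R t)) (at 0)"
  proof (rule Lim_null[THEN iffD2], rule Lim_null_comparison)
    show "\<forall>\<^sub>F h in at 0. norm (L2_inner (Q h) (R t) - L2_inner X (R t)) \<le> L2_norm (\<lambda>p. Q h p - X p) * L2_norm (R t)"
      using ev by eventually_elim
       (use L2_Cauchy_Schwarz[OF L2_diff[OF QL2 X] R[OF t]] in \<open>simp add: L2_inner_diff_left QL2 X R t\<close>)
    show "((\<lambda>h. L2_norm (\<lambda>p. Q h p - X p) * L2_norm (R t)) \<longlongrightarrow> 0) (at 0)"
      using tendsto_mult[OF lim tendsto_const[of "L2_norm (R t)"]] by simp
  qed
  \<comment> \<open>The difference quotients converge in norm, hence stay bounded, and the factor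
    \<open>h\<close> makes the quadratic term vanish.\<close>
  have small: "((\<lambda>h. h * (L2_norm (Q h))^2) \<longlongrightarrow> 0) (at 0)"
  proof (rule Lim_null_comparison)
    show "\<forall>\<^sub>F h in at 0. norm (h * (L2_norm (Q h))^2) \<le> \<bar>h\<bar> * (L2_norm (\<lambda>p. Q h p - X p) + L2_norm X)^2"
      using ev
    proof eventually_elim
      case (elim h)
      then have "L2_norm (Q h) \<le> L2_norm (\<lambda>p. Q h p - X p) + L2_norm X"
        using L2_norm_triangle[OF L2_diff[OF QL2 X] X] by simp
      then show ?case
        by (auto simp: abs_mult intro!: mult_left_mono power_mono L2_norm_nonneg)
    qed
    have "((\<lambda>h::real. \<bar>h\<bar> * (L2_norm (\<lambda>p. Q h p - X p) + L2_norm X)^2) \<longlongrightarrow> \<bar>0\<bar> * (0 + L2_norm X)^2) (at 0)"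
      by (intro tendsto_intros lim)
    then show "((\<lambda>h::real. \<bar>h\<bar> * (L2_norm (\<lambda>p. Q h p - X p) + L2_norm X)^2) \<longlongrightarrow> 0) (at 0)" by simp
  qed
  have "((\<lambda>h. 2 * Re (L2_inner (Q h) (R t)) + h * (L2_norm (Q h))^2) \<longlongrightarrow> 2 * Re (L2_inner X (R t)) + 0) (at 0)"
    by (intro tendsto_intros inner small)
  then have "((\<lambda>h. ((L2_norm (R (t + h)))^2 - (L2_norm (R t))^2) / h) \<longlongrightarrow> 2 * Re (L2_inner X (R t)) + 0) (at 0)"
  proof (rule Lim_transform_eventually)
    show "\<forall>\<^sub>F h in at 0. 2 * Re (L2_inner (Q h) (R t)) + h * (L2_norm (Q h))^2 = ((L2_norm (R (t + h)))^2 - (L2_norm (R t))^2) / h"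
      using ev
    proof eventually_elim
      case (elim h)
      have "R (t + h) = (\<lambda>p. R t p + of_real h * Q h p)"
        using elim by (simp add: Q_def fun_eq_iff)
      then have "(L2_norm (R (t + h)))^2 = (L2_norm (R t))^2 + 2 * Re (L2_inner (\<lambda>p. of_real h * Q h p) (R t)) + (L2_norm (\<lambda>p. of_real h * Q h p))^2"
        using L2_norm_add_square[OF R[OF t] L2_cmult[OF QL2], of h "of_real h"] elim by simp
      also have "\<dots> = (L2_norm (R t))^2 + 2 * h * Re (L2_inner (Q h) (R t)) + h^2 * (L2_norm (Q h))^2"
        by (simp add: L2_inner_cmult_left L2_norm_cmult power_mult_distrib)
      finally show ?case using elim by (simp add: field_simps power2_eq_square)
    qed
  qed
  then show ?thesis by (simp add: DERIV_def)
qed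

section \<open>Schwartz functions\<close>

lemma d_xi_eqI:
  assumes "(F has_derivative F') (at p)"
  shows "d_xi F p = F' (1, 0)"
proof -
  have 1: "((\<lambda>x::real. (x, snd p)) has_derivative (\<lambda>h. (h, 0))) (at (fst p))"
    by (auto intro!: derivative_eq_intros)
  have 2: "(F has_derivative F') (at (fst p, snd p))" using assms by simp
  have "((\<lambda>x. F (x, snd p)) has_derivative (\<lambda>h. F' (h, 0))) (at (fst p))"
    using diff_chain_at[OF 1 2] by (simp add: o_def)
  moreover have "F' (h, 0) = h *\<^sub>R F' (1, 0)" for h :: real
    using linear_cmul[OF has_derivative_linear[OF assms], of h "(1, 0)"] by simp
  then have "(\<lambda>h. F' (h, 0)) = (\<lambda>h::real. h *\<^sub>R F' (1, 0))" by (rule ext)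
  ultimately have "((\<lambda>x. F (x, snd p)) has_vector_derivative F' (1, 0)) (at (fst p))"
    by (simp add: has_vector_derivative_def)
  then show ?thesis
    by (simp add: d_xi_def case_prod_beta vector_derivative_at)
qed

lemma d_eta_eqI:
  assumes "(F has_derivative F') (at p)"
  shows "d_eta F p = F' (0, 1)"
proof -
  have 1: "((\<lambda>x::real. (fst p, x)) has_derivative (\<lambda>h. (0, h))) (at (snd p))"
    by (auto intro!: derivative_eq_intros)
  have 2: "(F has_derivative F') (at (fst p, snd p))" using assms by simp
  have "((\<lambda>x. F (fst p, x)) has_derivative (\<lambda>h. F' (0, h))) (at (snd p))"
    using diff_chain_at[OF 1 2] by (simp add: o_def)
  moreover have "F' (0, h) = h *\<^sub>R F' (0, 1)" for h :: real
    using linear_cmul[OF has_derivative_linear[OF assms], of h "(0, 1)"] by simp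
  then have "(\<lambda>h. F' (0, h)) = (\<lambda>h::real. h *\<^sub>R F' (0, 1))" by (rule ext)
  ultimately have "((\<lambda>x. F (fst p, x)) has_vector_derivative F' (0, 1)) (at (snd p))"
    by (simp add: has_vector_derivative_def)
  then show ?thesis
    by (simp add: d_eta_def case_prod_beta vector_derivative_at)
qed

lemma has_derivative_partials:
  assumes "F differentiable (at p)"
  shows "(F has_derivative (\<lambda>h. fst h *\<^sub>R d_xi F p + snd h *\<^sub>R d_eta F p)) (at p)"
proof -
  obtain F' where F': "(F has_derivative F') (at p)"
    using assms by (auto simp: differentiable_def)
  interpret linear F' by (rule has_derivative_linear[OF F'])
  have "F' h = fst h *\<^sub>R d_xi F p + snd h *\<^sub>R d_eta F p" for h
  proof -
    have "h = fst h *\<^sub>R (1, 0) + snd h *\<^sub>R (0, 1)" by (simp add: prod_eq_iff)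
    then have "F' h = F' (fst h *\<^sub>R (1, 0) + snd h *\<^sub>R (0, 1))" by (rule arg_cong)
    also have "\<dots> = fst h *\<^sub>R F' (1, 0) + snd h *\<^sub>R F' (0, 1)" by (simp only: add scale)
    finally show ?thesis by (simp add: d_xi_eqI[OF F'] d_eta_eqI[OF F'])
  qed
  then have "F' = (\<lambda>h. fst h *\<^sub>R d_xi F p + snd h *\<^sub>R d_eta F p)" by auto
  with F' show ?thesis by simp
qed

lemma has_vector_derivative_d_xi:
  assumes "F differentiable (at (x, y))"
  shows "((\<lambda>x. F (x, y)) has_vector_derivative d_xi F (x, y)) (at x within A)"
proof -
  have 1: "((\<lambda>x::real. (x, y)) has_derivative (\<lambda>h. (h, 0))) (at x within A)"
    by (auto intro!: derivative_eq_intros)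
  show ?thesis
    using has_derivative_compose[OF 1 has_derivative_partials[OF assms]]
    by (simp add: has_vector_derivative_def o_def)
qed

lemma has_vector_derivative_d_eta:
  assumes "F differentiable (at (x, y))"
  shows "((\<lambda>y. F (x, y)) has_vector_derivative d_eta F (x, y)) (at y within A)"
proof -
  have 1: "((\<lambda>y::real. (x, y)) has_derivative (\<lambda>h. (0, h))) (at y within A)"
    by (auto intro!: derivative_eq_intros)
  show ?thesis
    using has_derivative_compose[OF 1 has_derivative_partials[OF assms]]
    by (simp add: has_vector_derivative_def o_def)
qed

text \<open>Differentiating \<open>F (x, b) - F (x, a) = \<integral> d_eta F (x, y) dy\<close> under the integral.\<close>

lemma d_eta_d_xi_commute:
  assumes F: "\<And>p. F differentiable (at p)"
    and Fy: "\<And>p. d_eta F differentiable (at p)"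
    and Fyx: "\<And>p. d_xi (d_eta F) differentiable (at p)"
  shows "d_eta (d_xi F) = d_xi (d_eta F)"
proof (rule ext, clarify)
  fix x b :: real
  \<comment> \<open>A base point strictly below \<open>b\<close>: then \<open>b\<close> is interior
    to \<open>{a..b+1}\<close>, and the derivative within that interval is the full
    derivative.\<close>
  define a where "a = b - 1"
  have ab: "a \<le> b" by (simp add: a_def)
  have cont_Fyx: "continuous_on UNIV (d_xi (d_eta F))"
    by (intro differentiable_imp_continuous_on) (use Fyx in \<open>auto simp: differentiable_on_def intro: differentiable_at_withinI\<close>)
  have cont_Fy: "continuous_on UNIV (d_eta F)"
    by (intro differentiable_imp_continuous_on) (use Fy in \<open>auto simp: differentiable_on_def intro: differentiable_at_withinI\<close>)
  have FTC: "((\<lambda>y. d_eta F (x, y)) has_integral (F (x, c) - F (x, a))) {a..c}" if "a \<le> c" for x c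
    using that by (intro fundamental_theorem_of_calculus has_vector_derivative_d_eta F)
  have dF: "d_xi F (x, c) = d_xi F (x, a) + integral {a..c} (\<lambda>y. d_xi (d_eta F) (x, y))"
    if "a \<le> c" for c
  proof -
    have "((\<lambda>x. integral (cbox a c) (\<lambda>y. d_eta F (x, y))) has_vector_derivative
        integral (cbox a c) (\<lambda>y. d_xi (d_eta F) (x, y))) (at x within UNIV)"
    proof (rule leibniz_rule_vector_derivative)
      show "((\<lambda>x. d_eta F (x, y)) has_vector_derivative d_xi (d_eta F) (x, y)) (at x within UNIV)" for x y
        by (intro has_vector_derivative_d_xi Fy)
      show "(\<lambda>y. d_eta F (x, y)) integrable_on cbox a c" for x
        using FTC[OF that, of x] by auto
      show "continuous_on (UNIV \<times> cbox a c) (\<lambda>(x, t). d_xi (d_eta F) (x, t))"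
        using continuous_on_subset[OF cont_Fyx] by (simp add: case_prod_beta)
    qed auto
    moreover have "(\<lambda>x. integral (cbox a c) (\<lambda>y. d_eta F (x, y))) = (\<lambda>x. F (x, c) - F (x, a))"
      using FTC[OF that] by (auto simp: integral_unique)
    moreover have "((\<lambda>x. F (x, c) - F (x, a)) has_vector_derivative (d_xi F (x, c) - d_xi F (x, a))) (at x)"
      by (intro has_vector_derivative_diff has_vector_derivative_d_xi F)
    ultimately show ?thesis
      using vector_derivative_unique_at[of _ _ x] by (force simp: algebra_simps)
  qed
  have "((\<lambda>c. integral {a..c} (\<lambda>y. d_xi (d_eta F) (x, y))) has_vector_derivative d_xi (d_eta F) (x, b))
      (at b within {a..b+1})"
    by (intro integral_has_vector_derivative continuous_on_compose2[OF cont_Fyx] continuous_intros)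
      (auto simp: a_def)
  from has_vector_derivative_add[OF has_vector_derivative_const[of "d_xi F (x, a)"] this]
  have "((\<lambda>c. d_xi F (x, a) + integral {a..c} (\<lambda>y. d_xi (d_eta F) (x, y)))
      has_vector_derivative d_xi (d_eta F) (x, b)) (at b within {a..b+1})"
    by simp
  then have "((\<lambda>c. d_xi F (x, c)) has_vector_derivative d_xi (d_eta F) (x, b)) (at b within {a..b+1})"
    by (rule has_vector_derivative_transform[rotated 2]) (auto intro!: dF ab)
  then have "((\<lambda>c. d_xi F (x, c)) has_vector_derivative d_xi (d_eta F) (x, b)) (at b)"
    by (subst (asm) at_within_Icc_at) (auto simp: a_def)
  then show "d_eta (d_xi F) (x, b) = d_xi (d_eta F) (x, b)"
    by (simp add: d_eta_def vector_derivative_at)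
qed

text \<open>The weights \<open>1 + x^2\<close> are at least 1 and a single exponent governs both
  variables. Raising \<open>n\<close> therefore absorbs linear factors, and the weights can be
  compared with the rotation invariant 1 + x^2 + y^2. The usual family of moments is recovered in
  \<open>decaying_iff\<close>.\<close>

definition decaying :: "phase_fun \<Rightarrow> bool" where
  "decaying F \<longleftrightarrow> (\<forall>n::nat. \<exists>K. \<forall>x y. (1 + x^2) ^ n * (1 + y^2) ^ n * cmod (F (x, y)) \<le> K)"

lemma abs_power_le_one_plus_square_power: "\<bar>x::real\<bar> ^ j \<le> (1 + x^2) ^ j"
proof (rule power_mono)
  have "2 * \<bar>x\<bar> \<le> 1 + \<bar>x\<bar>^2" using sum_squares_bound[of 1 "\<bar>x\<bar>"] by simp
  then show "\<bar>x\<bar> \<le> 1 + x^2" by (simp add: field_simps)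
qed simp

lemma decaying_iff:
  "decaying F \<longleftrightarrow> (\<forall>j k. \<exists>C. \<forall>x y. \<bar>x\<bar> ^ j * \<bar>y\<bar> ^ k * cmod (F (x, y)) \<le> C)"
proof
  assume F: "decaying F"
  show "\<forall>j k. \<exists>C. \<forall>x y. \<bar>x\<bar> ^ j * \<bar>y\<bar> ^ k * cmod (F (x, y)) \<le> C"
  proof (intro allI)
    fix j k :: nat
    obtain K where K: "(1 + x^2) ^ (j + k) * (1 + y^2) ^ (j + k) * cmod (F (x, y)) \<le> K" for x y
      using F unfolding decaying_def by meson
    have le: "\<bar>x\<bar> ^ j \<le> (1 + x^2) ^ (j + k)" "\<bar>x\<bar> ^ k \<le> (1 + x^2) ^ (j + k)" for x :: real
      by (intro order_trans[OF abs_power_le_one_plus_square_power] power_increasing; simp)+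
    have "\<bar>x\<bar> ^ j * \<bar>y\<bar> ^ k * cmod (F (x, y)) \<le> K" for x y
      by (rule order_trans[OF _ K[of x y]]) (intro mult_mono le(1)[of x] le(2)[of y]; simp)
    then show "\<exists>C. \<forall>x y. \<bar>x\<bar> ^ j * \<bar>y\<bar> ^ k * cmod (F (x, y)) \<le> C" by blast
  qed
next
  assume F: "\<forall>j k. \<exists>C. \<forall>x y. \<bar>x\<bar> ^ j * \<bar>y\<bar> ^ k * cmod (F (x, y)) \<le> C"
  show "decaying F"
    unfolding decaying_def
  proof
    fix n :: nat
    obtain C where C: "\<And>j k x y. \<bar>x\<bar> ^ j * \<bar>y\<bar> ^ k * cmod (F (x, y)) \<le> C j k"
      using F by metis
    have le: "(1 + x^2) ^ n \<le> 2 ^ n * (1 + \<bar>x\<bar> ^ (2 * n))" for x :: real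
    proof -
      have "(1 + x^2) ^ n \<le> (2 * max 1 (x^2)) ^ n" by (intro power_mono) auto
      also have "\<dots> \<le> 2 ^ n * (1 + \<bar>x\<bar> ^ (2 * n))"
        unfolding power_mult_distrib by (intro mult_left_mono) (auto simp: max_def power_mult)
      finally show ?thesis .
    qed
    have "(1 + x^2) ^ n * (1 + y^2) ^ n * cmod (F (x, y))
      \<le> 4 ^ n * (C 0 0 + C (2 * n) 0 + C 0 (2 * n) + C (2 * n) (2 * n))" for x y
    proof -
      have "(1 + x^2) ^ n * (1 + y^2) ^ n * cmod (F (x, y))
        \<le> (2 ^ n * (1 + \<bar>x\<bar> ^ (2 * n))) * (2 ^ n * (1 + \<bar>y\<bar> ^ (2 * n))) * cmod (F (x, y))"
        by (intro mult_right_mono mult_mono le) auto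
      also have "\<dots> = 4 ^ n * (\<bar>x\<bar> ^ 0 * \<bar>y\<bar> ^ 0 * cmod (F (x, y)) + \<bar>x\<bar> ^ (2 * n) * \<bar>y\<bar> ^ 0 * cmod (F (x, y))
        + \<bar>x\<bar> ^ 0 * \<bar>y\<bar> ^ (2 * n) * cmod (F (x, y)) + \<bar>x\<bar> ^ (2 * n) * \<bar>y\<bar> ^ (2 * n) * cmod (F (x, y)))"
      proof -
        have "4 ^ n = (2::real) ^ n * 2 ^ n" by (simp flip: power_mult_distrib)
        then show ?thesis by (simp add: algebra_simps)
      qed
      also have "\<dots> \<le> 4 ^ n * (C 0 0 + C (2 * n) 0 + C 0 (2 * n) + C (2 * n) (2 * n))"
        by (intro mult_left_mono add_mono C) simp
      finally show ?thesis .
    qed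
    then show "\<exists>K. \<forall>x y. (1 + x^2) ^ n * (1 + y^2) ^ n * cmod (F (x, y)) \<le> K" by blast
  qed
qed

lemma decaying_lincomb:
  assumes "decaying F" "decaying G"
  shows "decaying (\<lambda>p. F p + c * G p)"
  unfolding decaying_def
proof
  fix n :: nat
  obtain K where K: "\<And>x y. (1 + x^2) ^ n * (1 + y^2) ^ n * cmod (F (x, y)) \<le> K"
    using assms(1) unfolding decaying_def by meson
  obtain L where L: "\<And>x y. (1 + x^2) ^ n * (1 + y^2) ^ n * cmod (G (x, y)) \<le> L"
    using assms(2) unfolding decaying_def by meson
  have "(1 + x^2) ^ n * (1 + y^2) ^ n * cmod (F (x, y) + c * G (x, y)) \<le> K + cmod c * L" for x y
    using add_mono[OF K[of x y] mult_left_mono[OF L[of x y] norm_ge_zero[of c]]]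
      mult_left_mono[OF norm_triangle_ineq[of "F (x, y)" "c * G (x, y)"], of "(1 + x^2) ^ n * (1 + y^2) ^ n"]
    by (simp add: distrib_left norm_mult mult_ac)
  then show "\<exists>K. \<forall>x y. (1 + x^2) ^ n * (1 + y^2) ^ n * cmod (F (x, y) + c * G (x, y)) \<le> K" by blast
qed

lemma decaying_linear_mult:
  assumes "decaying F"
  shows "decaying (\<lambda>p. of_real (a * fst p + b * snd p) * F p)"
  unfolding decaying_def
proof
  fix n :: nat
  obtain K where K: "\<And>x y. (1 + x^2) ^ Suc n * (1 + y^2) ^ Suc n * cmod (F (x, y)) \<le> K"
    using assms unfolding decaying_def by meson
  have "(1 + x^2) ^ n * (1 + y^2) ^ n * cmod (of_real (a * x + b * y) * F (x, y)) \<le> (\<bar>a\<bar> + \<bar>b\<bar>) * K" for x y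
  proof -
    define X where "X = (1 + x^2) * (1 + y^2)"
    have X: "\<bar>x\<bar> \<le> X" "\<bar>y\<bar> \<le> X"
      using abs_power_le_one_plus_square_power[of x 1] abs_power_le_one_plus_square_power[of y 1]
      by (auto simp: X_def algebra_simps intro: order_trans)
    have "\<bar>a * x + b * y\<bar> \<le> \<bar>a\<bar> * \<bar>x\<bar> + \<bar>b\<bar> * \<bar>y\<bar>" by (simp flip: abs_mult)
    also have "\<dots> \<le> \<bar>a\<bar> * X + \<bar>b\<bar> * X" by (intro add_mono mult_left_mono X) auto
    finally have "\<bar>a * x + b * y\<bar> \<le> (\<bar>a\<bar> + \<bar>b\<bar>) * X" by (simp add: distrib_right)
    then have "\<bar>a * x + b * y\<bar> * (X ^ n * cmod (F (x, y))) \<le> (\<bar>a\<bar> + \<bar>b\<bar>) * X * (X ^ n * cmod (F (x, y)))"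
      by (intro mult_right_mono) (auto simp: X_def)
    also have "\<dots> = (\<bar>a\<bar> + \<bar>b\<bar>) * ((1 + x^2) ^ Suc n * (1 + y^2) ^ Suc n * cmod (F (x, y)))"
      by (simp add: X_def power_mult_distrib mult_ac)
    also have "\<dots> \<le> (\<bar>a\<bar> + \<bar>b\<bar>) * K" by (intro mult_left_mono K) simp
    finally show ?thesis by (simp only: X_def power_mult_distrib norm_mult norm_of_real mult_ac)
  qed
  then show "\<exists>K. \<forall>x y. (1 + x^2) ^ n * (1 + y^2) ^ n * cmod (of_real (a * fst (x, y) + b * snd (x, y)) * F (x, y)) \<le> K"
    by auto
qed

text \<open>A coinduction principle: instead of computing iterated derivatives, one exhibits a class
  of differentiable, decaying functions that is closed under both partial derivatives.\<close>

lemma schwartzI: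
  assumes "F \<in> X"
    and X: "\<And>F. F \<in> X \<Longrightarrow> (\<forall>p. F differentiable (at p)) \<and> decaying F \<and> d_xi F \<in> X \<and> d_eta F \<in> X"
  shows "F \<in> schwartz"
proof -
  have "(d_eta ^^ b) F \<in> X" for b
    by (induction b) (use assms in auto)
  then have "(d_xi ^^ a) ((d_eta ^^ b) F) \<in> X" for a b
    by (induction a) (use X in auto)
  with X show ?thesis
    unfolding schwartz_def decaying_iff[symmetric] by blast
qed

lemma schwartz_iff:
  "F \<in> schwartz \<longleftrightarrow> (\<forall>a b. (\<forall>p. ((d_xi ^^ a) ((d_eta ^^ b) F)) differentiable (at p))
     \<and> decaying ((d_xi ^^ a) ((d_eta ^^ b) F)))"
  unfolding schwartz_def decaying_iff by simp

lemma schwartz_differentiable: "F \<in> schwartz \<Longrightarrow> F differentiable (at p)"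
  unfolding schwartz_iff by (metis funpow_0)

lemma schwartz_decaying: "F \<in> schwartz \<Longrightarrow> decaying F"
  unfolding schwartz_iff by (metis funpow_0)

lemma schwartz_d_eta:
  assumes "F \<in> schwartz" shows "d_eta F \<in> schwartz"
proof -
  have "(d_eta ^^ b) (d_eta F) = (d_eta ^^ Suc b) F" for b
    by (simp only: funpow_Suc_right comp_apply)
  with assms show ?thesis unfolding schwartz_iff by (simp del: funpow.simps)
qed

lemma schwartz_d_eta_power: "F \<in> schwartz \<Longrightarrow> (d_eta ^^ k) F \<in> schwartz"
  by (induction k) (auto intro: schwartz_d_eta)

text \<open>In the definition of the class the \<eta>-derivatives are taken first, so an inner
  \<xi>-derivative has to be moved outwards past all of them.\<close>

lemma schwartz_d_xi:
  assumes F: "F \<in> schwartz"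
  shows "d_xi F \<in> schwartz"
proof -
  have "d_eta (d_xi G) = d_xi (d_eta G)" if "G \<in> schwartz" for G
  proof (rule d_eta_d_xi_commute)
    have "(d_xi ^^ 1) ((d_eta ^^ 1) G) differentiable at p" for p
      using that unfolding schwartz_iff by blast
    then show "d_xi (d_eta G) differentiable at p" for p by simp
  qed (use that in \<open>auto intro: schwartz_differentiable schwartz_d_eta\<close>)
  then have comm: "(d_eta ^^ b) (d_xi F) = d_xi ((d_eta ^^ b) F)" for b
    by (induction b) (auto simp: schwartz_d_eta_power F)
  have "(d_xi ^^ a) ((d_eta ^^ b) (d_xi F)) = (d_xi ^^ Suc a) ((d_eta ^^ b) F)" for a b
    by (simp add: comm funpow_Suc_right del: funpow.simps)
  then show ?thesis
    using F unfolding schwartz_iff by (metis (no_types))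
qed

section \<open>Closure properties of the Schwartz class\<close>

lemma d_xi_add:
  assumes "F differentiable (at p)" "G differentiable (at p)"
  shows "d_xi (\<lambda>p. F p + G p) p = d_xi F p + d_xi G p"
  using d_xi_eqI[OF has_derivative_add[OF assms[THEN has_derivative_partials]]] by simp

lemma d_eta_add:
  assumes "F differentiable (at p)" "G differentiable (at p)"
  shows "d_eta (\<lambda>p. F p + G p) p = d_eta F p + d_eta G p"
  using d_eta_eqI[OF has_derivative_add[OF assms[THEN has_derivative_partials]]] by simp

lemma d_xi_cmult:
  assumes "F differentiable (at p)"
  shows "d_xi (\<lambda>p. c * F p) p = c * d_xi F p"
  using d_xi_eqI[OF has_derivative_mult_right[OF assms[THEN has_derivative_partials]]] by simp

lemma d_eta_cmult:
  assumes "F differentiable (at p)"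
  shows "d_eta (\<lambda>p. c * F p) p = c * d_eta F p"
  using d_eta_eqI[OF has_derivative_mult_right[OF assms[THEN has_derivative_partials]]] by simp

lemma schwartz_zero: "(\<lambda>p. 0) \<in> schwartz"
proof (rule schwartzI[of _ "{\<lambda>p. 0}"])
  have "d_xi (\<lambda>p. 0) = (\<lambda>p. 0)" "d_eta (\<lambda>p. 0) = (\<lambda>p. 0)"
    by (auto simp: fun_eq_iff d_xi_def d_eta_def)
  then show "F \<in> {\<lambda>p. 0} \<Longrightarrow> (\<forall>p. F differentiable (at p)) \<and> decaying F \<and> d_xi F \<in> {\<lambda>p. 0} \<and> d_eta F \<in> {\<lambda>p. 0}" for F
    by (auto simp: decaying_def)
qed simp

lemma schwartz_lincomb:
  assumes "F \<in> schwartz" "G \<in> schwartz"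
  shows "(\<lambda>p. F p + c * G p) \<in> schwartz"
proof -
  define X where "X = {\<lambda>p. F p + c * G p |F G. F \<in> schwartz \<and> G \<in> schwartz}"
  have XI: "(\<lambda>p. F p + c * G p) \<in> X" if "F \<in> schwartz" "G \<in> schwartz" for F G
    using that by (auto simp: X_def)
  show ?thesis
  proof (rule schwartzI[of _ X])
    show "(\<lambda>p. F p + c * G p) \<in> X" by (intro XI assms)
  next
    fix H assume "H \<in> X"
    then obtain F G where H: "H = (\<lambda>p. F p + c * G p)" and FG: "F \<in> schwartz" "G \<in> schwartz"
      by (auto simp: X_def)
    have "d_xi H = (\<lambda>p. d_xi F p + c * d_xi G p)" "d_eta H = (\<lambda>p. d_eta F p + c * d_eta G p)"
      unfolding H using FG[THEN schwartz_differentiable]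
      by (auto simp: fun_eq_iff d_xi_add d_eta_add d_xi_cmult d_eta_cmult)
    then have "d_xi H \<in> X" "d_eta H \<in> X"
      by (auto intro!: XI FG schwartz_d_xi schwartz_d_eta)
    then show "(\<forall>p. H differentiable (at p)) \<and> decaying H \<and> d_xi H \<in> X \<and> d_eta H \<in> X"
      unfolding H using FG
      by (intro conjI allI differentiable_add differentiable_mult differentiable_const schwartz_differentiable
          decaying_lincomb schwartz_decaying)
  qed
qed

lemma schwartz_add: "F \<in> schwartz \<Longrightarrow> G \<in> schwartz \<Longrightarrow> (\<lambda>p. F p + G p) \<in> schwartz"
  using schwartz_lincomb[of F G 1] by simp

lemma schwartz_diff: "F \<in> schwartz \<Longrightarrow> G \<in> schwartz \<Longrightarrow> (\<lambda>p. F p - G p) \<in> schwartz"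
  using schwartz_lincomb[of F G "-1"] by simp

lemma schwartz_cmult: "F \<in> schwartz \<Longrightarrow> (\<lambda>p. c * F p) \<in> schwartz"
  using schwartz_lincomb[OF schwartz_zero, of F c] by simp

lemma schwartz_sum:
  assumes "finite I" "\<And>i. i \<in> I \<Longrightarrow> F i \<in> schwartz"
  shows "(\<lambda>p. \<Sum>i\<in>I. F i p) \<in> schwartz"
  using assms by (induction I rule: finite_induct) (auto intro: schwartz_zero schwartz_add)

lemma schwartz_linear_mult:
  assumes "F \<in> schwartz"
  shows "(\<lambda>p. of_real (a * fst p + b * snd p) * F p) \<in> schwartz"
proof -
  \<comment> \<open>The product rule produces a summand without the linear factor; the free summand
    \<open>G\<close> makes the class closed under differentiation.\<close>
  define X where "X = {\<lambda>p. of_real (a * fst p + b * snd p) * F p + G p |F G. F \<in> schwartz \<and> G \<in> schwartz}"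
  have XI: "(\<lambda>p. of_real (a * fst p + b * snd p) * F p + G p) \<in> X" if "F \<in> schwartz" "G \<in> schwartz" for F G
    using that by (auto simp: X_def)
  show ?thesis
  proof (rule schwartzI[of _ X])
    show "(\<lambda>p. of_real (a * fst p + b * snd p) * F p) \<in> X"
      using XI[OF assms schwartz_zero] by simp
  next
    fix H assume "H \<in> X"
    then obtain F G where H: "H = (\<lambda>p. of_real (a * fst p + b * snd p) * F p + G p)" and FG: "F \<in> schwartz" "G \<in> schwartz"
      by (auto simp: X_def)
    have D: "(H has_derivative (\<lambda>h. of_real (a * fst p + b * snd p) * (fst h *\<^sub>R d_xi F p + snd h *\<^sub>R d_eta F p)
        + of_real (a * fst h + b * snd h) * F p + (fst h *\<^sub>R d_xi G p + snd h *\<^sub>R d_eta G p))) (at p)" for p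
      unfolding H by (rule has_derivative_eq_rhs)
        (auto intro!: derivative_eq_intros FG[THEN schwartz_differentiable, THEN has_derivative_partials])
    have "d_xi H = (\<lambda>p. of_real (a * fst p + b * snd p) * d_xi F p + (of_real a * F p + d_xi G p))"
      "d_eta H = (\<lambda>p. of_real (a * fst p + b * snd p) * d_eta F p + (of_real b * F p + d_eta G p))"
      using D[THEN d_xi_eqI] D[THEN d_eta_eqI] by (auto simp: fun_eq_iff)
    then have "d_xi H \<in> X" "d_eta H \<in> X"
      by (simp_all only: XI FG schwartz_d_xi schwartz_d_eta schwartz_add schwartz_cmult)
    moreover have "decaying H"
      unfolding H using decaying_lincomb[OF decaying_linear_mult, of F G a b 1] FG[THEN schwartz_decaying] by simp
    ultimately show "(\<forall>p. H differentiable (at p)) \<and> decaying H \<and> d_xi H \<in> X \<and> d_eta H \<in> X"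
      using D unfolding differentiable_def by blast
  qed
qed

lemma schwartz_xi_mult: "F \<in> schwartz \<Longrightarrow> (\<lambda>p. of_real (fst p) * F p) \<in> schwartz"
  and schwartz_eta_mult: "F \<in> schwartz \<Longrightarrow> (\<lambda>p. of_real (snd p) * F p) \<in> schwartz"
  using schwartz_linear_mult[of F 1 0] schwartz_linear_mult[of F 0 1] by simp_all

lemma continuous_schwartz: "F \<in> schwartz \<Longrightarrow> continuous_on A F"
  by (meson differentiable_imp_continuous_on differentiable_on_def differentiable_at_withinI schwartz_differentiable)

section \<open>Rotated Schwartz functions\<close>

lemma harmonic_flow_minus: "harmonic_flow (- t) p = (fst p * cos t - snd p * sin t, snd p * cos t + fst p * sin t)"
  by (simp add: harmonic_flow_def case_prod_beta)

lemma harmonic_flow_minus_has_derivative: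
  "(harmonic_flow (- t) has_derivative
    (\<lambda>h. (fst h * cos t - snd h * sin t, snd h * cos t + fst h * sin t))) (at p)"
  unfolding harmonic_flow_minus[abs_def] by (auto intro!: derivative_eq_intros)

lemma harmonic_term_has_derivative:
  assumes "F differentiable (at (harmonic_flow (- t) p))"
  shows "(harmonic_term F t has_derivative (\<lambda>h.
      (fst h * cos t - snd h * sin t) *\<^sub>R harmonic_term (d_xi F) t p +
      (snd h * cos t + fst h * sin t) *\<^sub>R harmonic_term (d_eta F) t p)) (at p)"
  using has_derivative_compose[OF harmonic_flow_minus_has_derivative[of t p] has_derivative_partials[OF assms]]
  by (simp add: harmonic_term_def)

lemma d_xi_harmonic_term:
  assumes "F \<in> schwartz"
  shows "d_xi (harmonic_term F t) p = of_real (cos t) * harmonic_term (d_xi F) t p + of_real (sin t) * harmonic_term (d_eta F) t p"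
  using d_xi_eqI[OF harmonic_term_has_derivative[OF schwartz_differentiable[OF assms]], of t p]
  by (simp add: scaleR_conv_of_real)

lemma d_eta_harmonic_term:
  assumes "F \<in> schwartz"
  shows "d_eta (harmonic_term F t) p = - of_real (sin t) * harmonic_term (d_xi F) t p + of_real (cos t) * harmonic_term (d_eta F) t p"
  using d_eta_eqI[OF harmonic_term_has_derivative[OF schwartz_differentiable[OF assms]], of t p]
  by (simp add: scaleR_conv_of_real)

lemma harmonic_flow_norm:
  "(fst (harmonic_flow t p))^2 + (snd (harmonic_flow t p))^2 = (fst p)^2 + (snd p)^2"
proof -
  have "(a * c + b * s)^2 + (b * c - a * s)^2 = (a^2 + b^2) * (s^2 + c^2)" for a b s c :: real
    by algebra
  then show ?thesis by (simp add: harmonic_flow_def case_prod_beta)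
qed

text \<open>Polynomial weights are comparable to powers of the rotation invariant \<open>1 + x^2 + y^2\<close>,
  hence the uniformity in \<open>t\<close>.\<close>

lemma harmonic_term_decay:
  assumes "decaying F"
  shows "\<exists>K\<ge>0. \<forall>t x y. (1 + x^2) ^ n * (1 + y^2) ^ n * cmod (harmonic_term F t (x, y)) \<le> K"
proof -
  \<comment> \<open>The exponent doubles because the product of the two weights at the original
    point is bounded only by the square of the rotation invariant.\<close>
  obtain K where K: "\<And>x y. (1 + x^2) ^ (2*n) * (1 + y^2) ^ (2*n) * cmod (F (x, y)) \<le> K"
    using assms unfolding decaying_def by meson
  have "(1 + x^2) ^ n * (1 + y^2) ^ n * cmod (harmonic_term F t (x, y)) \<le> K" for t x y
  proof -
    obtain a b where ab: "harmonic_flow (- t) (x, y) = (a, b)" by fastforce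
    have eq: "a^2 + b^2 = x^2 + y^2" using harmonic_flow_norm[of "- t" "(x, y)"] by (simp add: ab)
    have "(1 + x^2) * (1 + y^2) \<le> (1 + (x^2 + y^2))^2"
    proof -
      have "(1 + (x^2 + y^2))^2 = (1 + x^2) * (1 + y^2) + (x^2 + y^2 + x^2 * x^2 + y^2 * y^2 + x^2 * y^2)"
        by (simp add: power2_eq_square algebra_simps)
      then show ?thesis by simp
    qed
    also have "\<dots> \<le> ((1 + a^2) * (1 + b^2))^2"
      unfolding eq[symmetric] by (intro power_mono) (auto simp: algebra_simps)
    finally have "((1 + x^2) * (1 + y^2)) ^ n \<le> (((1 + a^2) * (1 + b^2))^2) ^ n"
      by (intro power_mono) auto
    then have "(1 + x^2) ^ n * (1 + y^2) ^ n \<le> (1 + a^2) ^ (2*n) * (1 + b^2) ^ (2*n)"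
      by (simp add: power_mult_distrib power_mult[symmetric])
    from mult_right_mono[OF this, of "cmod (F (a, b))"] K[of a b] show ?thesis
      by (simp add: harmonic_term_def ab)
  qed
  moreover have "0 \<le> K" using K[of 0 0] by (simp add: order_trans[OF norm_ge_zero])
  ultimately show ?thesis by blast
qed

lemma decaying_harmonic_term:
  assumes "decaying F" shows "decaying (harmonic_term F t)"
  unfolding decaying_def using harmonic_term_decay[OF assms] by meson

lemma schwartz_harmonic_term:
  assumes "F \<in> schwartz"
  shows "harmonic_term F t \<in> schwartz"
proof (rule schwartzI[of _ "{harmonic_term F t |F. F \<in> schwartz}"])
  let ?X = "{harmonic_term F t |F. F \<in> schwartz}"
  show "harmonic_term F t \<in> ?X" using assms by auto
  fix H assume "H \<in> ?X"
  then obtain F where H: "H = harmonic_term F t" and F: "F \<in> schwartz" by auto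
  have "d_xi H = harmonic_term (\<lambda>p. of_real (cos t) * d_xi F p + of_real (sin t) * d_eta F p) t"
    unfolding H by (rule ext, unfold d_xi_harmonic_term[OF F]) (simp add: harmonic_term_def)
  moreover have "d_eta H = harmonic_term (\<lambda>p. (- of_real (sin t)) * d_xi F p + of_real (cos t) * d_eta F p) t"
    unfolding H by (rule ext, unfold d_eta_harmonic_term[OF F]) (simp add: harmonic_term_def)
  moreover have "(\<lambda>p. c * d_xi F p + d * d_eta F p) \<in> schwartz" for c d
    by (intro schwartz_add schwartz_cmult schwartz_d_xi schwartz_d_eta F)
  moreover have "H differentiable (at p)" for p
    using harmonic_term_has_derivative[OF schwartz_differentiable[OF F]] unfolding H differentiable_def by blast
  moreover have "decaying H" unfolding H by (intro decaying_harmonic_term schwartz_decaying F)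
  ultimately show "(\<forall>p. H differentiable (at p)) \<and> decaying H \<and> d_xi H \<in> ?X \<and> d_eta H \<in> ?X" by blast
qed

text \<open>The classical Liouville operator of the harmonic oscillator, which generates the
  rotations \<open>harmonic_term F t\<close>. It is also the part of the Wigner operator of order
  zero in \<open>sqrt \<epsilon>\<close>.\<close>

definition L_harm :: "phase_fun \<Rightarrow> phase_fun" where
  "L_harm F = (\<lambda>p. of_real (snd p) * d_xi F p - of_real (fst p) * d_eta F p)"

lemma schwartz_L_harm: "F \<in> schwartz \<Longrightarrow> L_harm F \<in> schwartz"
  unfolding L_harm_def
  by (intro schwartz_diff schwartz_xi_mult schwartz_eta_mult schwartz_d_xi schwartz_d_eta)

lemma L_harm_add:
  assumes "F \<in> schwartz" "G \<in> schwartz"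
  shows "L_harm (\<lambda>p. F p + G p) = (\<lambda>p. L_harm F p + L_harm G p)"
  by (simp add: fun_eq_iff L_harm_def d_xi_add d_eta_add schwartz_differentiable assms algebra_simps)

lemma L_harm_cmult:
  assumes "F \<in> schwartz"
  shows "L_harm (\<lambda>p. c * F p) = (\<lambda>p. c * L_harm F p)"
  by (simp add: fun_eq_iff L_harm_def d_xi_cmult d_eta_cmult schwartz_differentiable assms algebra_simps)

text \<open>A flow commutes with its generator: pairing the rotated gradient with the vector
  (\<eta>, -\<xi>) is pairing the gradient with the rotated vector.\<close>

lemma L_harm_harmonic_term:
  assumes "F \<in> schwartz"
  shows "L_harm (harmonic_term F t) = harmonic_term (L_harm F) t"
  by (auto simp: fun_eq_iff L_harm_def d_xi_harmonic_term[OF assms] d_eta_harmonic_term[OF assms])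
    (simp add: harmonic_term_def harmonic_flow_minus algebra_simps)

lemma harmonic_term_time_derivative:
  assumes "F \<in> schwartz"
  shows "((\<lambda>t. harmonic_term F t p) has_vector_derivative - harmonic_term (L_harm F) t p) (at t)"
proof -
  have 1: "((\<lambda>t. harmonic_flow (- t) p) has_derivative
    (\<lambda>h. h *\<^sub>R (- snd (harmonic_flow (- t) p), fst (harmonic_flow (- t) p)))) (at t)"
    unfolding harmonic_flow_minus by (auto intro!: derivative_eq_intros simp: algebra_simps)
  show ?thesis
    using has_derivative_compose[OF 1 has_derivative_partials[OF schwartz_differentiable[OF assms]]]
    by (simp add: has_vector_derivative_def harmonic_term_def L_harm_def scaleR_conv_of_real algebra_simps)
qed

text \<open>The inductive form turns every closure property into an induction with three cases and
  avoids bookkeeping for finite sums. Only the scalar \<open>c\<close> and the rotation depend on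
  time, so bounds uniform in time for rotated Schwartz functions leave \<open>c\<close> as the sole
  source of growth. The rule \<open>cong\<close> compares nonnegative times, the ones at which
  \<open>c\<close> is controlled.\<close>

inductive rot_family :: "(real \<Rightarrow> phase_fun) \<Rightarrow> bool" where
  basic: "\<phi> \<in> schwartz \<Longrightarrow> (\<And>b. continuous_on {0..b} c) \<Longrightarrow> (\<And>t. t \<ge> 0 \<Longrightarrow> cmod (c t) \<le> K * exp t)
    \<Longrightarrow> rot_family (\<lambda>t p. c t * harmonic_term \<phi> t p)"
| add: "rot_family Z \<Longrightarrow> rot_family Y \<Longrightarrow> rot_family (\<lambda>t p. Z t p + Y t p)"
| cong: "rot_family Z \<Longrightarrow> (\<And>t. t \<ge> 0 \<Longrightarrow> Y t = Z t) \<Longrightarrow> rot_family Y"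

lemma rot_family_schwartz: "rot_family Z \<Longrightarrow> t \<ge> 0 \<Longrightarrow> Z t \<in> schwartz"
  by (induction rule: rot_family.induct)
    (auto intro: schwartz_cmult schwartz_add schwartz_harmonic_term)

lemma rot_family_decay:
  assumes "rot_family Z"
  shows "\<exists>K\<ge>0. \<forall>t\<ge>0. \<forall>x y. (1 + x^2) ^ n * (1 + y^2) ^ n * cmod (Z t (x, y)) \<le> K * exp t"
  using assms
proof induction
  case (basic \<phi> c K)
  obtain L where L: "L \<ge> 0" "\<And>t x y. (1 + x^2) ^ n * (1 + y^2) ^ n * cmod (harmonic_term \<phi> t (x, y)) \<le> L"
    using harmonic_term_decay[OF schwartz_decaying[OF basic(1)]] by blast
  have "0 \<le> K" using order_trans[OF norm_ge_zero basic(3)[of 0]] by simp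
  moreover have "(1 + x^2) ^ n * (1 + y^2) ^ n * cmod (c t * harmonic_term \<phi> t (x, y)) \<le> (L * K) * exp t"
    if "t \<ge> 0" for t x y
    using mult_mono[OF L(2)[of x y t] basic(3)[OF that]] L(1) by (simp add: norm_mult mult_ac)
  ultimately show ?case using L(1) by (intro exI[of _ "L * K"]) auto
next
  case (add Z Y)
  then obtain K L where K: "K \<ge> 0" "\<And>t x y. t \<ge> 0 \<Longrightarrow> (1 + x^2) ^ n * (1 + y^2) ^ n * cmod (Z t (x, y)) \<le> K * exp t"
    and L: "L \<ge> 0" "\<And>t x y. t \<ge> 0 \<Longrightarrow> (1 + x^2) ^ n * (1 + y^2) ^ n * cmod (Y t (x, y)) \<le> L * exp t" by blast
  have "(1 + x^2) ^ n * (1 + y^2) ^ n * cmod (Z t (x, y) + Y t (x, y)) \<le> (K + L) * exp t"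
    if "t \<ge> 0" for t x y
    using add_mono[OF K(2)[OF that, of x y] L(2)[OF that, of x y]]
      mult_left_mono[OF norm_triangle_ineq[of "Z t (x, y)" "Y t (x, y)"], of "(1 + x^2) ^ n * (1 + y^2) ^ n"]
    by (simp add: algebra_simps)
  then show ?case using K(1) L(1) by (intro exI[of _ "K + L"]) auto
next
  case (cong Z Y)
  then show ?case by auto
qed

lemma rot_family_harmonic_term: "\<phi> \<in> schwartz \<Longrightarrow> rot_family (harmonic_term \<phi>)"
  using rot_family.basic[of \<phi> "\<lambda>_. 1" 1] by simp

lemma rot_family_cmult: "rot_family Z \<Longrightarrow> rot_family (\<lambda>t p. a * Z t p)"
proof (induction rule: rot_family.induct)
  case (basic \<phi> c K)
  then have "rot_family (\<lambda>t p. c t * harmonic_term (\<lambda>p. a * \<phi> p) t p)"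
    by (intro rot_family.basic schwartz_cmult)
  then show ?case by (simp add: harmonic_term_def mult_ac)
next
  case (add Z Y)
  then show ?case by (simp add: distrib_left rot_family.add)
next
  case (cong Z Y)
  then show ?case by (auto intro: rot_family.cong)
qed

text \<open>Conjugation by the rotation gives this form both to multiplication by \<xi> and to
  differentiation in \<eta>, the two building blocks of \<open>B_op\<close>. Cosine and sine are
  bounded by 1, so the constant \<open>K\<close> survives unchanged.\<close>

lemma rot_family_trig:
  assumes "\<phi> \<in> schwartz" "\<psi> \<in> schwartz" "\<And>b. continuous_on {0..b} c" "\<And>t. t \<ge> 0 \<Longrightarrow> cmod (c t) \<le> K * exp t"
  shows "rot_family (\<lambda>t p. c t * (of_real (cos t) * harmonic_term \<phi> t p + of_real (sin t) * harmonic_term \<psi> t p))"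
proof -
  have "K * exp t \<ge> 0" if "t \<ge> 0" for t
    using order_trans[OF norm_ge_zero assms(4)[OF that]] .
  then have "cmod (c t * of_real (cos t)) \<le> K * exp t" "cmod (c t * of_real (sin t)) \<le> K * exp t" if "t \<ge> 0" for t
    using mult_mono[OF assms(4)[OF that] abs_cos_le_one[of t]] mult_mono[OF assms(4)[OF that] abs_sin_le_one[of t]] that
    by (auto simp: norm_mult)
  then have "rot_family (\<lambda>t p. (c t * of_real (cos t)) * harmonic_term \<phi> t p + (c t * of_real (sin t)) * harmonic_term \<psi> t p)"
    using assms by (intro rot_family.add rot_family.basic[where K = K] continuous_intros) auto
  then show ?thesis by (simp add: algebra_simps)
qed

lemma rot_family_xi_mult: "rot_family Z \<Longrightarrow> rot_family (\<lambda>t p. of_real (fst p) * Z t p)"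
proof (induction rule: rot_family.induct)
  case (basic \<phi> c K)
  \<comment> \<open>The coordinate \<xi> is recovered from the rotated coordinates by the inverse
    rotation.\<close>
  have *: "c t * (of_real (cos t) * harmonic_term (\<lambda>p. of_real (fst p) * \<phi> p) t p +
      of_real (sin t) * harmonic_term (\<lambda>p. of_real (snd p) * \<phi> p) t p)
    = of_real (fst p) * (c t * harmonic_term \<phi> t p)" for t p
  proof -
    have "fst p * ((cos t)^2 + (sin t)^2) = cos t * (fst p * cos t - snd p * sin t) + sin t * (snd p * cos t + fst p * sin t)"
      by (simp only: power2_eq_square algebra_simps)
    then have "fst p = cos t * (fst p * cos t - snd p * sin t) + sin t * (snd p * cos t + fst p * sin t)" by simp
    from arg_cong[OF this, of "\<lambda>r. c t * (of_real r * harmonic_term \<phi> t p)", symmetric] show ?thesis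
      by (simp add: harmonic_term_def harmonic_flow_minus distrib_left distrib_right mult.assoc)
  qed
  show ?case
    using rot_family_trig[OF schwartz_xi_mult schwartz_eta_mult, OF basic(1) basic(1) basic(2), of K] basic(3) by (simp only: *)
next
  case (add Z Y)
  then show ?case by (simp add: distrib_left rot_family.add)
next
  case (cong Z Y)
  then show ?case by (auto intro: rot_family.cong)
qed

lemma rot_family_d_eta: "rot_family Z \<Longrightarrow> rot_family (\<lambda>t. d_eta (Z t))"
proof (induction rule: rot_family.induct)
  case (basic \<phi> c K)
  have *: "c t * (of_real (cos t) * harmonic_term (d_eta \<phi>) t p + of_real (sin t) * harmonic_term (\<lambda>p. (-1) * d_xi \<phi> p) t p)
    = d_eta (\<lambda>p. c t * harmonic_term \<phi> t p) p" for t p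
    using basic(1)
    by (simp add: d_eta_cmult d_eta_harmonic_term schwartz_harmonic_term schwartz_differentiable)
      (simp add: harmonic_term_def algebra_simps)
  have "rot_family (\<lambda>t p. c t * (of_real (cos t) * harmonic_term (d_eta \<phi>) t p +
      of_real (sin t) * harmonic_term (\<lambda>p. (-1) * d_xi \<phi> p) t p))"
    using basic by (intro rot_family_trig schwartz_d_eta schwartz_cmult schwartz_d_xi)
  then show ?case by (simp only: *)
next
  case (add Z Y)
  have "rot_family (\<lambda>t p. d_eta (Z t) p + d_eta (Y t) p)"
    using add by (intro rot_family.add)
  then show ?case
    by (rule rot_family.cong) (intro ext d_eta_add schwartz_differentiable rot_family_schwartz add)
next
  case (cong Z Y)
  then show ?case by (auto intro: rot_family.cong)
qed

lemma rot_family_d_eta_power: "rot_family Z \<Longrightarrow> rot_family (\<lambda>t. (d_eta ^^ k) (Z t))"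
  by (induction k) (auto dest: rot_family_d_eta)

lemma rot_family_xi_power: "rot_family Z \<Longrightarrow> rot_family (\<lambda>t p. of_real (fst p) ^ k * Z t p)"
  by (induction k) (auto dest: rot_family_xi_mult simp: mult_ac)

lemma rot_family_zero: "rot_family (\<lambda>t p. 0)"
  using rot_family_cmult[OF rot_family_harmonic_term[OF schwartz_zero], of 0] by simp

lemma rot_family_sum:
  assumes "finite I" "\<And>i. i \<in> I \<Longrightarrow> rot_family (Z i)"
  shows "rot_family (\<lambda>t p. \<Sum>i\<in>I. Z i t p)"
  using assms by (induction I rule: finite_induct) (auto intro: rot_family_zero rot_family.add)

text \<open>Scalar, power of \<xi> and \<eta>-derivative are separated to match the closure rules of
  \<open>rot_family\<close>.\<close>

lemma B_op_alt:
  "B_op V \<nu> F = (\<lambda>p. \<Sum>j = 0..(\<nu> - 1) div 2 + 1.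
     (- of_real ((deriv ^^ (\<nu> + 2)) V 0) * ((\<i> / 2) ^ (2 * j) * (1 / fact (2 * j + 1)) / fact (\<nu> + 1 - 2 * j)))
      * (of_real (fst p) ^ (\<nu> + 1 - 2 * j) * (d_eta ^^ (2 * j + 1)) F p))"
  unfolding B_op_def sum_distrib_left case_prod_beta prod.collapse
  by (intro ext sum.cong refl) (simp add: divide_simps)

lemma rot_family_B_op: "rot_family Z \<Longrightarrow> rot_family (\<lambda>t. B_op V \<nu> (Z t))"
  unfolding B_op_alt
  by (intro rot_family_sum rot_family_cmult rot_family_xi_power rot_family_d_eta_power) auto

section \<open>Fourier transforms on the line\<close>

text \<open>The exponent is positive and there is no normalizing factor; hence the constants 2 \<pi>
  in inversion and in the Plancherel bound.\<close>

definition fourier :: "(real \<Rightarrow> complex) \<Rightarrow> real \<Rightarrow> complex" where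
  "fourier f x = (\<integral>z. iexp (x * z) * f z \<partial>lborel)"

lemma integrable_exp_mult:
  assumes f: "integrable lborel f" and [measurable]: "g \<in> borel_measurable borel"
  shows "integrable lborel (\<lambda>z::real. iexp (g z) * f z)"
proof (rule Bochner_Integration.integrable_bound[OF f])
  have [measurable]: "f \<in> borel_measurable borel" using borel_measurable_integrable[OF f] by simp
  show "(\<lambda>z::real. iexp (g z) * f z) \<in> borel_measurable lborel" by simp
qed (simp add: norm_mult)

lemma fourier_bound:
  assumes "integrable lborel f"
  shows "cmod (fourier f x) \<le> (\<integral>z. cmod (f z) \<partial>lborel)"
  unfolding fourier_def
  by (rule order_trans[OF integral_norm_bound]) (simp add: norm_mult)

lemma fourier_add:
  assumes "integrable lborel f" "integrable lborel g"
  shows "fourier (\<lambda>z. f z + g z) x = fourier f x + fourier g x"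
  unfolding fourier_def distrib_left
  by (intro Bochner_Integration.integral_add integrable_exp_mult assms) auto

lemma fourier_cmult: "fourier (\<lambda>z. c * f z) x = c * fourier f x"
  unfolding fourier_def by (simp only: mult.left_commute[of _ c] integral_mult_right_zero)

lemma fourier_sum:
  assumes "\<And>i. i \<in> I \<Longrightarrow> integrable lborel (f i)"
  shows "fourier (\<lambda>z. \<Sum>i\<in>I. f i z) x = (\<Sum>i\<in>I. fourier (f i) x)"
  unfolding fourier_def sum_distrib_left
  by (intro Bochner_Integration.integral_sum integrable_exp_mult assms) auto

lemma borel_measurable_fourier:
  assumes [measurable]: "f \<in> borel_measurable borel"
  shows "fourier f \<in> borel_measurable borel"
  unfolding fourier_def by measurable

text \<open>Fubini, together with the symmetry of the kernel in \<open>x\<close> and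
  \<open>z\<close>. This identity carries the inversion formula, the Plancherel bound and the
  skew-symmetry of the potential term.\<close>

lemma fourier_multiplication:
  assumes f: "integrable lborel f" and g: "integrable lborel g"
  shows "(\<integral>x. g x * fourier f x \<partial>lborel) = (\<integral>z. f z * fourier g z \<partial>lborel)"
proof -
  have [measurable]: "f \<in> borel_measurable borel" "g \<in> borel_measurable borel"
    using borel_measurable_integrable[OF f] borel_measurable_integrable[OF g] by simp_all
  have "integrable (lborel \<Otimes>\<^sub>M lborel) (\<lambda>(x, z). g x * (iexp (x * z) * f z))"
  proof (rule lborel_pair.Fubini_integrable)
    show "(\<lambda>(x, z). g x * (iexp (x * z) * f z)) \<in> borel_measurable (lborel \<Otimes>\<^sub>M lborel)"
      by measurable
    show "integrable lborel (\<lambda>x. \<integral>z. norm (case (x, z) of (x, z) \<Rightarrow> g x * (iexp (x * z) * f z)) \<partial>lborel)"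
      using g by (simp add: norm_mult)
    have "integrable lborel (\<lambda>z. g x * (iexp (x * z) * f z))" for x
      by (intro integrable_mult_right integrable_exp_mult f) simp
    then show "AE x in lborel. integrable lborel (\<lambda>z. case (x, z) of (x, z) \<Rightarrow> g x * (iexp (x * z) * f z))"
      by simp
  qed
  from lborel_pair.Fubini_integral[OF this]
  have "(\<integral>x. (\<integral>z. g x * (iexp (x * z) * f z) \<partial>lborel) \<partial>lborel)
    = (\<integral>z. (\<integral>x. g x * (iexp (x * z) * f z) \<partial>lborel) \<partial>lborel)" by simp
  moreover have "(\<integral>z. g x * (iexp (x * z) * f z) \<partial>lborel) = g x * fourier f x" for x
    unfolding fourier_def by (rule integral_mult_right_zero)
  moreover have "(\<integral>x. g x * (iexp (x * z) * f z) \<partial>lborel) = f z * fourier g z" for z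
    unfolding fourier_def integral_mult_right_zero[symmetric] by (simp add: mult_ac)
  ultimately show ?thesis by (simp only:)
qed

section \<open>The Gaussian, its transform, and regularized inversion\<close>

lemma std_normal_fourier:
  "fourier (\<lambda>z. of_real (exp (- (z^2) / 2))) x = of_real (sqrt (2 * pi) * exp (- (x^2) / 2))"
proof -
  have "(\<integral>z. std_normal_density z *\<^sub>R iexp (x * z) \<partial>lborel) = of_real (exp (- (x^2) / 2))"
    using char_std_normal_distribution[THEN fun_cong, of x]
    unfolding char_def by (subst (asm) integral_density) auto
  moreover have "(\<lambda>z. std_normal_density z *\<^sub>R iexp (x * z))
     = (\<lambda>z. of_real (1 / sqrt (2 * pi)) * (iexp (x * z) * of_real (exp (- (z^2) / 2))))"
    by (simp add: fun_eq_iff std_normal_density_def scaleR_conv_of_real)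
  ultimately have "of_real (1 / sqrt (2 * pi)) * fourier (\<lambda>z. of_real (exp (- (z^2) / 2))) x = of_real (exp (- (x^2) / 2))"
    by (simp only: fourier_def integral_mult_right_zero)
  then show ?thesis by (simp add: field_simps)
qed

lemma integrable_gaussian:
  assumes "d \<noteq> 0"
  shows "integrable lborel (\<lambda>z::real. exp (- ((d * z)^2) / 2))"
    and "(\<integral>z. exp (- ((d * z)^2) / 2) \<partial>lborel) = sqrt (2 * pi) / \<bar>d\<bar>"
proof -
  have eq: "(\<lambda>z. exp (- (z^2) / 2)) = (\<lambda>z. sqrt (2 * pi) * std_normal_density z)"
    by (simp add: fun_eq_iff std_normal_density_def)
  have i: "integrable lborel (\<lambda>z::real. exp (- (z^2) / 2))"
    unfolding eq by simp
  have v: "(\<integral>z. exp (- (z^2) / 2) \<partial>lborel) = sqrt (2 * pi)"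
    unfolding eq by simp
  show "integrable lborel (\<lambda>z::real. exp (- ((d * z)^2) / 2))"
    using lborel_integrable_real_affine[OF i, of d 0] assms by simp
  show "(\<integral>z. exp (- ((d * z)^2) / 2) \<partial>lborel) = sqrt (2 * pi) / \<bar>d\<bar>"
    using lborel_integral_real_affine[of d "\<lambda>z. exp (- (z^2) / 2)" 0] assms v by (simp add: field_simps)
qed

definition gauss :: "real \<Rightarrow> real \<Rightarrow> complex" where
  "gauss d z = of_real (exp (- ((d * z)^2) / 2))"

text \<open>The transform of \<open>gauss d\<close>: a positive kernel of total mass 2 \<pi> that
  concentrates at 0 as \<open>d\<close> tends to 0, while \<open>gauss d\<close> tends to 1.\<close>

definition gauss_kernel :: "real \<Rightarrow> real \<Rightarrow> real" where
  "gauss_kernel d u = sqrt (2 * pi) / d * exp (- ((u / d)^2) / 2)"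

lemma gauss_measurable [measurable]: "gauss d \<in> borel_measurable borel" "gauss_kernel d \<in> borel_measurable borel"
  unfolding gauss_def gauss_kernel_def by measurable

lemma integrable_gauss: "d > 0 \<Longrightarrow> integrable lborel (gauss d)"
  using integrable_gaussian(1)[of d] by (simp add: gauss_def[abs_def] integrable_of_real)

lemma fourier_gauss:
  assumes "d > 0" shows "fourier (gauss d) x = of_real (gauss_kernel d x)"
proof -
  have "fourier (\<lambda>z. of_real (exp (- (z^2) / 2))) (x / d) =
    d *\<^sub>R (\<integral>z. iexp (x / d * (0 + d * z)) * of_real (exp (- ((0 + d * z)^2) / 2)) \<partial>lborel)"
    using assms unfolding fourier_def by (subst lborel_integral_real_affine[of d _ 0]) auto
  also have "\<dots> = d *\<^sub>R fourier (gauss d) x"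
    using assms by (simp add: fourier_def gauss_def)
  finally have "of_real d * fourier (gauss d) x = of_real (sqrt (2 * pi) * exp (- ((x / d)^2) / 2))"
    by (simp only: std_normal_fourier scaleR_conv_of_real)
  then show ?thesis using assms by (simp add: gauss_kernel_def field_simps)
qed

lemma integrable_gauss_kernel:
  assumes "d > 0"
  shows "integrable lborel (gauss_kernel d)" "(\<integral>u. gauss_kernel d u \<partial>lborel) = 2 * pi"
  using integrable_gaussian[of "1 / d"] assms
  by (auto simp: gauss_kernel_def[abs_def] field_simps)

lemma gauss_kernel_nonneg: "d > 0 \<Longrightarrow> gauss_kernel d u \<ge> 0"
  by (simp add: gauss_kernel_def)

lemma gauss_even: "gauss d (- x) = gauss d x"
  by (simp add: gauss_def)

lemma norm_gauss_le: "cmod (gauss d x) \<le> 1"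
  by (simp add: gauss_def)

lemma lborel_integral_reflect: "(\<integral>x. f (- x) \<partial>lborel) = (\<integral>x. f x \<partial>lborel)" for f :: "real \<Rightarrow> complex"
  using lborel_integral_real_affine[of "-1" f 0] by simp

lemma lborel_integral_shift: "(\<integral>x. f (a + x) \<partial>lborel) = (\<integral>x. f x \<partial>lborel)"
  for f :: "real \<Rightarrow> 'a :: {banach, second_countable_topology}"
  using lborel_integral_real_affine[of 1 f a] by simp

text \<open>The Gaussian factor makes the frequency integral absolutely convergent for every
  integrable \<open>f\<close>, so the multiplication formula applies. The modulation by
  \<open>x\<close> becomes a translation of the kernel.\<close>

lemma gauss_regularized_inversion:
  assumes f: "integrable lborel f" and d: "d > 0"
  shows "(\<integral>z. iexp (x * z) * (gauss d z * fourier f (- z)) \<partial>lborel)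
    = (\<integral>y. f y * of_real (gauss_kernel d (y - x)) \<partial>lborel)"
proof -
  have "(\<integral>z. iexp (x * z) * (gauss d z * fourier f (- z)) \<partial>lborel)
      = (\<integral>z. (iexp (- x * z) * gauss d z) * fourier f z \<partial>lborel)"
    by (subst lborel_integral_reflect[symmetric]) (simp add: gauss_even mult_ac)
  also have "\<dots> = (\<integral>y. f y * fourier (\<lambda>z. iexp (- x * z) * gauss d z) y \<partial>lborel)"
    by (rule fourier_multiplication[OF f integrable_exp_mult[OF integrable_gauss[OF d]]]) simp
  also have "fourier (\<lambda>z. iexp (- x * z) * gauss d z) = (\<lambda>y. of_real (gauss_kernel d (y - x)))"
  proof
    fix y
    have "iexp (y * z) * (iexp (- x * z) * gauss d z) = iexp ((y - x) * z) * gauss d z" for z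
      unfolding mult.assoc[symmetric] exp_add[symmetric] by (simp add: algebra_simps)
    then show "fourier (\<lambda>z. iexp (- x * z) * gauss d z) y = of_real (gauss_kernel d (y - x))"
      unfolding fourier_gauss[OF d, symmetric] fourier_def by (simp only:)
  qed
  finally show ?thesis .
qed

section \<open>Fourier inversion and the Plancherel bound\<close>

lemma inverse_Suc_tendsto: "(\<lambda>n. 1 / real (Suc n)) \<longlonglongrightarrow> 0"
  using LIMSEQ_inverse_real_of_nat by (simp add: inverse_eq_divide)

lemma gauss_tendsto_one: "(\<lambda>n. gauss (1 / real (Suc n)) z) \<longlonglongrightarrow> 1"
proof -
  have "(\<lambda>n. complex_of_real (exp (- ((1 / real (Suc n) * z)^2) / 2))) \<longlonglongrightarrow> of_real (exp (- ((0 * z)^2) / 2))"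
    by (intro tendsto_intros inverse_Suc_tendsto) simp
  then show ?thesis by (simp add: gauss_def)
qed

theorem fourier_inversion:
  fixes f :: "real \<Rightarrow> complex"
  assumes f: "integrable lborel f" "\<And>x. isCont f x" "\<And>x. cmod (f x) \<le> B"
    and ft: "integrable lborel (fourier f)"
  shows "fourier (\<lambda>z. fourier f (- z)) x = 2 * pi * f x"
proof -
  define d where "d n = 1 / real (Suc n)" for n
  let ?g = "\<lambda>v. of_real (sqrt (2 * pi) * exp (- (v^2) / 2)) :: complex" and ?A = "\<lambda>n z. iexp (x * z) * (gauss (d n) z * fourier f (- z))"
  have d: "d n > 0" for n by (simp add: d_def)
  have [measurable]: "f \<in> borel_measurable borel" using borel_measurable_integrable[OF f(1)] by simp
  note [measurable] = borel_measurable_fourier[of f]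
  have ft': "integrable lborel (\<lambda>z. fourier f (- z))"
    using lborel_integrable_real_affine[OF ft, of "-1" 0] by simp
  have 1: "(\<lambda>n. \<integral>z. ?A n z \<partial>lborel)
     \<longlonglongrightarrow> fourier (\<lambda>z. fourier f (- z)) x"
    unfolding fourier_def[of "\<lambda>z. fourier f (- z)"]
  proof (rule integral_dominated_convergence)
    show "integrable lborel (\<lambda>z. cmod (fourier f (- z)))" using ft' by simp
    show "AE z in lborel. norm (?A n z) \<le> cmod (fourier f (- z))" for n
      using norm_gauss_le by (auto simp: norm_mult intro!: mult_left_le_one_le)
    have "(\<lambda>n. ?A n z)
       \<longlonglongrightarrow> iexp (x * z) * (1 * fourier f (- z))" for z
      unfolding d_def by (intro tendsto_intros gauss_tendsto_one)
    then show "AE z in lborel. (\<lambda>n. ?A n z)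
       \<longlonglongrightarrow> iexp (x * z) * fourier f (- z)" by simp
  qed measurable
  \<comment> \<open>The substitution y = x + d v removes \<open>d\<close> from the Gaussian, so only
    the argument of \<open>f\<close> still moves and boundedness of \<open>f\<close> gives a
    majorant.\<close>
  have 2: "(\<integral>z. ?A n z \<partial>lborel)
    = (\<integral>v. ?g v * f (x + d n * v) \<partial>lborel)" for n
  proof -
    have "(\<integral>y. f y * of_real (gauss_kernel (d n) (y - x)) \<partial>lborel)
      = d n *\<^sub>R (\<integral>v. f (x + d n * v) * of_real (gauss_kernel (d n) (d n * v)) \<partial>lborel)"
      using d[of n] by (subst lborel_integral_real_affine[of "d n" _ x]) auto
    also have "\<dots> = (\<integral>v. ?g v * f (x + d n * v) \<partial>lborel)"
      using d[of n] unfolding integral_scaleR_right[symmetric]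
      by (intro Bochner_Integration.integral_cong) (auto simp: gauss_kernel_def scaleR_conv_of_real)
    finally show ?thesis using gauss_regularized_inversion[OF f(1) d] by simp
  qed
  have 3: "(\<lambda>n. \<integral>v. ?g v * f (x + d n * v) \<partial>lborel)
    \<longlonglongrightarrow> (\<integral>v. ?g v * f x \<partial>lborel)"
  proof (rule integral_dominated_convergence)
    show "integrable lborel (\<lambda>v. sqrt (2 * pi) * exp (- (v^2) / 2) * B)"
      using integrable_gaussian(1)[of 1] by simp
    show "AE v in lborel. norm (?g v * f (x + d n * v)) \<le> sqrt (2 * pi) * exp (- (v^2) / 2) * B" for n
      by (auto simp: norm_mult intro!: mult_left_mono f)
    have "(\<lambda>n. f (x + d n * v)) \<longlonglongrightarrow> f (x + 0 * v)" for v
      by (rule isCont_tendsto_compose[of "x + 0 * v" f, OF f(2)]) (unfold d_def, intro tendsto_intros inverse_Suc_tendsto)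
    then show "AE v in lborel. (\<lambda>n. ?g v * f (x + d n * v))
      \<longlonglongrightarrow> ?g v * f x"
      by (auto intro!: tendsto_intros)
  qed measurable
  have "(\<integral>v. ?g v * f x \<partial>lborel) = of_real (\<integral>v. sqrt (2 * pi) * exp (- (v^2) / 2) \<partial>lborel) * f x"
    by (simp only: integral_mult_left_zero integral_complex_of_real)
  also have "\<dots> = 2 * pi * f x"
    using integrable_gaussian(2)[of 1] by (simp flip: of_real_mult)
  finally show ?thesis
    using LIMSEQ_unique[OF 1, unfolded 2, OF 3] by simp
qed

text \<open>A Bochner integral that fails to converge has the value 0, so the bound holds in every
  case. It allows the iterated integrals below to be estimated before their convergence is
  known.\<close>

lemma norm_integral_le_nn_integral: "ennreal (norm (integral\<^sup>L M f)) \<le> (\<integral>\<^sup>+x. ennreal (norm (f x)) \<partial>M)"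
  by (cases "integrable M f") (simp_all add: integral_norm_bound_ennreal not_integrable_integral_eq)

text \<open>With a Gaussian inserted, the multiplication formula turns the left side into a
  quadratic form in \<open>H\<close> with the kernel \<open>gauss_kernel\<close>. That kernel is
  positive and symmetric with mass 2 \<pi> in each variable, so Schur's test bounds the form by 2
  \<pi> times the square integral of \<open>H\<close>, uniformly in \<open>d\<close>.\<close>

theorem plancherel_ineq:
  assumes H: "integrable lborel H" "integrable lborel (\<lambda>z. (cmod (H z))^2)"
  shows "integrable lborel (\<lambda>x. (cmod (fourier H x))^2)"
    "(\<integral>x. (cmod (fourier H x))^2 \<partial>lborel) \<le> 2 * pi * (\<integral>z. (cmod (H z))^2 \<partial>lborel)"
proof -
  let ?F = "\<lambda>x. (cmod (fourier H x))^2"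
  define S where "S = (\<integral>z. (cmod (H z))^2 \<partial>lborel)"
  have S_nonneg: "S \<ge> 0" by (simp add: S_def)
  have [measurable]: "H \<in> borel_measurable borel" using borel_measurable_integrable[OF H(1)] by simp
  note [measurable] = borel_measurable_fourier[of H]
  have Hc: "integrable lborel (\<lambda>z. cnj (H z))" using H(1) by simp
  have cnj_ft: "cnj (fourier H x) = fourier (\<lambda>z. cnj (H z)) (- x)" for x
    unfolding fourier_def by (subst Bochner_Integration.integral_cnj[symmetric]) (simp add: exp_cnj)
  have main: "integrable lborel (\<lambda>x. cmod (gauss d x) * ?F x)
     \<and> (\<integral>x. cmod (gauss d x) * ?F x \<partial>lborel) \<le> 2 * pi * S" if d: "d > 0" for d
  proof
    let ?I = "\<lambda>z. \<integral>w. cnj (H w) * of_real (gauss_kernel d (w - z)) \<partial>lborel"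
    let ?L = "\<integral>x. cmod (gauss d x) * ?F x \<partial>lborel"
    let ?B = "\<integral>z. cmod (H z) \<partial>lborel"
    have "integrable lborel (\<lambda>x. gauss d x * cnj (fourier H x))"
    proof (rule Bochner_Integration.integrable_bound)
      show "integrable lborel (\<lambda>x. cmod (gauss d x) * ?B)" using integrable_gauss[OF d] by simp
    qed (auto simp: norm_mult intro!: mult_left_mono order_trans[OF fourier_bound[OF H(1)]])
    note gi = this
    show "integrable lborel (\<lambda>x. cmod (gauss d x) * ?F x)"
    proof (rule Bochner_Integration.integrable_bound)
      show "integrable lborel (\<lambda>x. cmod (gauss d x) * ?B^2)" using integrable_gauss[OF d] by simp
    qed (auto simp: norm_mult intro!: mult_left_mono power_mono fourier_bound[OF H(1)])
    have kernel: "fourier (\<lambda>x. gauss d x * cnj (fourier H x)) z = (?I z)" for z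
      using gauss_regularized_inversion[OF Hc d, of z]
      unfolding cnj_ft fourier_def[of "\<lambda>x. gauss d x * fourier (\<lambda>z. cnj (H z)) (- x)"] .
    have ik: "integrable lborel (\<lambda>w. gauss_kernel d (w - z))" for z
      using lborel_integrable_real_affine[OF integrable_gauss_kernel(1)[OF d], of 1 "-z"] by simp
    have vk: "(\<integral>w. gauss_kernel d (w - z) \<partial>lborel) = 2 * pi" for z
      using lborel_integral_shift[of "gauss_kernel d" "-z"] integrable_gauss_kernel(2)[OF d] by simp
    have sym: "gauss_kernel d (w - z) = gauss_kernel d (z - w)" for w z
      by (simp add: gauss_kernel_def power_divide power2_commute)
    have nk: "(\<integral>\<^sup>+w. ennreal (gauss_kernel d (w - z)) \<partial>lborel) = ennreal (2 * pi)" for z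
      using nn_integral_eq_integral[OF ik[of z]] vk gauss_kernel_nonneg[OF d] by simp
    let ?k = "\<lambda>w z. ennreal (gauss_kernel d (w - z))"
    have nk': "(\<integral>\<^sup>+z. ?k w z \<partial>lborel) = ennreal (2 * pi)" for w
      using nk[of w] by (simp only: sym[of w])
    let ?h = "\<lambda>z. ennreal ((cmod (H z))^2 / 2)"
    have h: "(\<integral>\<^sup>+z. ?h z * ennreal (2 * pi) \<partial>lborel) = ennreal (pi * S)"
      using nn_integral_eq_integral[of lborel "\<lambda>z. pi * (cmod (H z))^2"] H(2)
      by (simp add: S_def mult.commute flip: ennreal_mult)
    have "of_real ?L = (\<integral>x. (gauss d x * cnj (fourier H x)) * fourier H x \<partial>lborel)"
      unfolding integral_complex_of_real[symmetric]
      by (intro Bochner_Integration.integral_cong refl)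
        (simp only: of_real_mult complex_norm_square, simp add: gauss_def mult_ac)
    also have "\<dots> = (\<integral>z. H z * ?I z \<partial>lborel)"
      unfolding fourier_multiplication[OF H(1) gi] kernel ..
    finally have "cmod (of_real ?L) = cmod (\<integral>z. H z * ?I z \<partial>lborel)"
      by (rule arg_cong)
    then have "ennreal ?L \<le> ennreal (cmod (\<integral>z. H z * ?I z \<partial>lborel))"
      unfolding norm_of_real by (intro ennreal_leI) linarith
    also have "\<dots> \<le> (\<integral>\<^sup>+z. ennreal (cmod (H z * ?I z)) \<partial>lborel)"
      by (rule norm_integral_le_nn_integral)
    also have "\<dots> \<le> (\<integral>\<^sup>+z. (\<integral>\<^sup>+w. ?h z * ?k w z + ?h w * ?k w z \<partial>lborel) \<partial>lborel)"
    proof (intro nn_integral_mono)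
      fix z
      have "ennreal (cmod (H z * ?I z)) = ennreal (cmod (\<integral>w. H z * (cnj (H w) * of_real (gauss_kernel d (w - z))) \<partial>lborel))"
        by simp
      also have "\<dots> \<le> (\<integral>\<^sup>+w. ennreal (cmod (H z * (cnj (H w) * of_real (gauss_kernel d (w - z))))) \<partial>lborel)"
        by (rule norm_integral_le_nn_integral)
      also have "\<dots> \<le> (\<integral>\<^sup>+w. ?h z * ?k w z + ?h w * ?k w z \<partial>lborel)"
      proof (intro nn_integral_mono)
        fix w
        \<comment> \<open>Schur's test for a symmetric kernel: after this splitting each half
          integrates the kernel in one variable and contributes \<open>pi * S\<close>.\<close>
        have "cmod (H z) * cmod (H w) \<le> (cmod (H z))^2 / 2 + (cmod (H w))^2 / 2"
          using sum_squares_bound[of "cmod (H z)" "cmod (H w)"] by simp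
        from mult_right_mono[OF this gauss_kernel_nonneg[OF d, of "w - z"]]
        show "ennreal (cmod (H z * (cnj (H w) * of_real (gauss_kernel d (w - z)))))
          \<le> ?h z * ?k w z + ?h w * ?k w z"
          using gauss_kernel_nonneg[OF d, of "w - z"]
          by (simp add: norm_mult distrib_right mult.assoc ennreal_leI flip: ennreal_mult ennreal_plus)
      qed
      finally show "ennreal (cmod (H z * ?I z)) \<le> (\<integral>\<^sup>+w. ?h z * ?k w z + ?h w * ?k w z \<partial>lborel)" .
    qed
    also have "\<dots> = (\<integral>\<^sup>+z. ?h z * ennreal (2 * pi) \<partial>lborel)
        + (\<integral>\<^sup>+z. (\<integral>\<^sup>+w. ?h w * ?k w z \<partial>lborel) \<partial>lborel)"
      by (simp add: nn_integral_add nn_integral_cmult nk)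
    also have "(\<integral>\<^sup>+z. (\<integral>\<^sup>+w. ?h w * ?k w z \<partial>lborel) \<partial>lborel)
        = (\<integral>\<^sup>+w. ?h w * ennreal (2 * pi) \<partial>lborel)"
      by (subst lborel_pair.Fubini') (simp_all add: nn_integral_cmult nk')
    finally show "?L \<le> 2 * pi * S"
      unfolding h using S_nonneg by (simp add: mult_ac flip: ennreal_plus)
  qed
  \<comment> \<open>Let \<open>d\<close> tend to 0. Fatou's lemma yields the integrability of the
    limit together with the bound.\<close>
  define d where "d n = 1 / real (Suc n)" for n
  have d: "d n > 0" for n by (simp add: d_def)
  have "(\<integral>\<^sup>+x. ennreal (?F x) \<partial>lborel)
    = (\<integral>\<^sup>+x. liminf (\<lambda>n. ennreal (cmod (gauss (d n) x) * ?F x)) \<partial>lborel)"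
  proof (intro nn_integral_cong)
    fix x
    have "(\<lambda>n. cmod (gauss (d n) x) * ?F x) \<longlonglongrightarrow> cmod 1 * ?F x"
      unfolding d_def by (intro tendsto_intros gauss_tendsto_one)
    then have "(\<lambda>n. ennreal (cmod (gauss (d n) x) * ?F x)) \<longlonglongrightarrow> ennreal (?F x)"
      by (intro tendsto_ennrealI) simp
    from lim_imp_Liminf[OF sequentially_bot this]
    show "ennreal (?F x) = liminf (\<lambda>n. ennreal (cmod (gauss (d n) x) * ?F x))"
      by (rule sym)
  qed
  also have "\<dots> \<le> liminf (\<lambda>n. \<integral>\<^sup>+x. ennreal (cmod (gauss (d n) x) * ?F x) \<partial>lborel)"
    by (intro nn_integral_liminf) measurable
  also have "\<dots> \<le> liminf (\<lambda>n. ennreal (2 * pi * S))"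
  proof (intro Liminf_mono always_eventually allI)
    fix n
    show "(\<integral>\<^sup>+x. ennreal (cmod (gauss (d n) x) * ?F x) \<partial>lborel) \<le> ennreal (2 * pi * S)"
      using main[OF d[of n]] by (subst nn_integral_eq_integral) (auto intro: ennreal_leI)
  qed
  also have "\<dots> = ennreal (2 * pi * S)" by (simp add: Liminf_const)
  finally have nn: "(\<integral>\<^sup>+x. ennreal (?F x) \<partial>lborel) \<le> ennreal (2 * pi * S)" .
  show i: "integrable lborel (\<lambda>x. ?F x)"
    using le_less_trans[OF nn ennreal_less_top] by (intro integrableI_nonneg) auto
  have "ennreal (\<integral>x. ?F x \<partial>lborel) \<le> ennreal (2 * pi * S)"
    using nn by (subst (asm) nn_integral_eq_integral[OF i]) auto
  then show "(\<integral>x. ?F x \<partial>lborel) \<le> 2 * pi * (\<integral>z. (cmod (H z))^2 \<partial>lborel)"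
    using S_nonneg by (simp add: S_def[symmetric])
qed

section \<open>Integration by parts for decaying functions on the line\<close>

lemma integral_derivative_eq_0:
  fixes f f' :: "real \<Rightarrow> complex"
  assumes "\<And>x. (f has_vector_derivative f' x) (at x)" "\<And>x. isCont f' x" "integrable lborel f'"
    and "(f \<longlongrightarrow> 0) at_top" "(f \<longlongrightarrow> 0) at_bot"
  shows "(\<integral>x. f' x \<partial>lborel) = 0"
proof -
  have "(LBINT x=-\<infinity>..\<infinity>. f' x) = 0 - 0"
    using assms by (intro interval_integral_FTC_integrable) (auto simp: ereal_tendsto_simps set_integrable_def)
  then show ?thesis by (simp add: interval_lebesgue_integral_def set_lebesgue_integral_def)
qed

lemma decay_integrable:
  assumes "f \<in> borel_measurable borel" "\<And>x::real. cmod (f x) \<le> K * inverse (1 + x^2)"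
  shows "integrable lborel f" "(\<integral>x. cmod (f x) \<partial>lborel) \<le> K * pi"
proof -
  have i: "integrable lborel (\<lambda>x::real. K * inverse (1 + x^2))"
    by (intro integrable_mult_right integrable_inverse_one_plus_square)
  show "integrable lborel f"
    by (rule Bochner_Integration.integrable_bound[OF i]) (use assms in \<open>auto intro: order_trans[OF _ abs_ge_self]\<close>)
  then have "(\<integral>x. cmod (f x) \<partial>lborel) \<le> (\<integral>x. K * inverse (1 + x^2) \<partial>lborel)"
    by (intro integral_mono i assms) auto
  then show "(\<integral>x. cmod (f x) \<partial>lborel) \<le> K * pi" by (simp add: integrable_inverse_one_plus_square)
qed

lemma decay_tendsto_0:
  fixes f :: "real \<Rightarrow> complex"
  assumes "\<And>x. cmod (f x) \<le> K * inverse (1 + x^2)"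
  shows "(f \<longlongrightarrow> 0) at_top" "(f \<longlongrightarrow> 0) at_bot"
proof -
  have "((\<lambda>x::real. K * inverse (1 + x^2)) \<longlongrightarrow> 0) at_top" "((\<lambda>x::real. K * inverse (1 + x^2)) \<longlongrightarrow> 0) at_bot"
    by real_asymp+
  from this[THEN Lim_null_comparison[OF always_eventually[OF allI[OF assms]]]]
  show "(f \<longlongrightarrow> 0) at_top" "(f \<longlongrightarrow> 0) at_bot" .
qed

text \<open>The derivative of \<open>iexp (x * z) * f z\<close> in \<open>z\<close> integrates to 0.
  At the frequency \<open>- z\<close> used in \<open>pft\<close> the minus sign disappears.\<close>

lemma fourier_derivative:
  assumes "\<And>x. (f has_vector_derivative f' x) (at x)" "\<And>x. isCont f' x"
    and "\<And>x. cmod (f x) \<le> K * inverse (1 + x^2)" "\<And>x. cmod (f' x) \<le> K' * inverse (1 + x^2)"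
  shows "fourier f' x = - \<i> * of_real x * fourier f x"
proof -
  have cf: "isCont f z" for z using assms(1) has_vector_derivative_continuous by blast
  have [measurable]: "f \<in> borel_measurable borel" "f' \<in> borel_measurable borel"
    using cf assms(2) by (auto intro!: borel_measurable_continuous_onI continuous_at_imp_continuous_on)
  note i = decay_integrable(1)[OF _ assms(3)] decay_integrable(1)[OF _ assms(4)]
  have e: "integrable lborel (\<lambda>z. iexp (x * z) * f z)" "integrable lborel (\<lambda>z. iexp (x * z) * f' z)"
    by (intro integrable_exp_mult i; simp)+
  have "(\<integral>z. \<i> * of_real x * (iexp (x * z) * f z) + iexp (x * z) * f' z \<partial>lborel) = 0"
  proof (rule integral_derivative_eq_0)
    show "((\<lambda>z. iexp (x * z) * f z) has_vector_derivative
      \<i> * of_real x * (iexp (x * z) * f z) + iexp (x * z) * f' z) (at z)" for z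
    proof -
      have "((\<lambda>z. iexp (x * z)) has_vector_derivative \<i> * of_real x * iexp (x * z)) (at z)"
        by (rule has_vector_derivative_eq_rhs, rule field_vector_diff_chain_at[unfolded o_def, where g = exp])
          (auto intro!: derivative_eq_intros has_vector_derivative_real_field simp: scaleR_conv_of_real)
      from has_vector_derivative_mult[OF this assms(1)] show ?thesis by (simp add: algebra_simps)
    qed
    show "isCont (\<lambda>z. \<i> * of_real x * (iexp (x * z) * f z) + iexp (x * z) * f' z) z" for z
      by (intro continuous_intros cf assms(2))
    show "integrable lborel (\<lambda>z. \<i> * of_real x * (iexp (x * z) * f z) + iexp (x * z) * f' z)"
      using e by auto
    have "cmod (iexp (x * z) * f z) \<le> K * inverse (1 + z^2)" for z
      using assms(3) by (simp add: norm_mult)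
    from decay_tendsto_0[OF this]
    show "((\<lambda>z. iexp (x * z) * f z) \<longlongrightarrow> 0) at_top" "((\<lambda>z. iexp (x * z) * f z) \<longlongrightarrow> 0) at_bot" .
  qed
  then have "\<i> * of_real x * fourier f x + fourier f' x = 0"
    using e by (simp add: fourier_def)
  then show ?thesis by (simp add: add_eq_0_iff)
qed

section \<open>The potential part of the Wigner operator\<close>

text \<open>The inner integral of the Wigner operator; the argument \<open>- z\<close> gives the
  phase exp(-i \<eta>' z).\<close>

definition pft :: "phase_fun \<Rightarrow> real \<Rightarrow> real \<Rightarrow> complex" where
  "pft F x z = fourier (\<lambda>y. F (x, y)) (- z)"

definition pot_diff :: "(real \<Rightarrow> real) \<Rightarrow> real \<Rightarrow> real \<Rightarrow> real \<Rightarrow> real" where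
  "pot_diff U \<epsilon> x z = U (sqrt \<epsilon> * (x + z / 2)) - U (sqrt \<epsilon> * (x - z / 2))"

text \<open>The potential is a free parameter because the operator is applied to \<open>V\<close>,
  to the monomials of its Taylor polynomial and to the Taylor remainder. On the Fourier side it
  multiplies by a real function, up to an imaginary constant.\<close>

definition pot_op :: "(real \<Rightarrow> real) \<Rightarrow> real \<Rightarrow> phase_fun \<Rightarrow> phase_fun" where
  "pot_op U \<epsilon> F = (\<lambda>p. - (\<i> / of_real (2 * pi * \<epsilon>)) *
     fourier (\<lambda>z. of_real (pot_diff U \<epsilon> (fst p) z) * pft F (fst p) z) (snd p))"

lemma wigner_op_eq:
  "wigner_op V \<epsilon> F = (\<lambda>p. of_real (snd p) * d_xi F p + pot_op V \<epsilon> F p)"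
proof (rule ext, clarify)
  fix x y :: real
  have "(\<integral>y'. iexp ((y - y') * z) * F (x, y') *
          of_real (V (sqrt \<epsilon> * (x + z / 2)) - V (sqrt \<epsilon> * (x - z / 2))) \<partial>lborel)
    = iexp (y * z) * (of_real (pot_diff V \<epsilon> x z) * pft F x z)" for z
  proof -
    have "iexp ((y - y') * z) = iexp (y * z) * iexp (- z * y')" for y'
      by (subst exp_add[symmetric]) (simp add: algebra_simps)
    then have "iexp ((y - y') * z) * F (x, y') * of_real (V (sqrt \<epsilon> * (x + z / 2)) - V (sqrt \<epsilon> * (x - z / 2)))
      = (iexp (y * z) * of_real (pot_diff V \<epsilon> x z)) * (iexp (- z * y') * F (x, y'))" for y'
      by (simp only: pot_diff_def mult_ac)
    then show ?thesis
      unfolding pft_def fourier_def by (simp only: integral_mult_right_zero mult.assoc)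
  qed
  then show "wigner_op V \<epsilon> F (x, y) = of_real (snd (x, y)) * d_xi F (x, y) + pot_op V \<epsilon> F (x, y)"
    unfolding wigner_op_def pot_op_def fourier_def[of "\<lambda>z. of_real (pot_diff V \<epsilon> (fst (x, y)) z) * pft F (fst (x, y)) z"]
    by simp
qed

section \<open>Decay of the partial Fourier transform\<close>

lemma le_mult_inverses:
  fixes a b c K :: real
  assumes "a * b * c \<le> K" "a > 0" "b > 0"
  shows "c \<le> K * (inverse a * inverse b)"
  using assms by (simp add: field_simps)

lemma le_weight:
  assumes "\<And>x y. (1 + x^2) ^ 1 * (1 + y^2) ^ 1 * cmod (F (x, y)) \<le> K"
  shows "cmod (F p) \<le> K * weight p"
  using le_mult_inverses[OF assms[of "fst p" "snd p", unfolded power_one_right]]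
  by (simp add: weight_def case_prod_beta add_pos_nonneg)

lemma decaying_bound:
  assumes "decaying F"
  shows "\<exists>K. \<forall>p. cmod (F p) \<le> K * weight p"
proof -
  obtain K where "\<And>x y. (1 + x^2) ^ 1 * (1 + y^2) ^ 1 * cmod (F (x, y)) \<le> K"
    using assms unfolding decaying_def by meson
  then show ?thesis by (blast intro: le_weight)
qed

lemma schwartz_slice:
  assumes F: "F \<in> schwartz"
  shows "isCont (\<lambda>y. F (x, y)) y" "(\<lambda>y. F (x, y)) \<in> borel_measurable borel"
    "\<exists>K. \<forall>y. cmod (F (x, y)) \<le> K * inverse (1 + y^2)" "integrable lborel (\<lambda>y. F (x, y))"
proof -
  show c: "isCont (\<lambda>y. F (x, y)) y" for y
    using has_vector_derivative_d_eta[OF schwartz_differentiable[OF F]] has_vector_derivative_continuous by blast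
  then show m: "(\<lambda>y. F (x, y)) \<in> borel_measurable borel"
    by (intro borel_measurable_continuous_onI continuous_at_imp_continuous_on) auto
  obtain K where K: "\<And>p. cmod (F p) \<le> K * weight p"
    using decaying_bound[OF schwartz_decaying[OF F]] by blast
  have "cmod (F (x, y)) \<le> (K * inverse (1 + x^2)) * inverse (1 + y^2)" for y
    using K[of "(x, y)"] by (simp add: weight_def mult.assoc)
  note K = this
  then show "\<exists>K. \<forall>y. cmod (F (x, y)) \<le> K * inverse (1 + y^2)" by blast
  show "integrable lborel (\<lambda>y. F (x, y))" by (rule decay_integrable[OF m K])
qed

lemma pft_d_eta:
  assumes F: "F \<in> schwartz"
  shows "pft (d_eta F) x z = \<i> * of_real z * pft F x z"
proof -
  obtain K where K: "\<And>y. cmod (F (x, y)) \<le> K * inverse (1 + y^2)" using schwartz_slice(3)[OF F] by blast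
  obtain K' where K': "\<And>y. cmod (d_eta F (x, y)) \<le> K' * inverse (1 + y^2)"
    using schwartz_slice(3)[OF schwartz_d_eta[OF F]] by blast
  show ?thesis
    unfolding pft_def
    using fourier_derivative[OF has_vector_derivative_d_eta[OF schwartz_differentiable[OF F]]
      schwartz_slice(1)[OF schwartz_d_eta[OF F]] K K', of "- z"] by simp
qed

lemma pft_d_eta_power:
  assumes F: "F \<in> schwartz"
  shows "pft ((d_eta ^^ k) F) x z = (\<i> * of_real z) ^ k * pft F x z"
  by (induction k) (simp_all add: pft_d_eta schwartz_d_eta_power F mult_ac)

lemma pft_add:
  assumes "F \<in> schwartz" "G \<in> schwartz"
  shows "pft (\<lambda>p. F p + G p) x z = pft F x z + pft G x z"
  unfolding pft_def by (intro fourier_add schwartz_slice assms)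

lemma pft_cmult: "pft (\<lambda>p. c * F p) x z = c * pft F x z"
  unfolding pft_def by (rule fourier_cmult)

text \<open>Its symbol under \<open>pft\<close> is 1 + z^2, so its powers convert smoothness in
  \<eta> into decay in \<open>z\<close>, with the same weights as in \<open>decaying\<close>.
  Writing the difference as a sum with factor -1 lets the closure rules for sums and scalar
  multiples apply.\<close>

definition one_minus_d2 :: "phase_fun \<Rightarrow> phase_fun" where
  "one_minus_d2 F = (\<lambda>p. F p + (-1) * d_eta (d_eta F) p)"

lemma schwartz_one_minus_d2: "F \<in> schwartz \<Longrightarrow> one_minus_d2 F \<in> schwartz"
  unfolding one_minus_d2_def by (intro schwartz_add schwartz_cmult schwartz_d_eta)

lemma schwartz_one_minus_d2_power: "F \<in> schwartz \<Longrightarrow> (one_minus_d2 ^^ n) F \<in> schwartz"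
  by (induction n) (auto intro: schwartz_one_minus_d2)

lemma pft_one_minus_d2:
  assumes "F \<in> schwartz"
  shows "pft (one_minus_d2 F) x z = (1 + (of_real z)^2) * pft F x z"
  unfolding one_minus_d2_def
  by (subst pft_add[OF assms schwartz_cmult[OF schwartz_d_eta[OF schwartz_d_eta[OF assms]]]], subst pft_cmult)
    (simp add: pft_d_eta assms schwartz_d_eta algebra_simps power2_eq_square)

lemma pft_one_minus_d2_power:
  assumes "F \<in> schwartz"
  shows "pft ((one_minus_d2 ^^ n) F) x z = (1 + (of_real z)^2) ^ n * pft F x z"
  by (induction n) (simp_all add: pft_one_minus_d2 schwartz_one_minus_d2_power assms mult_ac)

text \<open>The n-th power of \<open>one_minus_d2\<close> supplies the decay in \<open>z\<close>,
  its slices keep the decay in \<open>x\<close>, and one factor of decay in \<open>y\<close> makes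
  the slice integrable, with integral at most \<pi> times the constant. The bound \<open>K\<close>
  is an explicit parameter so that a time-dependent constant can be inserted later.\<close>

lemma pft_decay:
  assumes F: "F \<in> schwartz" and n: "n \<ge> 1"
    and K: "\<And>x y. (1 + x^2) ^ n * (1 + y^2) ^ n * cmod ((one_minus_d2 ^^ n) F (x, y)) \<le> K"
  shows "(1 + x^2) ^ n * (1 + z^2) ^ n * cmod (pft F x z) \<le> pi * K"
proof -
  define G where "G = (one_minus_d2 ^^ n) F"
  have G: "G \<in> schwartz" unfolding G_def by (intro schwartz_one_minus_d2_power F)
  have pos: "1 + a^2 > 0" for a :: real by (simp add: add_pos_nonneg)
  have "cmod (G (x, y)) \<le> (K / (1 + x^2) ^ n) * inverse (1 + y^2)" for y
  proof -
    have "1 + y^2 \<le> (1 + y^2) ^ n" using n self_le_power[of "1 + y^2" n] by simp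
    then have "(1 + x^2) ^ n * (1 + y^2) * cmod (G (x, y)) \<le> (1 + x^2) ^ n * (1 + y^2) ^ n * cmod (G (x, y))"
      by (intro mult_right_mono mult_left_mono) auto
    also have "\<dots> \<le> K" unfolding G_def by (rule K)
    finally have "cmod (G (x, y)) \<le> K * (inverse ((1 + x^2) ^ n) * inverse (1 + y^2))"
      by (rule le_mult_inverses) (simp_all add: pos)
    then show ?thesis by (simp add: divide_inverse)
  qed
  from decay_integrable[OF schwartz_slice(2)[OF G] this]
  have "cmod (pft G x z) \<le> K / (1 + x^2) ^ n * pi"
    unfolding pft_def using fourier_bound[of "\<lambda>y. G (x, y)" "- z"] by linarith
  then have "cmod ((1 + (of_real z)^2) ^ n * pft F x z) \<le> K / (1 + x^2) ^ n * pi"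
    unfolding G_def pft_one_minus_d2_power[OF F] .
  moreover have "cmod ((1 + (of_real z)^2) ^ n) = (1 + z^2) ^ n"
  proof -
    have "(1 + complex_of_real z ^ 2) ^ n = of_real ((1 + z^2) ^ n)" by simp
    then show ?thesis by (simp only: norm_of_real) (simp add: abs_of_nonneg)
  qed
  ultimately show ?thesis using pos[of x] by (simp add: norm_mult field_simps)
qed

lemma schwartz_one_minus_d2_decay:
  assumes "F \<in> schwartz"
  shows "\<exists>K. \<forall>x y. (1 + x^2) ^ n * (1 + y^2) ^ n * cmod ((one_minus_d2 ^^ n) F (x, y)) \<le> K"
  using schwartz_decaying[OF schwartz_one_minus_d2_power[OF assms, of n]] unfolding decaying_def by blast

lemma pft_bound:
  assumes F: "F \<in> schwartz"
  shows "\<exists>K. \<forall>z. cmod (pft F x z) \<le> K * inverse (1 + z^2)"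
proof -
  obtain K where K: "\<And>x y. (1 + x^2) ^ 1 * (1 + y^2) ^ 1 * cmod ((one_minus_d2 ^^ 1) F (x, y)) \<le> K"
    using schwartz_one_minus_d2_decay[OF F] by meson
  have pos: "1 + a^2 > 0" for a :: real by (simp add: add_pos_nonneg)
  have "cmod (pft F x z) \<le> (pi * K / (1 + x^2)) * inverse (1 + z^2)" for z
    using le_mult_inverses[OF _ pos pos, of x z "cmod (pft F x z)" "pi * K"] pft_decay[OF F _ K, of x z] by (simp add: divide_inverse)
  then show ?thesis by blast
qed

lemma schwartz_measurable: "F \<in> schwartz \<Longrightarrow> F \<in> borel_measurable borel"
  by (intro borel_measurable_continuous_onI continuous_schwartz)

lemma pft_measurable:
  assumes F: "F \<in> schwartz"
  shows "(\<lambda>p. pft F (fst p) (snd p)) \<in> borel_measurable (borel \<Otimes>\<^sub>M borel)"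
proof -
  have [measurable]: "F \<in> borel_measurable (borel \<Otimes>\<^sub>M borel)"
    using schwartz_measurable[OF F] by (simp add: borel_prod)
  show ?thesis unfolding pft_def fourier_def by measurable
qed

lemma pft_slice_integrable:
  assumes F: "F \<in> schwartz"
  shows "integrable lborel (pft F x)"
proof -
  have [measurable]: "pft F x \<in> borel_measurable borel"
    using measurable_compose[OF _ pft_measurable[OF F], of "\<lambda>z. (x, z)" borel] by simp
  show ?thesis using pft_bound[OF F, of x] decay_integrable(1)[of "pft F x"] by auto
qed

lemma pft_inversion:
  assumes F: "F \<in> schwartz"
  shows "fourier (pft F x) y = of_real (2 * pi) * F (x, y)"
proof -
  obtain K where K: "\<And>y. cmod (F (x, y)) \<le> K * inverse (1 + y^2)" using schwartz_slice(3)[OF F] by blast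
  have "K \<ge> 0" using order_trans[OF norm_ge_zero K[of 0]] by simp
  then have B: "cmod (F (x, y)) \<le> K" for y
    using K[of y] mult_left_le[of "inverse (1 + y^2)" K] by (simp add: inverse_le_1_iff)
  have "integrable lborel (\<lambda>z. pft F x (- z))"
    using lborel_integrable_real_affine[OF pft_slice_integrable[OF F, of x], of "-1" 0] by simp
  then have "integrable lborel (fourier (\<lambda>y. F (x, y)))" by (simp add: pft_def)
  from fourier_inversion[OF schwartz_slice(4,1)[OF F] B this] show ?thesis
    by (simp add: pft_def[abs_def])
qed

text \<open>Powers of \<open>z\<close> are absorbed into \<open>pft\<close> as \<eta>-derivatives,
  and inversion then undoes the two transforms. This is why a polynomial potential gives a
  differential operator.\<close>

lemma fourier_power_pft:
  assumes F: "F \<in> schwartz"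
  shows "integrable lborel (\<lambda>z. of_real z ^ k * pft F x z)"
    "fourier (\<lambda>z. of_real z ^ k * pft F x z) y = of_real (2 * pi) * ((- \<i>) ^ k * (d_eta ^^ k) F (x, y))"
proof -
  have eq: "(\<lambda>z. of_real z ^ k * pft F x z) = (\<lambda>z. (- \<i>) ^ k * pft ((d_eta ^^ k) F) x z)"
    unfolding pft_d_eta_power[OF F] by (simp add: fun_eq_iff power_mult_distrib[symmetric] mult.assoc[symmetric])
  show "integrable lborel (\<lambda>z. of_real z ^ k * pft F x z)"
    unfolding eq by (intro integrable_mult_right pft_slice_integrable schwartz_d_eta_power F)
  show "fourier (\<lambda>z. of_real z ^ k * pft F x z) y = of_real (2 * pi) * ((- \<i>) ^ k * (d_eta ^^ k) F (x, y))"
    unfolding eq fourier_cmult by (simp add: pft_inversion schwartz_d_eta_power F)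
qed

text \<open>\<open>M\<close> is the order of vanishing at 0, which turns into powers of
  \<open>sqrt \<epsilon>\<close> after dilation; \<open>m\<close> allows further growth at infinity.
  The potential itself has \<open>M = 0\<close>, its Taylor remainder
  \<open>M = N + 3\<close>.\<close>

definition poly_growth :: "(real \<Rightarrow> real) \<Rightarrow> real \<Rightarrow> nat \<Rightarrow> nat \<Rightarrow> bool" where
  "poly_growth U C M m \<longleftrightarrow> continuous_on UNIV U \<and> C \<ge> 0 \<and> (\<forall>u. \<bar>U u\<bar> \<le> C * \<bar>u\<bar> ^ M * (1 + \<bar>u\<bar> ^ m))"

text \<open>Both arguments of \<open>U\<close>, before dilation, are dominated by (1 + x^2) (1 +
  z^2), and \<open>sqrt \<epsilon> \<le> 1\<close> discards the dilation in the growth factor. One 2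
  in the constant comes from the two values of \<open>U\<close>, the other from bounding 1 +
  a^m.\<close>

lemma pot_diff_bound:
  assumes U: "poly_growth U C M m" and \<epsilon>: "0 \<le> \<epsilon>" "\<epsilon> \<le> 1"
  shows "\<bar>pot_diff U \<epsilon> x z\<bar> \<le> 4 * C * sqrt \<epsilon> ^ M * ((1 + x^2) * (1 + z^2)) ^ (M + m)"
proof -
  define X where "X = (1 + x^2) * (1 + z^2)"
  have X1: "X \<ge> 1" unfolding X_def by (simp add: algebra_simps)
  have abs: "\<bar>x\<bar> + \<bar>z\<bar> \<le> X"
  proof -
    have "2 * \<bar>x\<bar> \<le> 1 + x^2" "2 * \<bar>z\<bar> \<le> 1 + z^2"
      using sum_squares_bound[of 1 "\<bar>x\<bar>"] sum_squares_bound[of 1 "\<bar>z\<bar>"] by simp_all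
    moreover have "0 \<le> x^2 * z^2" "0 \<le> x^2" "0 \<le> z^2" by simp_all
    moreover have "X = 1 + x^2 + z^2 + x^2 * z^2" by (simp add: X_def algebra_simps)
    ultimately show ?thesis by linarith
  qed
  have C: "C \<ge> 0" using U by (simp add: poly_growth_def)
  have s: "0 \<le> sqrt \<epsilon>" "sqrt \<epsilon> \<le> 1" using \<epsilon> by auto
  have *: "\<bar>U (sqrt \<epsilon> * w)\<bar> \<le> 2 * C * sqrt \<epsilon> ^ M * X ^ (M + m)" if w: "\<bar>w\<bar> \<le> X" for w
  proof -
    have "\<bar>sqrt \<epsilon> * w\<bar> ^ m \<le> X ^ m"
      using mult_mono[OF s(2) w] s by (intro power_mono) (auto simp: abs_mult)
    then have "1 + \<bar>sqrt \<epsilon> * w\<bar> ^ m \<le> 2 * X ^ m" using one_le_power[OF X1, of m] by linarith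
    have "\<bar>sqrt \<epsilon> * w\<bar> ^ M \<le> sqrt \<epsilon> ^ M * X ^ M"
      unfolding abs_mult power_mult_distrib using w s by (intro mult_mono power_mono) auto
    then have "C * \<bar>sqrt \<epsilon> * w\<bar> ^ M \<le> C * (sqrt \<epsilon> ^ M * X ^ M)" using C by (intro mult_left_mono)
    from this \<open>1 + _ \<le> _\<close> have "C * \<bar>sqrt \<epsilon> * w\<bar> ^ M * (1 + \<bar>sqrt \<epsilon> * w\<bar> ^ m) \<le> C * (sqrt \<epsilon> ^ M * X ^ M) * (2 * X ^ m)"
      by (rule mult_mono) (use C s X1 in simp_all)
    also have "\<dots> = 2 * C * sqrt \<epsilon> ^ M * X ^ (M + m)" by (simp add: power_add)
    finally show ?thesis
      using U unfolding poly_growth_def by (meson order_trans)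
  qed
  have "\<bar>pot_diff U \<epsilon> x z\<bar> \<le> \<bar>U (sqrt \<epsilon> * (x + z / 2))\<bar> + \<bar>U (sqrt \<epsilon> * (x - z / 2))\<bar>"
    unfolding pot_diff_def by (rule abs_triangle_ineq4)
  moreover have "\<bar>x + z / 2\<bar> \<le> X" "\<bar>x - z / 2\<bar> \<le> X" using abs by linarith+
  ultimately show ?thesis
    using *[of "x + z / 2"] *[of "x - z / 2"] unfolding X_def[symmetric] by linarith
qed

lemma pot_diff_measurable [measurable]:
  assumes "continuous_on UNIV U"
  shows "(\<lambda>p. pot_diff U \<epsilon> (fst p) (snd p)) \<in> borel_measurable (borel \<Otimes>\<^sub>M borel)"
proof -
  have [measurable]: "U \<in> borel_measurable borel" using assms by (intro borel_measurable_continuous_onI)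
  show ?thesis unfolding pot_diff_def by measurable
qed

text \<open>Of the \<open>Suc (M + m)\<close> powers of decay, \<open>M + m\<close> compensate the
  growth of the potential difference; the last one is left over as the integrable weight.\<close>

lemma pot_integrand_bound:
  assumes U: "poly_growth U C M m" and \<epsilon>: "0 \<le> \<epsilon>" "\<epsilon> \<le> 1" and F: "F \<in> schwartz"
    and n: "n = Suc (M + m)"
    and K: "\<And>x y. (1 + x^2) ^ n * (1 + y^2) ^ n * cmod ((one_minus_d2 ^^ n) F (x, y)) \<le> K"
  shows "cmod (of_real (pot_diff U \<epsilon> x z) * pft F x z)
    \<le> (4 * pi * C * K * sqrt \<epsilon> ^ M) * (inverse (1 + x^2) * inverse (1 + z^2))"
proof -
  define X where "X = (1 + x^2) * (1 + z^2)"
  have X: "X > 0" unfolding X_def by (intro mult_pos_pos add_pos_nonneg) auto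
  have C: "C \<ge> 0" using U by (simp add: poly_growth_def)
  have 1: "X ^ n * cmod (pft F x z) \<le> pi * K"
    using pft_decay[OF F _ K, of x z] n by (simp only: X_def power_mult_distrib)
  have "cmod (of_real (pot_diff U \<epsilon> x z) * pft F x z) * X = \<bar>pot_diff U \<epsilon> x z\<bar> * (X * cmod (pft F x z))"
    by (simp add: norm_mult)
  also have "\<dots> \<le> (4 * C * sqrt \<epsilon> ^ M * X ^ (M + m)) * (X * cmod (pft F x z))"
    using pot_diff_bound[OF U \<epsilon>, of x z] X unfolding X_def[symmetric] by (intro mult_right_mono) auto
  also have "\<dots> = 4 * C * sqrt \<epsilon> ^ M * (X ^ n * cmod (pft F x z))"
    by (simp add: n mult_ac)
  also have "\<dots> \<le> 4 * C * sqrt \<epsilon> ^ M * (pi * K)"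
    using 1 C \<epsilon> by (intro mult_left_mono) auto
  finally have "cmod (of_real (pot_diff U \<epsilon> x z) * pft F x z) \<le> 4 * C * sqrt \<epsilon> ^ M * (pi * K) / X"
    using X by (simp add: pos_le_divide_eq)
  then show ?thesis by (simp add: X_def divide_inverse mult_ac)
qed

lemma pot_integrand_slice:
  assumes U: "poly_growth U C M m" and \<epsilon>: "0 \<le> \<epsilon>" "\<epsilon> \<le> 1" and F: "F \<in> schwartz"
  shows "integrable lborel (\<lambda>z. of_real (pot_diff U \<epsilon> x z) * pft F x z)"
    "(\<lambda>z. of_real (pot_diff U \<epsilon> x z) * pft F x z) \<in> borel_measurable borel"
proof -
  define n where "n = Suc (M + m)"
  obtain K where K: "\<And>x y. (1 + x^2) ^ n * (1 + y^2) ^ n * cmod ((one_minus_d2 ^^ n) F (x, y)) \<le> K"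
    using schwartz_one_minus_d2_decay[OF F] by meson
  have cU: "continuous_on UNIV U" using U by (simp add: poly_growth_def)
  have "(\<lambda>p. of_real (pot_diff U \<epsilon> (fst p) (snd p)) * pft F (fst p) (snd p)) \<in> borel_measurable (borel \<Otimes>\<^sub>M borel)"
    using pft_measurable[OF F] pot_diff_measurable[OF cU] by measurable
  from measurable_compose[OF _ this, of "\<lambda>z. (x, z)" borel]
  show m: "(\<lambda>z. of_real (pot_diff U \<epsilon> x z) * pft F x z) \<in> borel_measurable borel" by simp
  have "cmod (of_real (pot_diff U \<epsilon> x z) * pft F x z)
    \<le> (4 * pi * C * K * sqrt \<epsilon> ^ M * inverse (1 + x^2)) * inverse (1 + z^2)" for z
    using pot_integrand_bound[OF U \<epsilon> F n_def K, of x z] by (simp only: mult.assoc)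
  then show "integrable lborel (\<lambda>z. of_real (pot_diff U \<epsilon> x z) * pft F x z)"
    by (rule decay_integrable[OF m])
qed

lemma pot_op_measurable:
  assumes U: "poly_growth U C M m" and F: "F \<in> schwartz"
  shows "pot_op U \<epsilon> F \<in> borel_measurable (borel \<Otimes>\<^sub>M borel)"
proof -
  have cU: "continuous_on UNIV U" using U by (simp add: poly_growth_def)
  have [measurable]: "(\<lambda>p. pft F (fst p) (snd p)) \<in> borel_measurable (borel \<Otimes>\<^sub>M borel)"
    by (rule pft_measurable[OF F])
  have [measurable]: "(\<lambda>p. pot_diff U \<epsilon> (fst p) (snd p)) \<in> borel_measurable (borel \<Otimes>\<^sub>M borel)"
    by (rule pot_diff_measurable[OF cU])
  have q: "(\<lambda>q. (fst (fst q), snd q)) \<in> measurable ((borel \<Otimes>\<^sub>M borel) \<Otimes>\<^sub>M lborel) (borel \<Otimes>\<^sub>M borel)"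
    by measurable
  have [measurable]: "(\<lambda>q. pot_diff U \<epsilon> (fst (fst q)) (snd q)) \<in> borel_measurable ((borel \<Otimes>\<^sub>M borel) \<Otimes>\<^sub>M lborel)"
    "(\<lambda>q. pft F (fst (fst q)) (snd q)) \<in> borel_measurable ((borel \<Otimes>\<^sub>M borel) \<Otimes>\<^sub>M lborel)"
    using measurable_compose[OF q pot_diff_measurable[OF cU]] measurable_compose[OF q pft_measurable[OF F]] by simp_all
  show ?thesis
    unfolding pot_op_def fourier_def by measurable
qed

text \<open>The Plancherel bound is applied in \<eta> for each fixed \<xi>, and the weight in \<xi>
  is integrated afterwards. The division by \<epsilon> is the loss of two powers of
  \<open>sqrt \<epsilon>\<close> against the \<open>M\<close> gained from \<open>U\<close>.\<close>

lemma pot_op_L2: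
  assumes U: "poly_growth U C M m" and \<epsilon>: "0 < \<epsilon>" "\<epsilon> \<le> 1" and F: "F \<in> schwartz"
    and n: "n = Suc (M + m)"
    and K: "\<And>x y. (1 + x^2) ^ n * (1 + y^2) ^ n * cmod ((one_minus_d2 ^^ n) F (x, y)) \<le> K"
  shows "pot_op U \<epsilon> F \<in> L2" "L2_norm (pot_op U \<epsilon> F) \<le> 8 * pi * C * K * sqrt \<epsilon> ^ M / \<epsilon>"
proof -
  let ?P = "\<lambda>x y. (cmod (pot_op U \<epsilon> F (x, y)))^2"
  define A where "A = 4 * pi * C * K * sqrt \<epsilon> ^ M"
  define H where "H x z = of_real (pot_diff U \<epsilon> x z) * pft F x z" for x z
  define w where "w x = inverse (1 + x^2)" for x :: real
  have w: "0 \<le> w x" "w x \<le> 1" "w x * w x \<le> w x" for x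
    by (auto simp: w_def inverse_le_1_iff intro!: mult_left_le)
  have iw: "integrable lborel w" "(\<integral>x. w x \<partial>lborel) = pi"
    unfolding w_def using integrable_inverse_one_plus_square by auto
  have Hb: "cmod (H x z) \<le> A * (w x * w z)" for x z
    unfolding H_def A_def w_def by (rule pot_integrand_bound[OF U _ _ F n K]) (use \<epsilon> in auto)
  have A: "A \<ge> 0" using order_trans[OF norm_ge_zero Hb[of 0 0]] by (simp add: w_def)
  have Hi: "integrable lborel (H x)" and Hm [measurable]: "H x \<in> borel_measurable borel" for x
    unfolding H_def using pot_integrand_slice[OF U _ _ F] \<epsilon> by auto
  have Hb2: "(cmod (H x z))^2 \<le> (A^2 * w x) * w z" for x z
  proof -
    have "(cmod (H x z))^2 \<le> (A * (w x * w z))^2" by (intro power_mono Hb) simp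
    also have "\<dots> = A^2 * ((w x * w x) * (w z * w z))" by (simp add: power2_eq_square mult_ac)
    also have "\<dots> \<le> A^2 * (w x * w z)" by (intro mult_left_mono mult_mono w) (simp_all add: w)
    finally show ?thesis by (simp add: mult.assoc)
  qed
  have iw2: "integrable lborel (\<lambda>z. (A^2 * w x) * w z)" for x
    using iw by (intro integrable_mult_right)
  have Hi2: "integrable lborel (\<lambda>z. (cmod (H x z))^2)" for x
    by (rule Bochner_Integration.integrable_bound[OF iw2]) (auto intro: order_trans[OF Hb2 abs_ge_self])
  have HI2: "(\<integral>z. (cmod (H x z))^2 \<partial>lborel) \<le> A^2 * pi * w x" for x
    using integral_mono[OF Hi2 iw2 Hb2, of x] iw by (simp add: mult_ac)
  have slice: "integrable lborel (\<lambda>y. ?P x y)"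
    "(\<integral>y. ?P x y \<partial>lborel) \<le> (A^2 / (2 * \<epsilon>^2)) * w x" for x
  proof -
    have "cmod (- (\<i> / of_real (2 * pi * \<epsilon>))) = inverse (2 * pi * \<epsilon>)"
      using \<epsilon> by (simp add: norm_divide norm_mult inverse_eq_divide)
    then have eq: "(\<lambda>y. ?P x y) = (\<lambda>y. (inverse (2 * pi * \<epsilon>))^2 * (cmod (fourier (H x) y))^2)"
      unfolding H_def pot_op_def by (simp only: norm_mult power_mult_distrib fst_conv snd_conv)
    show "integrable lborel (\<lambda>y. ?P x y)"
      unfolding eq by (intro integrable_mult_right plancherel_ineq Hi Hi2)
    have "(\<integral>y. ?P x y \<partial>lborel) = (inverse (2 * pi * \<epsilon>))^2 * (\<integral>y. (cmod (fourier (H x) y))^2 \<partial>lborel)"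
      unfolding eq by simp
    also have "\<dots> \<le> (inverse (2 * pi * \<epsilon>))^2 * (2 * pi * (A^2 * pi * w x))"
      by (intro mult_left_mono order_trans[OF plancherel_ineq(2)[OF Hi Hi2]] HI2) auto
    also have "\<dots> = (A^2 / (2 * \<epsilon>^2)) * w x"
      using \<epsilon> by (simp add: field_simps power2_eq_square)
    finally show "(\<integral>y. ?P x y \<partial>lborel) \<le> (A^2 / (2 * \<epsilon>^2)) * w x" .
  qed
  have m [measurable]: "pot_op U \<epsilon> F \<in> borel_measurable (borel \<Otimes>\<^sub>M borel)" by (rule pot_op_measurable[OF U F])
  have isl: "integrable lborel (\<lambda>x. \<integral>y. ?P x y \<partial>lborel)"
  proof (rule Bochner_Integration.integrable_bound)
    show "integrable lborel (\<lambda>x. (A^2 / (2 * \<epsilon>^2)) * w x)" using iw by (intro integrable_mult_right)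
    show "AE x in lborel. norm (\<integral>y. ?P x y \<partial>lborel) \<le> norm ((A^2 / (2 * \<epsilon>^2)) * w x)"
    proof (intro AE_I2)
      fix x
      have "0 \<le> (\<integral>y. ?P x y \<partial>lborel)" by (intro integral_nonneg_AE) simp
      with slice(2)[of x] show "norm (\<integral>y. ?P x y \<partial>lborel) \<le> norm ((A^2 / (2 * \<epsilon>^2)) * w x)"
        unfolding real_norm_def by linarith
    qed
  qed measurable
  have pair: "integrable (lborel \<Otimes>\<^sub>M lborel) (\<lambda>p. (cmod (pot_op U \<epsilon> F p))^2)"
  proof (rule lborel_pair.Fubini_integrable)
    show "(\<lambda>p. (cmod (pot_op U \<epsilon> F p))^2) \<in> borel_measurable (lborel \<Otimes>\<^sub>M lborel)" by measurable
    show "integrable lborel (\<lambda>x. \<integral>y. norm (?P x y) \<partial>lborel)"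
      using isl by simp
    show "AE x in lborel. integrable lborel (\<lambda>y. ?P x y)"
      using slice(1) by simp
  qed
  then show "pot_op U \<epsilon> F \<in> L2"
    using m unfolding L2_def lborel_prod borel_prod by simp
  have "(L2_norm (pot_op U \<epsilon> F))^2 = (\<integral>x. \<integral>y. ?P x y \<partial>lborel \<partial>lborel)"
    unfolding L2_norm_square lborel_prod[symmetric] by (rule lborel_pair.integral_fst'[OF pair, symmetric])
  also have "\<dots> \<le> (\<integral>x. (A^2 / (2 * \<epsilon>^2)) * w x \<partial>lborel)"
    by (intro integral_mono isl slice integrable_mult_right iw)
  also have "\<dots> = (A / \<epsilon>)^2 * (pi / 2)" using iw by (simp add: power_divide)
  \<comment> \<open>A generous bound that makes the estimate a perfect square before the root is
    taken.\<close>
  also have "\<dots> \<le> (A / \<epsilon>)^2 * 4" using pi_less_4 by (intro mult_left_mono) auto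
  also have "\<dots> = (2 * (A / \<epsilon>))^2" by (simp add: power2_eq_square)
  finally have "L2_norm (pot_op U \<epsilon> F) \<le> 2 * (A / \<epsilon>)"
    by (rule power2_le_imp_le) (use A \<epsilon> in simp)
  then show "L2_norm (pot_op U \<epsilon> F) \<le> 8 * pi * C * K * sqrt \<epsilon> ^ M / \<epsilon>" by (simp add: A_def)
qed

section \<open>Linearity in the function and in the potential\<close>

definition pot_int :: "(real \<Rightarrow> real) \<Rightarrow> real \<Rightarrow> phase_fun \<Rightarrow> bool" where
  "pot_int U \<epsilon> F \<longleftrightarrow> (\<forall>x. integrable lborel (\<lambda>z. of_real (pot_diff U \<epsilon> x z) * pft F x z))"

lemma poly_growth_pot_int:
  assumes "poly_growth U C M m" "0 \<le> \<epsilon>" "\<epsilon> \<le> 1" "F \<in> schwartz"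
  shows "pot_int U \<epsilon> F"
  using pot_integrand_slice(1)[OF assms] by (simp add: pot_int_def)

text \<open>The default value of a divergent integral is not additive, so convergence of both
  integrals has to accompany additivity.\<close>

lemma pot_op_add:
  assumes "F \<in> schwartz" "G \<in> schwartz" "pot_int U \<epsilon> F" "pot_int U \<epsilon> G"
  shows "pot_op U \<epsilon> (\<lambda>p. F p + G p) = (\<lambda>p. pot_op U \<epsilon> F p + pot_op U \<epsilon> G p)"
  using assms unfolding pot_op_def pot_int_def
  by (simp add: pft_add distrib_left fourier_add)

lemma pot_op_cmult: "pot_op U \<epsilon> (\<lambda>p. c * F p) = (\<lambda>p. c * pot_op U \<epsilon> F p)"
  unfolding pot_op_def pft_cmult by (simp only: mult.left_commute[of _ c] fourier_cmult)

lemma pot_op_add_pot: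
  assumes "pot_int U \<epsilon> F" "pot_int V \<epsilon> F"
  shows "pot_int (\<lambda>u. U u + V u) \<epsilon> F" "pot_op (\<lambda>u. U u + V u) \<epsilon> F p = pot_op U \<epsilon> F p + pot_op V \<epsilon> F p"
proof -
  have eq: "(\<lambda>z. of_real (pot_diff (\<lambda>u. U u + V u) \<epsilon> x z) * pft F x z)
    = (\<lambda>z. of_real (pot_diff U \<epsilon> x z) * pft F x z + of_real (pot_diff V \<epsilon> x z) * pft F x z)" for x
    by (simp add: pot_diff_def fun_eq_iff algebra_simps)
  show "pot_int (\<lambda>u. U u + V u) \<epsilon> F"
    using assms unfolding pot_int_def eq by auto
  show "pot_op (\<lambda>u. U u + V u) \<epsilon> F p = pot_op U \<epsilon> F p + pot_op V \<epsilon> F p"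
    using assms unfolding pot_op_def pot_int_def eq by (simp add: fourier_add distrib_left)
qed

lemma pot_op_cmult_pot:
  shows "pot_int U \<epsilon> F \<Longrightarrow> pot_int (\<lambda>u. a * U u) \<epsilon> F" "pot_op (\<lambda>u. a * U u) \<epsilon> F p = of_real a * pot_op U \<epsilon> F p"
proof -
  have eq: "(\<lambda>z. of_real (pot_diff (\<lambda>u. a * U u) \<epsilon> x z) * pft F x z)
    = (\<lambda>z. of_real a * (of_real (pot_diff U \<epsilon> x z) * pft F x z))" for x
    by (simp add: pot_diff_def fun_eq_iff algebra_simps)
  show "pot_int U \<epsilon> F \<Longrightarrow> pot_int (\<lambda>u. a * U u) \<epsilon> F"
    unfolding pot_int_def eq by auto
  show "pot_op (\<lambda>u. a * U u) \<epsilon> F p = of_real a * pot_op U \<epsilon> F p"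
    unfolding pot_op_def eq fourier_cmult by (simp only: mult.left_commute)
qed

lemma pot_op_zero_pot: "pot_int (\<lambda>u. 0) \<epsilon> F" "pot_op (\<lambda>u. 0) \<epsilon> F p = 0"
  by (simp_all add: pot_int_def pot_op_def pot_diff_def fourier_def)

lemma pot_op_sum_pot:
  assumes "finite I" "\<And>i. i \<in> I \<Longrightarrow> pot_int (U i) \<epsilon> F"
  shows "pot_int (\<lambda>u. \<Sum>i\<in>I. a i * U i u) \<epsilon> F \<and>
    pot_op (\<lambda>u. \<Sum>i\<in>I. a i * U i u) \<epsilon> F p = (\<Sum>i\<in>I. of_real (a i) * pot_op (U i) \<epsilon> F p)"
  using assms
proof (induction I rule: finite_induct)
  case empty
  then show ?case by (simp add: pot_op_zero_pot)
next
  case (insert j I)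
  then show ?case
    using pot_op_add_pot[OF pot_op_cmult_pot(1)[of "U j" \<epsilon> F "a j"], of "\<lambda>u. \<Sum>i\<in>I. a i * U i u"]
    by (simp add: pot_op_cmult_pot(2))
qed

lemma poly_growth_monomial: "poly_growth (\<lambda>u. u ^ k) 1 k 0"
  by (auto simp: poly_growth_def power_abs intro!: continuous_intros)

text \<open>The factor \<open>1 - (-1) ^ i\<close> annihilates even powers of \<open>z\<close>; for
  this reason only odd \<eta>-derivatives occur in \<open>B_op\<close>.\<close>

lemma pot_diff_monomial:
  "pot_diff (\<lambda>u. u ^ k) \<epsilon> x z =
    (\<Sum>i\<le>k. (sqrt \<epsilon> ^ k * real (k choose i) * ((1 - (-1) ^ i) / 2 ^ i) * x ^ (k - i)) * z ^ i)"
proof -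
  have "(sqrt \<epsilon> * (x + z / 2)) ^ k = (\<Sum>i\<le>k. sqrt \<epsilon> ^ k * (real (k choose i) * (z / 2) ^ i * x ^ (k - i)))"
    unfolding power_mult_distrib add.commute[of x] binomial_ring sum_distrib_left by simp
  moreover have "(sqrt \<epsilon> * (x - z / 2)) ^ k = (\<Sum>i\<le>k. sqrt \<epsilon> ^ k * (real (k choose i) * (- (z / 2)) ^ i * x ^ (k - i)))"
  proof -
    have "x - z / 2 = - (z / 2) + x" by simp
    then show ?thesis unfolding power_mult_distrib sum_distrib_left[symmetric] by (simp only: binomial_ring)
  qed
  ultimately show ?thesis
    unfolding pot_diff_def
    by (simp only: sum_subtractf[symmetric] power_minus[of "z / 2"] power_divide)
      (intro sum.cong refl, simp add: field_simps)
qed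

text \<open>The shift by 2 in the exponent matches the division by \<epsilon>: the monomial of
  degree \<nu> + 2 acts at order \<open>sqrt \<epsilon> ^ \<nu>\<close>. The case \<nu> = 0 is
  included because it gives the harmonic force term.\<close>

lemma pot_op_monomial:
  assumes F: "F \<in> schwartz" and \<epsilon>: "\<epsilon> > 0"
  shows "pot_op (\<lambda>u. u ^ (\<nu> + 2)) \<epsilon> F p = - of_real (fact (\<nu> + 2) * sqrt \<epsilon> ^ \<nu>) *
    (\<Sum>j = 0..(\<nu> + 1) div 2. (\<i> / 2) ^ (2 * j) * (1 / fact (2 * j + 1)) *
      (of_real (fst p) ^ (\<nu> + 1 - 2 * j) / fact (\<nu> + 1 - 2 * j)) * (d_eta ^^ (2 * j + 1)) F p)"
proof -
  define k where "k = \<nu> + 2"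
  define x y where "x = fst p" and "y = snd p"
  have p: "(x, y) = p" by (simp add: x_def y_def)
  define c where "c i = sqrt \<epsilon> ^ k * real (k choose i) * ((1 - (-1) ^ i) / 2 ^ i) * x ^ (k - i)" for i
  \<comment> \<open>The exponent \<open>Suc i\<close> absorbs the factor \<open>- \<i>\<close> of
    the prefactor of \<open>pot_op\<close>.\<close>
  let ?t = "\<lambda>i. of_real (c i / \<epsilon>) * ((- \<i>) ^ Suc i * (d_eta ^^ i) F p)" and ?J = "(\<lambda>j. 2 * j + 1) ` {0..(\<nu> + 1) div 2}"
  have "(\<lambda>z. of_real (pot_diff (\<lambda>u. u ^ k) \<epsilon> x z) * pft F x z)
    = (\<lambda>z. \<Sum>i\<le>k. of_real (c i) * (of_real z ^ i * pft F x z))"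
    unfolding pot_diff_monomial c_def[symmetric] by (simp add: sum_distrib_right mult.assoc)
  then have "pot_op (\<lambda>u. u ^ k) \<epsilon> F p = - (\<i> / of_real (2 * pi * \<epsilon>)) *
      fourier (\<lambda>z. \<Sum>i\<le>k. of_real (c i) * (of_real z ^ i * pft F x z)) y"
    by (simp only: pot_op_def x_def y_def)
  also have "fourier (\<lambda>z. \<Sum>i\<le>k. of_real (c i) * (of_real z ^ i * pft F x z)) y
    = (\<Sum>i\<le>k. of_real (c i) * (of_real (2 * pi) * ((- \<i>) ^ i * (d_eta ^^ i) F p)))"
    by (subst fourier_sum) (intro integrable_mult_right fourier_power_pft[OF F],
      simp only: fourier_cmult fourier_power_pft[OF F] p)
  also have "- (\<i> / of_real (2 * pi * \<epsilon>)) * \<dots> = (\<Sum>i\<le>k. ?t i)"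
    using \<epsilon> unfolding sum_distrib_left by (intro sum.cong refl) (simp add: field_simps)
  \<comment> \<open>The odd indices up to \<nu> + 2 are exactly 2 j + 1 with j at most (\<nu> + 1)
    div 2.\<close>
  also have "\<dots> = (\<Sum>i\<in>?J. ?t i)"
  proof (rule sum.mono_neutral_right)
    show "?J \<subseteq> {..k}" by (auto simp: k_def)
    show "\<forall>i\<in>{..k} - ?J. ?t i = 0"
    proof
      fix i assume i: "i \<in> {..k} - ?J"
      have "even i"
      proof (rule ccontr)
        assume "odd i"
        then obtain j where "i = 2 * j + 1" by (auto elim: oddE)
        with i show False by (auto simp: k_def)
      qed
      then show "?t i = 0" by (simp add: c_def)
    qed
  qed simp
  also have "\<dots> = (\<Sum>j = 0..(\<nu> + 1) div 2. ?t (2 * j + 1))"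
    by (subst sum.reindex) (auto simp: inj_on_def)
  also have "\<dots> = (\<Sum>j = 0..(\<nu> + 1) div 2. - of_real (fact (\<nu> + 2) * sqrt \<epsilon> ^ \<nu>) * ((\<i> / 2) ^ (2 * j) * (1 / fact (2 * j + 1)) *
      (of_real x ^ (\<nu> + 1 - 2 * j) / fact (\<nu> + 1 - 2 * j)) * (d_eta ^^ (2 * j + 1)) F p))"
  proof (intro sum.cong refl)
    fix j assume j: "j \<in> {0..(\<nu> + 1) div 2}"
    have le: "2 * j + 1 \<le> k" and km: "k - (2 * j + 1) = \<nu> + 1 - 2 * j" using j by (auto simp: k_def)
    have s: "sqrt \<epsilon> ^ k / \<epsilon> = sqrt \<epsilon> ^ \<nu>"
      unfolding k_def power_add real_sqrt_pow2[OF less_imp_le[OF \<epsilon>]] using \<epsilon> by simp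
    have h: "(2::real) ^ (2 * j + 1) = 2 * 4 ^ j" by (simp add: power_mult)
    have "c (2 * j + 1) / \<epsilon> = (sqrt \<epsilon> ^ k / \<epsilon>) * real (k choose (2 * j + 1)) * (2 / 2 ^ (2 * j + 1)) * x ^ (k - (2 * j + 1))"
      by (simp add: c_def)
    also have "\<dots> = fact (\<nu> + 2) * sqrt \<epsilon> ^ \<nu> * ((1 / 4 ^ j) * (1 / fact (2 * j + 1)) * (x ^ (\<nu> + 1 - 2 * j) / fact (\<nu> + 1 - 2 * j)))"
      unfolding s binomial_fact[OF le] km h by (simp add: k_def mult_ac del: fact_Suc)
    finally have c: "c (2 * j + 1) / \<epsilon> = fact (\<nu> + 2) * sqrt \<epsilon> ^ \<nu> * ((1 / 4 ^ j) * (1 / fact (2 * j + 1)) * (x ^ (\<nu> + 1 - 2 * j) / fact (\<nu> + 1 - 2 * j)))" .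
    have i: "(- \<i>) ^ Suc (2 * j + 1) = - ((-1) ^ j)" by (simp add: power_mult)
    have i2: "(\<i> / 2) ^ (2 * j) = (-1) ^ j * (1 / 4 ^ j)"
      using power_minus[of "1 / 4 :: complex" j] by (simp add: power_mult power_divide)
    show "?t (2 * j + 1)
      = - of_real (fact (\<nu> + 2) * sqrt \<epsilon> ^ \<nu>) * ((\<i> / 2) ^ (2 * j) * (1 / fact (2 * j + 1)) *
      (of_real x ^ (\<nu> + 1 - 2 * j) / fact (\<nu> + 1 - 2 * j)) * (d_eta ^^ (2 * j + 1)) F p)"
      unfolding c i i2 by (simp del: funpow.simps fact_Suc)
  qed
  finally show ?thesis unfolding sum_distrib_left k_def x_def .
qed

lemma pot_op_quadratic:
  assumes F: "F \<in> schwartz" and \<epsilon>: "\<epsilon> > 0"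
  shows "pot_op (\<lambda>u. u ^ 2) \<epsilon> F p = - 2 * of_real (fst p) * d_eta F p"
  using pot_op_monomial[OF assms, of 0 p] by (simp add: numeral_2_eq_2)

lemma pot_op_B_op:
  assumes F: "F \<in> schwartz" and \<epsilon>: "\<epsilon> > 0" and \<nu>: "\<nu> \<ge> 1"
  shows "of_real ((deriv ^^ (\<nu> + 2)) V 0 / fact (\<nu> + 2)) * pot_op (\<lambda>u. u ^ (\<nu> + 2)) \<epsilon> F p = of_real (sqrt \<epsilon> ^ \<nu>) * B_op V \<nu> F p"
proof -
  \<comment> \<open>This reconciles the two upper limits of summation. At \<nu> = 0 truncated
    subtraction would give 1 on the left and 0 on the right.\<close>
  have e: "(\<nu> - 1) div 2 + 1 = (\<nu> + 1) div 2" using \<nu> by (cases \<nu>) auto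
  have gen: "of_real (a / f) * (- of_real (f * s) * S) = of_real s * (- of_real a * S)" if "f \<noteq> 0"
    for a f s :: real and S :: complex
    using that by simp
  show ?thesis
    unfolding pot_op_monomial[OF F \<epsilon>] B_op_def case_prod_beta prod.collapse e
    by (rule gen) (rule fact_nonzero)
qed

section \<open>Skew-symmetry of the Wigner operator\<close>

lemma schwartz_L2: "F \<in> schwartz \<Longrightarrow> F \<in> L2"
  using decaying_bound[OF schwartz_decaying] L2_weight_bound(1)[of F] schwartz_measurable[of F] by auto

lemma pot_op_in_L2:
  assumes U: "poly_growth U C M m" and \<epsilon>: "0 < \<epsilon>" "\<epsilon> \<le> 1" and F: "F \<in> schwartz"
  shows "pot_op U \<epsilon> F \<in> L2"
  using schwartz_one_minus_d2_decay[OF F, of "Suc (M + m)"] pot_op_L2(1)[OF U \<epsilon> F refl] by blast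

text \<open>For fixed \<xi> the multiplication formula moves the transform onto the other factor.
  What remains is the integral of the real function \<open>pot_diff\<close> against the squared
  modulus of \<open>pft F\<close>, times an imaginary constant.\<close>

lemma pot_op_skew:
  assumes U: "poly_growth U C M m" and \<epsilon>: "0 < \<epsilon>" "\<epsilon> \<le> 1" and F: "F \<in> schwartz"
  shows "Re (L2_inner (pot_op U \<epsilon> F) F) = 0"
proof -
  note P = pot_op_in_L2[OF assms]
  have i: "integrable (lborel \<Otimes>\<^sub>M lborel) (\<lambda>p. pot_op U \<epsilon> F p * cnj (F p))"
    unfolding lborel_prod by (rule L2_integrable_mult[OF P schwartz_L2[OF F]])
  define c where "c = - (\<i> / of_real (2 * pi * \<epsilon>))"
  have Re0: "Re (\<integral>y. pot_op U \<epsilon> F (x, y) * cnj (F (x, y)) \<partial>lborel) = 0" for x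
  proof -
    define H where "H z = of_real (pot_diff U \<epsilon> x z) * pft F x z" for z
    have iH: "integrable lborel H"
      unfolding H_def using pot_integrand_slice(1)[OF U _ _ F] \<epsilon> by simp
    have iF: "integrable lborel (\<lambda>y. cnj (F (x, y)))" using schwartz_slice(4)[OF F] by simp
    have cnj: "fourier (\<lambda>y. cnj (F (x, y))) z = cnj (pft F x z)" for z
      unfolding pft_def fourier_def by (subst Bochner_Integration.integral_cnj[symmetric]) (simp add: exp_cnj)
    have "(\<integral>y. pot_op U \<epsilon> F (x, y) * cnj (F (x, y)) \<partial>lborel) = c * (\<integral>y. cnj (F (x, y)) * fourier H y \<partial>lborel)"
      unfolding integral_mult_right_zero[symmetric] H_def
      by (intro Bochner_Integration.integral_cong refl) (simp only: pot_op_def c_def fst_conv snd_conv mult_ac)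
    also have "(\<integral>y. cnj (F (x, y)) * fourier H y \<partial>lborel) = (\<integral>z. H z * cnj (pft F x z) \<partial>lborel)"
      unfolding fourier_multiplication[OF iH iF] cnj ..
    also have "\<dots> = (\<integral>z. of_real (pot_diff U \<epsilon> x z * (cmod (pft F x z))^2) \<partial>lborel)"
      by (intro Bochner_Integration.integral_cong refl)
        (simp only: H_def of_real_mult complex_norm_square mult.assoc)
    also have "\<dots> = of_real (\<integral>z. pot_diff U \<epsilon> x z * (cmod (pft F x z))^2 \<partial>lborel)"
      by (rule integral_complex_of_real)
    finally show ?thesis by (simp add: c_def)
  qed
  have "L2_inner (pot_op U \<epsilon> F) F = (\<integral>x. (\<integral>y. pot_op U \<epsilon> F (x, y) * cnj (F (x, y)) \<partial>lborel) \<partial>lborel)"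
    unfolding L2_inner_def lborel_prod[symmetric] by (rule lborel_pair.integral_fst'[OF i, symmetric])
  then show ?thesis
    using lborel_pair.integrable_fst'[OF i] by (simp only: integral_Re[symmetric] Re0) simp
qed

lemma schwartz_slice_xi:
  assumes F: "F \<in> schwartz"
  shows "isCont (\<lambda>x. F (x, y)) x" "(\<lambda>x. F (x, y)) \<in> borel_measurable borel"
    "\<exists>K. \<forall>x. cmod (F (x, y)) \<le> K * inverse (1 + x^2)"
proof -
  show c: "isCont (\<lambda>x. F (x, y)) x" for x
    using has_vector_derivative_d_xi[OF schwartz_differentiable[OF F]] has_vector_derivative_continuous by blast
  then show m: "(\<lambda>x. F (x, y)) \<in> borel_measurable borel"
    by (intro borel_measurable_continuous_onI continuous_at_imp_continuous_on) auto
  obtain K where K: "\<And>p. cmod (F p) \<le> K * weight p"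
    using decaying_bound[OF schwartz_decaying[OF F]] by blast
  have "cmod (F (x, y)) \<le> (K * inverse (1 + y^2)) * inverse (1 + x^2)" for x
    using K[of "(x, y)"] by (simp add: weight_def mult_ac)
  then show "\<exists>K. \<forall>x. cmod (F (x, y)) \<le> K * inverse (1 + x^2)" by blast
qed

lemma product_decay:
  assumes K: "\<And>x::real. cmod (f x) \<le> K * inverse (1 + x^2)" and L: "\<And>x. cmod (g x) \<le> L * inverse (1 + x^2)"
  shows "cmod (f x * cnj (g x)) \<le> (K * L) * inverse (1 + x^2)"
proof -
  have L0: "L \<ge> 0" using order_trans[OF norm_ge_zero L[of 0]] by simp
  have "cmod (g x) \<le> L"
    using L[of x] mult_left_le[of "inverse (1 + x^2)" L] L0 by (simp add: inverse_le_1_iff)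
  with K[of x] have "cmod (f x) * cmod (g x) \<le> (K * inverse (1 + x^2)) * L"
    by (intro mult_mono) (auto intro: order_trans[OF norm_ge_zero])
  then show ?thesis by (simp add: norm_mult mult_ac)
qed

text \<open>Twice the real part of the integrand is \<eta> times the \<xi>-derivative of the squared
  modulus of \<open>F\<close>, whose integral in \<xi> vanishes by decay. Hence \<xi> is integrated
  first.\<close>

lemma transport_skew:
  assumes F: "F \<in> schwartz"
  shows "Re (L2_inner (\<lambda>p. of_real (snd p) * d_xi F p) F) = 0"
proof -
  have i: "integrable (lborel \<Otimes>\<^sub>M lborel) (\<lambda>p. (of_real (snd p) * d_xi F p) * cnj (F p))"
    unfolding lborel_prod
    by (intro L2_integrable_mult schwartz_L2 schwartz_eta_mult schwartz_d_xi F)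
  have Re0: "Re (\<integral>x. (of_real y * d_xi F (x, y)) * cnj (F (x, y)) \<partial>lborel) = 0" for y
  proof -
    define g where "g x = d_xi F (x, y) * cnj (F (x, y))" for x
    note dF = schwartz_d_xi[OF F]
    obtain K where K: "\<And>x. cmod (F (x, y)) \<le> K * inverse (1 + x^2)" using schwartz_slice_xi(3)[OF F] by blast
    obtain L where L: "\<And>x. cmod (d_xi F (x, y)) \<le> L * inverse (1 + x^2)" using schwartz_slice_xi(3)[OF dF] by blast
    note [measurable] = schwartz_slice_xi(2)[OF F] schwartz_slice_xi(2)[OF dF]
    have gm: "g \<in> borel_measurable borel" unfolding g_def by measurable
    have gi: "integrable lborel g"
      by (rule decay_integrable(1)[OF gm]) (unfold g_def, rule product_decay[OF L K])
    have D: "((\<lambda>x. F (x, y)) has_vector_derivative d_xi F (x, y)) (at x)" for x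
      by (rule has_vector_derivative_d_xi[OF schwartz_differentiable[OF F]])
    have "(\<integral>x. g x + cnj (g x) \<partial>lborel) = 0"
    proof (rule integral_derivative_eq_0)
      show "((\<lambda>x. F (x, y) * cnj (F (x, y))) has_vector_derivative g x + cnj (g x)) (at x)" for x
        using has_vector_derivative_mult[OF D has_vector_derivative_cnj[OF D]] by (simp add: g_def mult_ac add.commute)
      show "isCont (\<lambda>x. g x + cnj (g x)) x" for x
        unfolding g_def by (intro continuous_intros schwartz_slice_xi(1) F dF)
      show "integrable lborel (\<lambda>x. g x + cnj (g x))" using gi by simp
      from decay_tendsto_0[OF product_decay[OF K K]]
      show "((\<lambda>x. F (x, y) * cnj (F (x, y))) \<longlongrightarrow> 0) at_top" "((\<lambda>x. F (x, y) * cnj (F (x, y))) \<longlongrightarrow> 0) at_bot" .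
    qed
    then have "(\<integral>x. g x \<partial>lborel) + cnj (\<integral>x. g x \<partial>lborel) = 0" using gi by simp
    then have "Re (\<integral>x. g x \<partial>lborel) = 0" by (simp add: complex_eq_iff)
    moreover have "(\<integral>x. (of_real y * d_xi F (x, y)) * cnj (F (x, y)) \<partial>lborel) = of_real y * (\<integral>x. g x \<partial>lborel)"
      unfolding g_def by (simp only: mult.assoc integral_mult_right_zero)
    ultimately show ?thesis by simp
  qed
  have eq: "(\<lambda>(x, y). (of_real y * d_xi F (x, y)) * cnj (F (x, y))) = (\<lambda>p. (of_real (snd p) * d_xi F p) * cnj (F p))"
    by (simp add: fun_eq_iff)
  have i': "integrable (lborel \<Otimes>\<^sub>M lborel) (\<lambda>(x, y). (of_real y * d_xi F (x, y)) * cnj (F (x, y)))"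
    unfolding eq by (rule i)
  have "L2_inner (\<lambda>p. of_real (snd p) * d_xi F p) F = (\<integral>y. (\<integral>x. (of_real y * d_xi F (x, y)) * cnj (F (x, y)) \<partial>lborel) \<partial>lborel)"
    unfolding lborel_pair.integral_snd[OF i'] L2_inner_def lborel_prod[symmetric] eq ..
  then show ?thesis
    using lborel_pair.integrable_snd[OF i'] by (simp only: integral_Re[symmetric] Re0) simp
qed

lemma wigner_op_L2:
  assumes U: "poly_growth V C M m" and \<epsilon>: "0 < \<epsilon>" "\<epsilon> \<le> 1" and F: "F \<in> schwartz"
  shows "wigner_op V \<epsilon> F \<in> L2" "Re (L2_inner (wigner_op V \<epsilon> F) F) = 0"
proof -
  note P = pot_op_in_L2[OF assms]
  have T: "(\<lambda>p. of_real (snd p) * d_xi F p) \<in> L2"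
    by (intro schwartz_L2 schwartz_eta_mult schwartz_d_xi F)
  show "wigner_op V \<epsilon> F \<in> L2" unfolding wigner_op_eq by (intro L2_add P T)
  show "Re (L2_inner (wigner_op V \<epsilon> F) F) = 0"
    unfolding wigner_op_eq L2_inner_add_left[OF T P schwartz_L2[OF F]]
    by (simp add: pot_op_skew[OF U \<epsilon> F] transport_skew[OF F])
qed

lemma wigner_op_lincomb:
  assumes U: "poly_growth V C M m" and \<epsilon>: "0 < \<epsilon>" "\<epsilon> \<le> 1" and F: "F \<in> schwartz" "G \<in> schwartz"
  shows "wigner_op V \<epsilon> (\<lambda>p. F p + c * G p) = (\<lambda>p. wigner_op V \<epsilon> F p + c * wigner_op V \<epsilon> G p)"
proof -
  have G': "(\<lambda>p. c * G p) \<in> schwartz" by (intro schwartz_cmult F)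
  have i: "pot_int V \<epsilon> H" if "H \<in> schwartz" for H
    using poly_growth_pot_int[OF U _ _ that] \<epsilon> by simp
  show ?thesis
    unfolding wigner_op_eq pot_op_add[OF F(1) G' i[OF F(1)] i[OF G']] pot_op_cmult
    by (simp only: d_xi_add d_xi_cmult schwartz_differentiable F G') (simp add: algebra_simps)
qed

lemma wigner_op_diff:
  assumes "poly_growth V C M m" "0 < \<epsilon>" "\<epsilon> \<le> 1" "F \<in> schwartz" "G \<in> schwartz"
  shows "wigner_op V \<epsilon> (\<lambda>p. F p - G p) = (\<lambda>p. wigner_op V \<epsilon> F p - wigner_op V \<epsilon> G p)"
  using wigner_op_lincomb[OF assms, of "-1"] by simp

lemma wigner_op_sum:
  assumes U: "poly_growth V C M m" and \<epsilon>: "0 < \<epsilon>" "\<epsilon> \<le> 1"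
    and F: "finite I" "\<And>i. i \<in> I \<Longrightarrow> F i \<in> schwartz"
  shows "wigner_op V \<epsilon> (\<lambda>p. \<Sum>i\<in>I. c i * F i p) = (\<lambda>p. \<Sum>i\<in>I. c i * wigner_op V \<epsilon> (F i) p)"
  using F
proof (induction I rule: finite_induct)
  case empty
  have "pot_op V \<epsilon> (\<lambda>p. 0) = (\<lambda>p. 0)" using pot_op_cmult[of V \<epsilon> 0] by simp
  moreover have "d_xi (\<lambda>p. 0) = (\<lambda>p. 0)" by (auto simp: fun_eq_iff d_xi_def)
  ultimately show ?case by (simp add: wigner_op_eq)
next
  case (insert j I)
  have "wigner_op V \<epsilon> (\<lambda>p. (\<Sum>i\<in>I. c i * F i p) + c j * F j p) = (\<lambda>p. (\<Sum>i\<in>I. c i * wigner_op V \<epsilon> (F i) p) + c j * wigner_op V \<epsilon> (F j) p)"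
    using insert by (subst wigner_op_lincomb[OF U \<epsilon>]) (auto intro!: schwartz_sum schwartz_cmult)
  then show ?case using insert(1,2) by (simp add: add.commute)
qed

lemma L2_inner_tendsto:
  assumes L2: "\<And>n. X n \<in> L2" "\<And>n. Y n \<in> L2" "X' \<in> L2" "Y' \<in> L2"
    and X: "(\<lambda>n. L2_norm (\<lambda>p. X n p - X' p)) \<longlonglongrightarrow> 0"
    and Y: "(\<lambda>n. L2_norm (\<lambda>p. Y n p - Y' p)) \<longlonglongrightarrow> 0"
  shows "(\<lambda>n. L2_inner (X n) (Y n)) \<longlonglongrightarrow> L2_inner X' Y'"
proof (rule Lim_null[THEN iffD2], rule Lim_null_comparison)
  let ?a = "\<lambda>n. L2_norm (\<lambda>p. X n p - X' p)" and ?b = "\<lambda>n. L2_norm (\<lambda>p. Y n p - Y' p)"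
  show "\<forall>\<^sub>F n in sequentially. norm (L2_inner (X n) (Y n) - L2_inner X' Y') \<le> ?a n * (?b n + L2_norm Y') + L2_norm X' * ?b n"
  proof (intro always_eventually allI)
    fix n
    have "L2_inner (X n) (Y n) - L2_inner X' Y' = L2_inner (\<lambda>p. X n p - X' p) (Y n) + L2_inner X' (\<lambda>p. Y n p - Y' p)"
      by (simp add: L2_inner_diff_left L2_inner_diff_right L2)
    also have "cmod \<dots> \<le> ?a n * L2_norm (Y n) + L2_norm X' * ?b n"
      by (intro order_trans[OF norm_triangle_ineq] add_mono L2_Cauchy_Schwarz L2_diff L2)
    also have "\<dots> \<le> ?a n * (?b n + L2_norm Y') + L2_norm X' * ?b n"
      using L2_norm_triangle[OF L2_diff[OF L2(2)[of n] L2(4)] L2(4)]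
      by (intro add_mono mult_left_mono) (auto simp: L2_norm_nonneg)
    finally show "norm (L2_inner (X n) (Y n) - L2_inner X' Y') \<le> ?a n * (?b n + L2_norm Y') + L2_norm X' * ?b n" .
  qed
  have "(\<lambda>n. ?a n * (?b n + L2_norm Y') + L2_norm X' * ?b n) \<longlonglongrightarrow> 0 * (0 + L2_norm Y') + L2_norm X' * 0"
    by (intro tendsto_intros X Y)
  then show "(\<lambda>n. ?a n * (?b n + L2_norm Y') + L2_norm X' * ?b n) \<longlonglongrightarrow> 0" by simp
qed

text \<open>If Schwartz functions approximate \<open>W\<close> in the graph norm, then subtracting
  \<open>A\<close> from them gives Schwartz functions approximating \<open>W - A\<close>. The
  vanishing real part passes to the limit because the inner product is continuous in both
  arguments.\<close>

lemma wigner_graph_skew: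
  assumes U: "poly_growth V C M m" and \<epsilon>: "0 < \<epsilon>" "\<epsilon> \<le> 1"
    and WG: "(W, G) \<in> wigner_graph V \<epsilon>" and A: "A \<in> schwartz"
  shows "Re (L2_inner (\<lambda>p. G p - wigner_op V \<epsilon> A p) (\<lambda>p. W p - A p)) = 0"
proof -
  obtain \<Phi> where WG2: "W \<in> L2" "G \<in> L2" and \<Phi>: "\<And>n. \<Phi> n \<in> schwartz" "\<And>n. wigner_op V \<epsilon> (\<Phi> n) \<in> L2"
    "(\<lambda>n. L2_norm (\<lambda>p. \<Phi> n p - W p)) \<longlonglongrightarrow> 0" "(\<lambda>n. L2_norm (\<lambda>p. wigner_op V \<epsilon> (\<Phi> n) p - G p)) \<longlonglongrightarrow> 0"
    using WG unfolding wigner_graph_def by auto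
  have LA: "wigner_op V \<epsilon> A \<in> L2" by (rule wigner_op_L2[OF U \<epsilon> A])
  note \<Psi> = schwartz_diff[OF \<Phi>(1) A]
  have "(\<lambda>n. L2_inner (wigner_op V \<epsilon> (\<lambda>p. \<Phi> n p - A p)) (\<lambda>p. \<Phi> n p - A p))
    \<longlonglongrightarrow> L2_inner (\<lambda>p. G p - wigner_op V \<epsilon> A p) (\<lambda>p. W p - A p)"
    unfolding wigner_op_diff[OF U \<epsilon> \<Phi>(1) A]
    by (rule L2_inner_tendsto)
      (use \<Phi>(3,4) in \<open>simp_all add: L2_diff LA schwartz_L2[OF A] schwartz_L2[OF \<Phi>(1)] \<Phi>(2) WG2\<close>)
  from tendsto_Re[OF this] show ?thesis
    unfolding wigner_op_L2(2)[OF U \<epsilon> \<Psi>] by (simp add: LIMSEQ_const_iff)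
qed

section \<open>Correctors\<close>

lemma harmonic_flow_add: "harmonic_flow s (harmonic_flow t p) = harmonic_flow (s + t) p"
  by (simp add: harmonic_flow_def case_prod_beta cos_add sin_add algebra_simps)

text \<open>The group law removes \<open>s\<close> from the rotation. In a Duhamel integral the
  variable of integration is then left in the scalar coefficient alone.\<close>

lemma harmonic_term_flow: "harmonic_term \<phi> s (harmonic_flow (- (t - s)) p) = harmonic_term \<phi> t p"
  by (simp add: harmonic_term_def harmonic_flow_add)

section \<open>Time increments, with bounds uniform in time\<close>

lemma harmonic_term_weight:
  assumes "\<phi> \<in> schwartz"
  shows "\<exists>K\<ge>0. \<forall>t p. cmod (harmonic_term \<phi> t p) \<le> K * weight p"
proof -
  obtain K where K: "K \<ge> 0" "\<And>t x y. (1 + x^2) ^ 1 * (1 + y^2) ^ 1 * cmod (harmonic_term \<phi> t (x, y)) \<le> K"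
    using harmonic_term_decay[OF schwartz_decaying[OF assms], of 1] by blast
  have "cmod (harmonic_term \<phi> t p) \<le> K * weight p" for t p by (rule le_weight) (rule K(2))
  with K(1) show ?thesis by blast
qed

lemma rot_family_L2:
  assumes "rot_family Z"
  shows "\<exists>K\<ge>0. \<forall>t\<ge>0. L2_norm (Z t) \<le> K * exp t"
proof -
  obtain K where K: "K \<ge> 0" "\<And>t x y. t \<ge> 0 \<Longrightarrow> (1 + x^2) ^ 1 * (1 + y^2) ^ 1 * cmod (Z t (x, y)) \<le> K * exp t"
    using rot_family_decay[OF assms, of 1] by blast
  have "L2_norm (Z t) \<le> (K * exp t) * pi" if "t \<ge> 0" for t
    using that schwartz_measurable[OF rot_family_schwartz[OF assms that]]
    by (intro L2_weight_bound(2) le_weight K) auto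
  then show ?thesis using K(1) by (intro exI[of _ "K * pi"]) (auto simp: mult_ac)
qed

text \<open>The factor 3 is 2 from the oscillation of the derivative in the linearization bound,
  plus 1 from its value at \<open>a\<close>.\<close>

lemma vector_derivative_bound:
  fixes f :: "real \<Rightarrow> 'a :: real_normed_vector"
  assumes "\<And>x. (f has_vector_derivative f' x) (at x)" "\<And>x. norm (f' x) \<le> B"
  shows "norm (f b - f a) \<le> 3 * B * \<bar>b - a\<bar>"
proof -
  have "norm (f b - f a - (b - a) *\<^sub>R f' a) \<le> norm (b - a) * (2 * B)"
  proof (rule vector_differentiable_bound_linearization[where S = UNIV])
    show "norm (f' x - f' a) \<le> 2 * B" for x
      using norm_triangle_ineq4[of "f' x" "f' a"] assms(2)[of x] assms(2)[of a] by linarith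
  qed (use assms in auto)
  moreover have "norm ((b - a) *\<^sub>R f' a) \<le> \<bar>b - a\<bar> * B"
    using assms(2) by (simp add: mult_left_mono)
  moreover have "norm (f b - f a) \<le> norm (f b - f a - (b - a) *\<^sub>R f' a) + norm ((b - a) *\<^sub>R f' a)"
    using norm_triangle_ineq[of "f b - f a - (b - a) *\<^sub>R f' a" "(b - a) *\<^sub>R f' a"] by simp
  ultimately show ?thesis by (simp add: algebra_simps)
qed

lemma vector_derivative_taylor_bound:
  fixes f :: "real \<Rightarrow> 'a :: real_normed_vector"
  assumes f: "\<And>x. (f has_vector_derivative f' x) (at x)"
    and f': "\<And>x. (f' has_vector_derivative f'' x) (at x)" "\<And>x. norm (f'' x) \<le> B"
  shows "norm (f b - f a - (b - a) *\<^sub>R f' a) \<le> 3 * B * \<bar>b - a\<bar>^2"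
proof -
  have B: "B \<ge> 0" using order_trans[OF norm_ge_zero f'(2)] .
  have "norm (f b - f a - (b - a) *\<^sub>R f' a) \<le> norm (b - a) * (3 * B * \<bar>b - a\<bar>)"
  proof (rule vector_differentiable_bound_linearization[where S = "closed_segment a b"])
    show "norm (f' x - f' a) \<le> 3 * B * \<bar>b - a\<bar>" if "x \<in> closed_segment a b" for x
    proof -
      have "\<bar>x - a\<bar> \<le> \<bar>b - a\<bar>" using that by (auto simp: closed_segment_eq_real_ivl split: if_splits)
      then show ?thesis
        using vector_derivative_bound[OF f', of x a] B mult_left_mono[of "\<bar>x - a\<bar>" "\<bar>b - a\<bar>" "3 * B"] by linarith
    qed
  qed (auto intro: has_vector_derivative_at_within f)
  then show ?thesis by (simp add: power2_eq_square mult_ac)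
qed

text \<open>Time derivatives of a rotated Schwartz function are again rotated Schwartz functions,
  obtained by applying \<open>L_harm\<close>. They are bounded by multiples of \<open>weight\<close>
  uniformly in time, so the mean value and Taylor estimates are uniform too.\<close>

lemma harmonic_term_increment:
  assumes \<phi>: "\<phi> \<in> schwartz"
  shows "\<exists>K\<ge>0. \<forall>t h p. cmod (harmonic_term \<phi> (t + h) p - harmonic_term \<phi> t p) \<le> (K * \<bar>h\<bar>) * weight p"
    "\<exists>K\<ge>0. \<forall>t h p. cmod (harmonic_term \<phi> (t + h) p - harmonic_term \<phi> t p + of_real h * harmonic_term (L_harm \<phi>) t p) \<le> (K * \<bar>h\<bar>^2) * weight p"
proof -
  let ?d = "\<lambda>t h p. cmod (harmonic_term \<phi> (t + h) p - harmonic_term \<phi> t p)"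
  let ?d2 = "\<lambda>t h p. cmod (harmonic_term \<phi> (t + h) p - harmonic_term \<phi> t p + of_real h * harmonic_term (L_harm \<phi>) t p)"
  note L = schwartz_L_harm[OF \<phi>] and LL = schwartz_L_harm[OF schwartz_L_harm[OF \<phi>]]
  obtain K where K: "K \<ge> 0" "\<And>t p. cmod (harmonic_term (L_harm \<phi>) t p) \<le> K * weight p"
    using harmonic_term_weight[OF L] by blast
  obtain K2 where K2: "K2 \<ge> 0" "\<And>t p. cmod (harmonic_term (L_harm (L_harm \<phi>)) t p) \<le> K2 * weight p"
    using harmonic_term_weight[OF LL] by blast
  have D: "((\<lambda>t. harmonic_term \<phi> t p) has_vector_derivative - harmonic_term (L_harm \<phi>) t p) (at t)" for t p
    by (rule harmonic_term_time_derivative[OF \<phi>])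
  have D2: "((\<lambda>t. - harmonic_term (L_harm \<phi>) t p) has_vector_derivative harmonic_term (L_harm (L_harm \<phi>)) t p) (at t)" for t p
    using has_vector_derivative_minus[OF harmonic_term_time_derivative[OF L]] by simp
  have "?d t h p \<le> ((3 * K) * \<bar>h\<bar>) * weight p" for t h p
    using vector_derivative_bound[where f = "\<lambda>t. harmonic_term \<phi> t p" and B = "K * weight p" and b = "t + h" and a = t, OF D] K(2)
    by (simp add: mult_ac)
  then show "\<exists>K\<ge>0. \<forall>t h p. ?d t h p \<le> (K * \<bar>h\<bar>) * weight p"
    using K(1) by (intro exI[of _ "3 * K"]) auto
  have "?d2 t h p
    \<le> ((3 * K2) * \<bar>h\<bar>^2) * weight p" for t h p
    using vector_derivative_taylor_bound[where f = "\<lambda>t. harmonic_term \<phi> t p" and b = "t + h" and a = t, OF D D2 K2(2)]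
    by (simp add: mult_ac scaleR_conv_of_real)
  then show "\<exists>K\<ge>0. \<forall>t h p. ?d2 t h p \<le> (K * \<bar>h\<bar>^2) * weight p"
    using K2(1) by (intro exI[of _ "3 * K2"]) auto
qed

text \<open>The product rule is proved pointwise with an error of the form
  \<open>e h * weight p\<close>, where \<open>e h\<close> tends to 0; the weight then converts this
  into convergence in L2.\<close>

lemma has_L2_derivative_term:
  assumes \<phi>: "\<phi> \<in> schwartz" and C: "(C has_vector_derivative c) (at t)"
  shows "has_L2_derivative (\<lambda>t p. C t * harmonic_term \<phi> t p)
    (\<lambda>p. c * harmonic_term \<phi> t p - L_harm (\<lambda>p. C t * harmonic_term \<phi> t p) p) t"
proof -
  obtain K0 where K0: "K0 \<ge> 0" "\<And>t p. cmod (harmonic_term \<phi> t p) \<le> K0 * weight p"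
    using harmonic_term_weight[OF \<phi>] by blast
  obtain K1 where K1: "K1 \<ge> 0" "\<And>t h p. cmod (harmonic_term \<phi> (t + h) p - harmonic_term \<phi> t p) \<le> (K1 * \<bar>h\<bar>) * weight p"
    using harmonic_term_increment(1)[OF \<phi>] by blast
  obtain K2 where K2: "K2 \<ge> 0" "\<And>t h p. cmod (harmonic_term \<phi> (t + h) p - harmonic_term \<phi> t p + of_real h * harmonic_term (L_harm \<phi>) t p) \<le> (K2 * \<bar>h\<bar>^2) * weight p"
    using harmonic_term_increment(2)[OF \<phi>] by blast
  define \<delta> where "\<delta> h = (C (t + h) - C t) / of_real h - c" for h :: real
  define T where "T = harmonic_term \<phi>"
  define LT where "LT = harmonic_term (L_harm \<phi>)"
  let ?Q = "\<lambda>h p. (C (t + h) * T (t + h) p - C t * T t p) / of_real h - (c * T t p - C t * LT t p)"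
  have \<delta>: "((\<lambda>h. cmod (\<delta> h)) \<longlongrightarrow> 0) (at 0)"
  proof (rule Lim_transform_eventually)
    show "((\<lambda>h. norm (C (t + h) - C t - h *\<^sub>R c) / norm h) \<longlongrightarrow> 0) (at 0)"
      using C unfolding has_vector_derivative_def has_derivative_at by blast
    have "norm (C (t + h) - C t - h *\<^sub>R c) / norm h = cmod (\<delta> h)" if "h \<noteq> 0" for h
    proof -
      have "C (t + h) - C t - h *\<^sub>R c = of_real h * \<delta> h"
        using that by (simp add: \<delta>_def scaleR_conv_of_real field_simps)
      then show ?thesis using that by (simp add: norm_mult)
    qed
    then show "\<forall>\<^sub>F h in at 0. norm (C (t + h) - C t - h *\<^sub>R c) / norm h = cmod (\<delta> h)"
      by (auto simp: eventually_at_filter)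
  qed
  define e where "e h = cmod (\<delta> h) * K0 + cmod c * (K1 * \<bar>h\<bar>) + cmod (C t) * (K2 * \<bar>h\<bar>)" for h
  have X: "(\<lambda>p. c * T t p - L_harm (\<lambda>p. C t * T t p) p) = (\<lambda>p. c * T t p - C t * LT t p)"
    unfolding T_def LT_def by (simp only: L_harm_cmult[OF schwartz_harmonic_term[OF \<phi>]] L_harm_harmonic_term[OF \<phi>])
  have cont: "continuous_on UNIV (T s)" "continuous_on UNIV (LT s)" for s
    unfolding T_def LT_def by (intro continuous_schwartz schwartz_harmonic_term schwartz_L_harm \<phi>)+
  have bound: "cmod (?Q h p) \<le> e h * weight p"
    if h: "h \<noteq> 0" for h p
  proof -
    \<comment> \<open>The three errors are that of the scalar derivative, the first-order increment
      of the rotation, and its second-order Taylor error divided by \<open>h\<close>.\<close>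
    have "?Q h p
      = \<delta> h * T (t + h) p + c * (T (t + h) p - T t p) + C t * ((T (t + h) p - T t p + of_real h * LT t p) / of_real h)"
      using h by (simp add: \<delta>_def field_simps)
    also have "cmod \<dots> \<le> cmod (\<delta> h) * cmod (T (t + h) p) + cmod c * cmod (T (t + h) p - T t p)
      + cmod (C t) * (cmod (T (t + h) p - T t p + of_real h * LT t p) / \<bar>h\<bar>)"
      by (intro order_trans[OF norm_triangle_ineq] add_mono) (simp_all add: norm_mult norm_divide)
    also have "\<dots> \<le> cmod (\<delta> h) * (K0 * weight p) + cmod c * ((K1 * \<bar>h\<bar>) * weight p)
      + cmod (C t) * (((K2 * \<bar>h\<bar>^2) * weight p) / \<bar>h\<bar>)"
      unfolding T_def LT_def using K0 K1 K2 by (intro add_mono mult_left_mono divide_right_mono) auto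
    also have "\<dots> = e h * weight p"
    proof -
      have "((K2 * r^2) * weight p) / r = (K2 * r) * weight p" if "r \<noteq> 0" for r
        using that by (simp add: power2_eq_square)
      from this[of "\<bar>h\<bar>"] h have "((K2 * \<bar>h\<bar>^2) * weight p) / \<bar>h\<bar> = (K2 * \<bar>h\<bar>) * weight p"
        by (simp only: abs_eq_0 not_False_eq_True)
      then show ?thesis by (simp only: e_def distrib_right mult.assoc)
    qed
    finally show ?thesis .
  qed
  have e: "(e \<longlongrightarrow> 0) (at 0)"
  proof -
    have "((\<lambda>h. cmod (\<delta> h) * K0 + cmod c * (K1 * \<bar>h\<bar>) + cmod (C t) * (K2 * \<bar>h\<bar>)) \<longlongrightarrow>
      0 * K0 + cmod c * (K1 * \<bar>0\<bar>) + cmod (C t) * (K2 * \<bar>0\<bar>)) (at 0)"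
      by (intro tendsto_intros \<delta>)
    then show ?thesis by (simp add: e_def[abs_def])
  qed
  show ?thesis
    unfolding has_L2_derivative_def T_def[symmetric] X
  proof (rule tendsto_sandwich[OF _ _ tendsto_const])
    show "((\<lambda>h. e h * pi) \<longlongrightarrow> 0) (at 0)" using tendsto_mult_right[OF e, of pi] by (simp add: tendsto_mult_left_zero e)
    show "\<forall>\<^sub>F h in at 0. L2_norm (?Q h) \<le> e h * pi"
    proof -
      have "L2_norm (?Q h) \<le> e h * pi" if "h \<noteq> 0" for h
      proof (rule L2_weight_bound(2)[OF _ bound[OF that]])
        have "continuous_on UNIV (?Q h)"
          using that by (intro continuous_intros cont) auto
        then show "(?Q h) \<in> borel_measurable lborel"
          by (simp add: borel_measurable_continuous_onI)
      qed
      then show ?thesis by (auto simp: eventually_at_filter)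
    qed
  qed (simp add: L2_norm_nonneg)
qed

section \<open>Duhamel's formula for rotated families\<close>

definition duhamel :: "(real \<Rightarrow> phase_fun) \<Rightarrow> real \<Rightarrow> phase_fun" where
  "duhamel D t p = integral {0..t} (\<lambda>s. D s (harmonic_flow (- (t - s)) p))"

text \<open>The term -1 is kept for its two uses: dropping it reproduces the bound
  \<open>K * exp t\<close>, while keeping it shows that the integral vanishes as \<open>t\<close>
  tends to 0.\<close>

lemma integral_exp_bound:
  assumes "continuous_on {0..t} c" "\<And>s. s \<ge> 0 \<Longrightarrow> cmod (c s) \<le> K * exp s" "t \<ge> 0"
  shows "cmod (integral {0..t} c) \<le> K * (exp t - 1)"
proof -
  have I: "((\<lambda>s. K * exp s) has_integral (K * exp t - K * exp 0)) {0..t}"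
    using assms(3) by (intro fundamental_theorem_of_calculus)
      (auto intro!: derivative_eq_intros simp flip: has_real_derivative_iff_has_vector_derivative)
  have "cmod (integral {0..t} c) \<le> integral {0..t} (\<lambda>s. K * exp s)"
    using assms by (intro integral_norm_bound_integral integrable_continuous_real[OF assms(1)] has_integral_integrable[OF I]) auto
  then show ?thesis using integral_unique[OF I] by (simp add: algebra_simps)
qed

text \<open>The four claims share one induction because the case of a sum needs them together:
  integrability to split the integral, and membership in the family, hence the Schwartz property, to
  add derivatives and norms.\<close>

lemma duhamel_properties:
  assumes "rot_family D"
  shows "(\<forall>t\<ge>0. \<forall>p. (\<lambda>s. D s (harmonic_flow (- (t - s)) p)) integrable_on {0..t}) \<and>
    rot_family (duhamel D) \<and>
    (\<forall>t>0. has_L2_derivative (duhamel D) (\<lambda>p. D t p - L_harm (duhamel D t) p) t) \<and>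
    ((\<lambda>t. L2_norm (duhamel D t)) \<longlongrightarrow> 0) (at_right 0)"
  using assms
proof induction
  case (basic \<phi> c K)
  define C where "C t = integral {0..t} c" for t
  have eq: "duhamel (\<lambda>t p. c t * harmonic_term \<phi> t p) = (\<lambda>t p. C t * harmonic_term \<phi> t p)"
    unfolding duhamel_def C_def harmonic_term_flow by (intro ext) (rule integral_mult_left)
  have int: "c integrable_on {0..t}" for t
    by (intro integrable_continuous_real basic)
  have K: "K \<ge> 0" using order_trans[OF norm_ge_zero basic(3)[of 0]] by simp
  have Cb: "cmod (C t) \<le> K * (exp t - 1)" if "t \<ge> 0" for t
    unfolding C_def by (rule integral_exp_bound) (use basic that in auto)
  let ?Z = "\<lambda>t p. C t * harmonic_term \<phi> t p"
  have fam: "rot_family ?Z"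
  proof (rule rot_family.basic[OF basic(1)])
    show "continuous_on {0..b} C" for b
      unfolding C_def by (rule indefinite_integral_continuous_1[OF int])
    show "cmod (C t) \<le> K * exp t" if "t \<ge> 0" for t
      using Cb[OF that] K by (simp add: algebra_simps)
  qed
  have der: "has_L2_derivative ?Z
    (\<lambda>p. c t * harmonic_term \<phi> t p - L_harm (?Z t) p) t" if "t > 0" for t
  proof (rule has_L2_derivative_term[OF basic(1)])
    \<comment> \<open>The interval extends beyond \<open>t\<close>, so \<open>t\<close> is interior
      and the derivative is two-sided.\<close>
    have "(C has_vector_derivative c t) (at t within {0..t+1})"
      unfolding C_def by (rule integral_has_vector_derivative[OF basic(2)]) (use that in auto)
    then show "(C has_vector_derivative c t) (at t)"
      using that by (subst (asm) at_within_Icc_at) auto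
  qed
  have lim: "((\<lambda>t. L2_norm (?Z t)) \<longlongrightarrow> 0) (at_right 0)"
  proof -
    obtain L where L: "L \<ge> 0" "\<And>t. t \<ge> 0 \<Longrightarrow> L2_norm (harmonic_term \<phi> t) \<le> L * exp t"
      using rot_family_L2[OF rot_family_harmonic_term[OF basic(1)]] by blast
    show ?thesis
    proof (rule tendsto_sandwich[OF _ _ tendsto_const])
      show "\<forall>\<^sub>F t in at_right 0. L2_norm (?Z t) \<le> (K * (exp t - 1)) * (L * exp t)"
      proof -
        have "cmod (C t) * L2_norm (harmonic_term \<phi> t) \<le> (K * (exp t - 1)) * (L * exp t)" if "t > 0" for t
          using that K by (intro mult_mono Cb L L2_norm_nonneg) auto
        then show ?thesis by (auto simp: eventually_at_filter L2_norm_cmult)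
      qed
      have "((\<lambda>t. (K * (exp t - 1)) * (L * exp t)) \<longlongrightarrow> (K * (exp 0 - 1)) * (L * exp 0)) (at_right (0::real))"
        by (intro tendsto_intros)
      then show "((\<lambda>t. (K * (exp t - 1)) * (L * exp t)) \<longlongrightarrow> 0) (at_right (0::real))" by simp
    qed (simp add: L2_norm_nonneg)
  qed
  have "(\<lambda>s. c s * harmonic_term \<phi> s (harmonic_flow (- (t - s)) p)) integrable_on {0..t}" for t p
    unfolding harmonic_term_flow by (intro integrable_on_mult_left int)
  then show ?case
    unfolding eq using fam der lim by blast
next
  case (add Z Y)
  then have Z: "\<And>t p. t \<ge> 0 \<Longrightarrow> (\<lambda>s. Z s (harmonic_flow (- (t - s)) p)) integrable_on {0..t}"
    and Y: "\<And>t p. t \<ge> 0 \<Longrightarrow> (\<lambda>s. Y s (harmonic_flow (- (t - s)) p)) integrable_on {0..t}"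
    and fam: "rot_family (duhamel Z)" "rot_family (duhamel Y)"
    and der: "\<And>t. t > 0 \<Longrightarrow> has_L2_derivative (duhamel Z) (\<lambda>p. Z t p - L_harm (duhamel Z t) p) t"
      "\<And>t. t > 0 \<Longrightarrow> has_L2_derivative (duhamel Y) (\<lambda>p. Y t p - L_harm (duhamel Y t) p) t"
    and lim: "((\<lambda>t. L2_norm (duhamel Z t)) \<longlongrightarrow> 0) (at_right 0)" "((\<lambda>t. L2_norm (duhamel Y t)) \<longlongrightarrow> 0) (at_right 0)"
    by auto
  let ?D = "duhamel (\<lambda>t p. Z t p + Y t p)"
  have eq: "?D t = (\<lambda>p. duhamel Z t p + duhamel Y t p)" if "t \<ge> 0" for t
    unfolding duhamel_def by (intro ext Henstock_Kurzweil_Integration.integral_add Z Y that)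
  note S = rot_family_schwartz[OF fam(1)] rot_family_schwartz[OF fam(2)]
  note S' = rot_family_schwartz[OF add(1)] rot_family_schwartz[OF add(2)]
  have "rot_family (?D)"
    by (rule rot_family.cong[OF rot_family.add[OF fam]]) (rule eq)
  moreover have "has_L2_derivative (?D)
     (\<lambda>p. Z t p + Y t p - L_harm (?D t) p) t" if "t > 0" for t
  proof -
    have "has_L2_derivative (\<lambda>t p. duhamel Z t p + 1 * duhamel Y t p)
      (\<lambda>p. (Z t p - L_harm (duhamel Z t) p) + 1 * (Y t p - L_harm (duhamel Y t) p)) t"
      using that S S'
      by (intro has_L2_derivative_lincomb der) (auto intro!: schwartz_L2 schwartz_diff schwartz_L_harm)
    then have "has_L2_derivative (?D)
      (\<lambda>p. (Z t p - L_harm (duhamel Z t) p) + 1 * (Y t p - L_harm (duhamel Y t) p)) t"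
      by (rule has_L2_derivative_cong) (use that eq in auto)
    moreover have "(\<lambda>p. (Z t p - L_harm (duhamel Z t) p) + 1 * (Y t p - L_harm (duhamel Y t) p))
      = (\<lambda>p. Z t p + Y t p - L_harm (?D t) p)"
      using that S by (simp add: eq L_harm_add fun_eq_iff)
    ultimately show ?thesis by simp
  qed
  moreover have "((\<lambda>t. L2_norm (?D t)) \<longlongrightarrow> 0) (at_right 0)"
  proof (rule tendsto_sandwich[OF _ _ tendsto_const])
    show "((\<lambda>t. L2_norm (duhamel Z t) + L2_norm (duhamel Y t)) \<longlongrightarrow> 0) (at_right 0)"
      using tendsto_add[OF lim] by simp
    have "L2_norm (?D t) \<le> L2_norm (duhamel Z t) + L2_norm (duhamel Y t)" if "t > 0" for t
      using that S by (simp add: eq L2_norm_triangle schwartz_L2)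
    then show "\<forall>\<^sub>F t in at_right 0. L2_norm (?D t) \<le> L2_norm (duhamel Z t) + L2_norm (duhamel Y t)"
      by (auto simp: eventually_at_filter)
  qed (simp add: L2_norm_nonneg)
  ultimately show ?case using Z Y by (auto intro: integrable_add)
next
  case (cong Z Y)
  \<comment> \<open>No sign of \<open>t\<close> has to be distinguished: every \<open>s\<close> in
    \<open>{0..t}\<close> is nonnegative.\<close>
  have eq: "duhamel Y t = duhamel Z t" for t
    unfolding duhamel_def using cong(2) by (intro ext integral_cong) simp
  then have eq': "duhamel Y = duhamel Z" by (rule ext)
  have "(\<lambda>s. Y s (harmonic_flow (- (t - s)) p)) integrable_on {0..t}" if "t \<ge> 0" for t p
  proof -
    have "(\<lambda>s. Z s (harmonic_flow (- (t - s)) p)) integrable_on {0..t}" using cong(3) that by blast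
    then show ?thesis by (rule integrable_eq) (simp add: cong(2))
  qed
  then show ?case using cong(3) by (simp add: eq' cong(2))
qed

text \<open>With the harmonic term as index 0, both parts of the corrector source merge into one
  convolution sum, and the expansion into a single sum over \<open>l \<le> N\<close>.\<close>

definition expansion_term :: "(real \<Rightarrow> real) \<Rightarrow> phase_fun \<Rightarrow> nat \<Rightarrow> real \<Rightarrow> phase_fun" where
  "expansion_term V f0 l = (if l = 0 then harmonic_term f0 else corrector V f0 l)"

definition expansion_source :: "(real \<Rightarrow> real) \<Rightarrow> phase_fun \<Rightarrow> nat \<Rightarrow> real \<Rightarrow> phase_fun" where
  "expansion_source V f0 l t = (\<lambda>p. - (\<Sum>\<nu>=1..l. B_op V \<nu> (expansion_term V f0 (l - \<nu>) t) p))"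

lemma expansion_term_eq_duhamel:
  assumes "l \<ge> 1"
  shows "expansion_term V f0 l = duhamel (expansion_source V f0 l)"
proof -
  \<comment> \<open>The index \<nu> = l is the one whose operator acts on the harmonic term.\<close>
  have "{1..l} = insert l {1..<l}" using assms by auto
  then have "expansion_source V f0 l s q = - B_op V l (harmonic_term f0 s) q
      - (\<Sum>\<nu>\<in>{1..<l}. B_op V \<nu> (corrector V f0 (l - \<nu>) s) q)" for s q
    by (simp add: expansion_source_def expansion_term_def cong: sum.cong_simp)
  then have "corrector V f0 l = duhamel (expansion_source V f0 l)"
    by (subst corrector.simps) (simp add: duhamel_def[abs_def] Let_def)
  with assms show ?thesis by (simp add: expansion_term_def)
qed

lemma rot_family_expansion_source:
  assumes "\<And>k. k < l \<Longrightarrow> rot_family (expansion_term V f0 k)"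
  shows "rot_family (expansion_source V f0 l)"
proof -
  have "rot_family (\<lambda>t p. (-1) * (\<Sum>\<nu>=1..l. B_op V \<nu> (expansion_term V f0 (l - \<nu>) t) p))"
    by (intro rot_family_cmult rot_family_sum rot_family_B_op assms) auto
  then show ?thesis by (simp add: expansion_source_def[abs_def])
qed

lemma rot_family_expansion_term:
  assumes "f0 \<in> schwartz"
  shows "rot_family (expansion_term V f0 l)"
proof (induction l rule: less_induct)
  case (less l)
  show ?case
  proof (cases "l = 0")
    case True
    then show ?thesis by (simp add: expansion_term_def rot_family_harmonic_term assms)
  next
    case False
    then show ?thesis
      using duhamel_properties[OF rot_family_expansion_source[OF less]] by (simp add: expansion_term_eq_duhamel)
  qed
qed

lemma expansion_term_tendsto_0:
  assumes "f0 \<in> schwartz" "l \<ge> 1"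
  shows "((\<lambda>t. L2_norm (expansion_term V f0 l t)) \<longlongrightarrow> 0) (at_right 0)"
  using duhamel_properties[OF rot_family_expansion_source[OF rot_family_expansion_term[OF assms(1)]]] assms(2)
  by (simp add: expansion_term_eq_duhamel)

lemma expansion_term_derivative:
  assumes "f0 \<in> schwartz" "t > 0"
  shows "has_L2_derivative (expansion_term V f0 l) (\<lambda>p. expansion_source V f0 l t p - L_harm (expansion_term V f0 l t) p) t"
proof (cases "l = 0")
  case True
  then show ?thesis
    \<comment> \<open>The harmonic term has constant coefficient 1, and its source is an empty
      sum.\<close>
    using has_L2_derivative_term[OF assms(1), of "\<lambda>_. 1" 0 t]
    by (simp add: expansion_term_def expansion_source_def)
next
  case False
  then show ?thesis
    using duhamel_properties[OF rot_family_expansion_source[OF rot_family_expansion_term[OF assms(1)]]] assms(2)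
    by (simp add: expansion_term_eq_duhamel)
qed

lemma harmonic_term_tendsto:
  assumes "f0 \<in> schwartz"
  shows "((\<lambda>t. L2_norm (\<lambda>p. harmonic_term f0 t p - f0 p)) \<longlongrightarrow> 0) (at_right 0)"
proof -
  obtain K where K: "K \<ge> 0" "\<And>t h p. cmod (harmonic_term f0 (t + h) p - harmonic_term f0 t p) \<le> (K * \<bar>h\<bar>) * weight p"
    using harmonic_term_increment(1)[OF assms] by blast
  have 0: "harmonic_term f0 0 = f0" by (simp add: harmonic_term_def harmonic_flow_def fun_eq_iff)
  have "L2_norm (\<lambda>p. harmonic_term f0 t p - f0 p) \<le> (K * \<bar>t\<bar>) * pi" for t
    using K(2)[of 0 t] by (intro L2_weight_bound(2)) 
      (auto simp: 0 intro!: schwartz_measurable schwartz_diff schwartz_harmonic_term assms)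
  moreover have "((\<lambda>t. (K * \<bar>t\<bar>) * pi) \<longlongrightarrow> (K * \<bar>0\<bar>) * pi) (at_right 0)"
    by (intro tendsto_intros)
  ultimately show ?thesis
    using tendsto_sandwich[of "\<lambda>_. 0" "\<lambda>t. L2_norm (\<lambda>p. harmonic_term f0 t p - f0 p)" "at_right 0" "\<lambda>t. (K * \<bar>t\<bar>) * pi" 0]
    by (simp add: L2_norm_nonneg)
qed

section \<open>Residual and energy estimate\<close>

definition taylor_remainder :: "(real \<Rightarrow> real) \<Rightarrow> nat \<Rightarrow> real \<Rightarrow> real" where
  "taylor_remainder V n x = V x - (\<Sum>k<n. (deriv ^^ k) V 0 / fact k * x ^ k)"

lemma smooth_real_DERIV: "smooth_real V \<Longrightarrow> DERIV ((deriv ^^ k) V) x :> (deriv ^^ Suc k) V x"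
  by (simp add: smooth_real_def DERIV_deriv_iff_field_differentiable)

text \<open>On \<open>{-1..1}\<close> the Lagrange form applies, with \<open>B\<close> bounding the
  n-th derivative on this compact interval. For larger arguments no derivative of \<open>V\<close>
  enters away from 0: \<open>V\<close> and the polynomial are estimated separately, every lower
  power of the argument being at most the n-th.\<close>

lemma poly_growth_taylor_remainder:
  assumes V: "smooth_real V" and c: "\<And>x. \<bar>V x\<bar> \<le> c * (1 + \<bar>x\<bar> ^ m)"
  shows "\<exists>C. poly_growth (taylor_remainder V n) C n m"
proof -
  let ?a = "\<lambda>k. (deriv ^^ k) V 0 / fact k"
  note D = smooth_real_DERIV[OF V]
  have cont: "continuous_on A ((deriv ^^ k) V)" for k A
    using D by (intro continuous_at_imp_continuous_on) (blast intro: DERIV_isCont)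
  have "bounded ((deriv ^^ n) V ` {-1..1})"
    by (intro compact_imp_bounded compact_continuous_image cont compact_Icc)
  then obtain B where "\<forall>y\<in>(deriv ^^ n) V ` {-1..1}. norm y \<le> B" unfolding bounded_iff by blast
  then have B: "\<bar>(deriv ^^ n) V x\<bar> \<le> B" if "x \<in> {-1..1}" for x using that by auto
  have B0: "B \<ge> 0" using order_trans[OF abs_ge_zero B[of 0]] by simp
  have c0: "c \<ge> 0" using order_trans[OF abs_ge_zero c[of 0]] by (cases m) auto
  define S where "S = (\<Sum>k<n. \<bar>?a k\<bar>)"
  have S0: "S \<ge> 0" by (simp add: S_def sum_nonneg)
  have "\<bar>taylor_remainder V n x\<bar> \<le> (B + c + S) * \<bar>x\<bar> ^ n * (1 + \<bar>x\<bar> ^ m)" for x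
  proof (cases "\<bar>x\<bar> \<le> 1")
    case True
    obtain t where t: "\<bar>t\<bar> \<le> \<bar>x\<bar>" "V x = (\<Sum>k<n. ?a k * x ^ k) + ((deriv ^^ n) V t / fact n) * x ^ n"
      using Maclaurin_all_le[of "\<lambda>k. (deriv ^^ k) V" V x n] D by auto
    have "\<bar>taylor_remainder V n x\<bar> = \<bar>(deriv ^^ n) V t\<bar> * (1 / fact n) * \<bar>x\<bar> ^ n"
      unfolding taylor_remainder_def t(2) by (simp add: abs_mult power_abs)
    also have "\<dots> \<le> B * 1 * \<bar>x\<bar> ^ n"
      using t(1) True B0 by (intro mult_mono B) (auto simp: fact_ge_1)
    also have "\<dots> \<le> (B + c + S) * \<bar>x\<bar> ^ n * (1 + \<bar>x\<bar> ^ m)"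
      using B0 c0 S0 mult_mono[of "B * \<bar>x\<bar> ^ n" "(B + c + S) * \<bar>x\<bar> ^ n" 1 "1 + \<bar>x\<bar> ^ m"]
      by (simp add: mult_right_mono)
    finally show ?thesis .
  next
    case False
    then have x1: "1 \<le> \<bar>x\<bar>" by simp
    have "\<bar>taylor_remainder V n x\<bar> \<le> \<bar>V x\<bar> + (\<Sum>k<n. \<bar>?a k * x ^ k\<bar>)"
      unfolding taylor_remainder_def by (intro order_trans[OF abs_triangle_ineq4] add_left_mono sum_abs)
    also have "(\<Sum>k<n. \<bar>?a k * x ^ k\<bar>) \<le> (\<Sum>k<n. \<bar>?a k\<bar> * \<bar>x\<bar> ^ n)"
      unfolding abs_mult power_abs using x1 by (intro sum_mono mult_left_mono power_increasing) auto
    also have "\<dots> = S * \<bar>x\<bar> ^ n" by (simp add: S_def sum_distrib_right)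
    also have "\<bar>V x\<bar> \<le> c * (1 + \<bar>x\<bar> ^ m) * \<bar>x\<bar> ^ n"
    proof -
      have "c * (1 + \<bar>x\<bar> ^ m) * 1 \<le> c * (1 + \<bar>x\<bar> ^ m) * \<bar>x\<bar> ^ n"
        using c0 x1 by (intro mult_left_mono) auto
      then show ?thesis using c[of x] by simp
    qed
    also have "c * (1 + \<bar>x\<bar> ^ m) * \<bar>x\<bar> ^ n + S * \<bar>x\<bar> ^ n \<le> (B + c + S) * \<bar>x\<bar> ^ n * (1 + \<bar>x\<bar> ^ m)"
    proof -
      have "0 \<le> B * (\<bar>x\<bar> ^ n * (1 + \<bar>x\<bar> ^ m))" "0 \<le> S * \<bar>x\<bar> ^ n * \<bar>x\<bar> ^ m" using B0 S0 by simp_all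
      then show ?thesis by (simp add: algebra_simps)
    qed
    finally show ?thesis by simp
  qed
  moreover have "continuous_on UNIV (taylor_remainder V n)"
    unfolding taylor_remainder_def using cont[of UNIV 0] by (intro continuous_intros) auto
  ultimately show ?thesis
    using B0 c0 S0 unfolding poly_growth_def by (intro exI[of _ "B + c + S"]) auto
qed

lemma admissible_poly_growth:
  assumes "admissible_potential V"
  shows "\<exists>C m. poly_growth V C 0 m"
proof -
  obtain c m where c: "\<And>x. \<bar>V x\<bar> \<le> c * (1 + \<bar>x\<bar> ^ m)" using assms unfolding admissible_potential_def by blast
  have "continuous_on UNIV V"
    using assms smooth_real_DERIV[of V 0] unfolding admissible_potential_def
    by (intro continuous_at_imp_continuous_on) (auto intro: DERIV_isCont)
  moreover have "c \<ge> 0" using order_trans[OF abs_ge_zero c[of 0]] by (cases m) auto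
  ultimately show ?thesis using c by (auto simp: poly_growth_def)
qed

lemma sum_lessThan_plus_3: "(\<Sum>k<N+3. g k) = g 0 + g 1 + g 2 + (\<Sum>\<nu>=1..N. g (\<nu> + 2))"
  for g :: "nat \<Rightarrow> 'a :: comm_monoid_add"
  by (induction N) (simp_all add: eval_nat_numeral add_ac)

text \<open>Cutting the Taylor series after degree N + 2 keeps exactly the orders up to N of
  \<open>sqrt \<epsilon>\<close>. The vanishing of \<open>V\<close> and its first derivative at 0
  removes degrees 0 and 1, and the unit second derivative turns degree 2 into the force term of
  \<open>L_harm\<close>.\<close>

lemma wigner_op_expansion:
  assumes V: "admissible_potential V" and F: "F \<in> schwartz" and \<epsilon>: "0 < \<epsilon>" "\<epsilon> \<le> 1"
  shows "wigner_op V \<epsilon> F p = L_harm F p + (\<Sum>\<nu>=1..N. of_real (sqrt \<epsilon> ^ \<nu>) * B_op V \<nu> F p)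
    + pot_op (taylor_remainder V (N + 3)) \<epsilon> F p"
proof -
  define a where "a k = (deriv ^^ k) V 0 / fact k" for k
  have sm: "smooth_real V" and V0: "V 0 = 0" and V1: "deriv V 0 = 0" and V2: "deriv (deriv V) 0 = 1"
    using V unfolding admissible_potential_def by blast+
  have a012: "a 0 = 0" "a 1 = 0" "a 2 = 1 / 2"
    by (simp_all add: a_def V0 V1 V2 numeral_2_eq_2)
  obtain c m where c: "\<And>x. \<bar>V x\<bar> \<le> c * (1 + \<bar>x\<bar> ^ m)" using V unfolding admissible_potential_def by blast
  obtain C where C: "poly_growth (taylor_remainder V (N + 3)) C (N + 3) m"
    using poly_growth_taylor_remainder[OF sm c] by blast
  have i1: "pot_int (taylor_remainder V (N + 3)) \<epsilon> F" by (rule poly_growth_pot_int[OF C _ _ F]) (use \<epsilon> in auto)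
  have i2: "pot_int (\<lambda>u. u ^ k) \<epsilon> F" for k by (rule poly_growth_pot_int[OF poly_growth_monomial _ _ F]) (use \<epsilon> in auto)
  have V_eq: "V = (\<lambda>u. taylor_remainder V (N + 3) u + (\<Sum>k<N+3. a k * u ^ k))"
    by (simp add: taylor_remainder_def a_def)
  note S = pot_op_sum_pot[of "{..<N+3}" "\<lambda>k u. u ^ k" \<epsilon> F a p, OF _ i2]
  have "pot_op V \<epsilon> F p = pot_op (taylor_remainder V (N + 3)) \<epsilon> F p + (\<Sum>k<N+3. of_real (a k) * pot_op (\<lambda>u. u ^ k) \<epsilon> F p)"
    using pot_op_add_pot(2)[OF i1, of "\<lambda>u. \<Sum>k<N+3. a k * u ^ k" p] S
    unfolding V_eq[symmetric] by simp
  also have "(\<Sum>k<N+3. of_real (a k) * pot_op (\<lambda>u. u ^ k) \<epsilon> F p)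
    = - of_real (fst p) * d_eta F p + (\<Sum>\<nu>=1..N. of_real (a (\<nu> + 2)) * pot_op (\<lambda>u. u ^ (\<nu> + 2)) \<epsilon> F p)"
    unfolding sum_lessThan_plus_3 a012 pot_op_quadratic[OF F \<epsilon>(1)] by simp
  also have "(\<Sum>\<nu>=1..N. of_real (a (\<nu> + 2)) * pot_op (\<lambda>u. u ^ (\<nu> + 2)) \<epsilon> F p) = (\<Sum>\<nu>=1..N. of_real (sqrt \<epsilon> ^ \<nu>) * B_op V \<nu> F p)"
    unfolding a_def by (intro sum.cong refl pot_op_B_op[OF F \<epsilon>(1)]) auto
  finally show ?thesis by (simp add: wigner_op_eq L_harm_def)
qed

text \<open>With m = l - \<nu> the sum runs over a triangle inside the square of all pairs.
  Subtracting it from the full square leaves precisely the pairs with \<nu> + m > N.\<close>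

lemma convolution_sum:
  fixes g :: "nat \<Rightarrow> nat \<Rightarrow> 'a :: comm_monoid_add"
  shows "(\<Sum>l\<le>N. \<Sum>\<nu>=1..l. g \<nu> (l - \<nu>)) = (\<Sum>m\<le>N. \<Sum>\<nu>=1..N. if \<nu> + m \<le> N then g \<nu> m else 0)"
proof -
  have "(\<Sum>l\<le>N. \<Sum>\<nu>=1..l. g \<nu> (l - \<nu>)) = (\<Sum>(l, \<nu>)\<in>(SIGMA l:{..N}. {1..l}). g \<nu> (l - \<nu>))"
    by (rule sum.Sigma) auto
  also have "\<dots> = (\<Sum>(m, \<nu>)\<in>(SIGMA m:{..N}. {\<nu>\<in>{1..N}. \<nu> + m \<le> N}). g \<nu> m)"
    by (rule sum.reindex_bij_witness[of _ "\<lambda>(m, \<nu>). (m + \<nu>, \<nu>)" "\<lambda>(l, \<nu>). (l - \<nu>, \<nu>)"]) auto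
  also have "\<dots> = (\<Sum>m\<le>N. \<Sum>\<nu>\<in>{\<nu>\<in>{1..N}. \<nu> + m \<le> N}. g \<nu> m)"
    by (rule sum.Sigma[symmetric]) auto
  also have "\<dots> = (\<Sum>m\<le>N. \<Sum>\<nu>=1..N. if \<nu> + m \<le> N then g \<nu> m else 0)"
    by (intro sum.cong refl sum.inter_filter) simp
  finally show ?thesis .
qed

lemma L2_sum:
  assumes "finite I" "\<And>i. i \<in> I \<Longrightarrow> F i \<in> L2" "\<And>i. i \<in> I \<Longrightarrow> L2_norm (F i) \<le> b i"
  shows "(\<lambda>p. \<Sum>i\<in>I. F i p) \<in> L2 \<and> L2_norm (\<lambda>p. \<Sum>i\<in>I. F i p) \<le> (\<Sum>i\<in>I. b i)"
  using assms
proof (induction I rule: finite_induct)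
  case empty
  then show ?case by (simp add: L2_zero) (simp add: L2_norm_def)
next
  case (insert j I)
  then have "(\<lambda>p. \<Sum>i\<in>I. F i p) \<in> L2" "L2_norm (\<lambda>p. \<Sum>i\<in>I. F i p) \<le> (\<Sum>i\<in>I. b i)" "F j \<in> L2" "L2_norm (F j) \<le> b j"
    by auto
  then show ?case
    using insert(1,2) L2_norm_triangle[of "F j" "\<lambda>p. \<Sum>i\<in>I. F i p"] by (simp add: L2_add)
qed

lemma rot_family_one_minus_d2_power: "rot_family Z \<Longrightarrow> rot_family (\<lambda>t. (one_minus_d2 ^^ n) (Z t))"
proof (induction n)
  case (Suc n)
  have "rot_family (\<lambda>t. one_minus_d2 (Y t))" if "rot_family Y" for Y
    unfolding one_minus_d2_def by (intro rot_family.add rot_family_cmult rot_family_d_eta that)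
  with Suc show ?case by simp
qed simp

section \<open>The truncated expansion and its residual\<close>

definition approx :: "(real \<Rightarrow> real) \<Rightarrow> phase_fun \<Rightarrow> nat \<Rightarrow> real \<Rightarrow> real \<Rightarrow> phase_fun" where
  "approx V f0 N \<epsilon> t = (\<lambda>p. \<Sum>l\<le>N. of_real (sqrt \<epsilon> ^ l) * expansion_term V f0 l t p)"

definition approx_deriv :: "(real \<Rightarrow> real) \<Rightarrow> phase_fun \<Rightarrow> nat \<Rightarrow> real \<Rightarrow> real \<Rightarrow> phase_fun" where
  "approx_deriv V f0 N \<epsilon> t = (\<lambda>p. \<Sum>l\<le>N. of_real (sqrt \<epsilon> ^ l) * (expansion_source V f0 l t p - L_harm (expansion_term V f0 l t) p))"

text \<open>The terms with \<open>L_harm\<close> cancel against those in the time derivative, and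
  the sources cancel all products of total order at most N. Only products of higher order and the
  Taylor remainder survive.\<close>

lemma residual_eq:
  assumes V: "admissible_potential V" and f0: "f0 \<in> schwartz" and \<epsilon>: "0 < \<epsilon>" "\<epsilon> \<le> 1" and t: "t \<ge> 0"
  shows "approx_deriv V f0 N \<epsilon> t p + wigner_op V \<epsilon> (approx V f0 N \<epsilon> t) p =
    (\<Sum>m\<le>N. \<Sum>\<nu>=1..N. if \<nu> + m \<le> N then 0 else of_real (sqrt \<epsilon> ^ (\<nu> + m)) * B_op V \<nu> (expansion_term V f0 m t) p)
    + (\<Sum>l\<le>N. of_real (sqrt \<epsilon> ^ l) * pot_op (taylor_remainder V (N + 3)) \<epsilon> (expansion_term V f0 l t) p)"
proof -
  define Z where "Z l = expansion_term V f0 l t" for l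
  define b where "b \<nu> m = of_real (sqrt \<epsilon> ^ (\<nu> + m)) * B_op V \<nu> (Z m) p" for \<nu> m
  define q where "q l = of_real (sqrt \<epsilon> ^ l) * pot_op (taylor_remainder V (N + 3)) \<epsilon> (Z l) p" for l
  obtain C m where C: "poly_growth V C 0 m" using admissible_poly_growth[OF V] by blast
  have Z: "Z l \<in> schwartz" for l
    unfolding Z_def by (intro rot_family_schwartz rot_family_expansion_term f0 t)
  have "wigner_op V \<epsilon> (approx V f0 N \<epsilon> t) p = (\<Sum>l\<le>N. of_real (sqrt \<epsilon> ^ l) * wigner_op V \<epsilon> (Z l) p)"
    unfolding approx_def Z_def[symmetric] by (subst wigner_op_sum[OF C \<epsilon>]) (auto simp: Z)
  then have "approx_deriv V f0 N \<epsilon> t p + wigner_op V \<epsilon> (approx V f0 N \<epsilon> t) p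
    = (\<Sum>l\<le>N. of_real (sqrt \<epsilon> ^ l) * expansion_source V f0 l t p + (\<Sum>\<nu>=1..N. b \<nu> l) + q l)"
    unfolding approx_deriv_def Z_def[symmetric] wigner_op_expansion[OF V Z \<epsilon>, of _ p N]
    by (simp add: sum.distrib[symmetric] b_def q_def sum_distrib_left algebra_simps power_add)
  also have "\<dots> = (\<Sum>l\<le>N. of_real (sqrt \<epsilon> ^ l) * expansion_source V f0 l t p) + (\<Sum>l\<le>N. \<Sum>\<nu>=1..N. b \<nu> l) + (\<Sum>l\<le>N. q l)"
    by (simp add: sum.distrib)
  also have "(\<Sum>l\<le>N. of_real (sqrt \<epsilon> ^ l) * expansion_source V f0 l t p) = - (\<Sum>l\<le>N. \<Sum>\<nu>=1..l. b \<nu> (l - \<nu>))"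
    unfolding sum_negf[symmetric] by (intro sum.cong refl)
      (simp add: expansion_source_def b_def Z_def sum_distrib_left sum_negf)
  also have "\<dots> = - (\<Sum>m\<le>N. \<Sum>\<nu>=1..N. if \<nu> + m \<le> N then b \<nu> m else 0)"
    by (simp only: convolution_sum)
  also have "\<dots> + (\<Sum>l\<le>N. \<Sum>\<nu>=1..N. b \<nu> l) = (\<Sum>m\<le>N. \<Sum>\<nu>=1..N. if \<nu> + m \<le> N then 0 else b \<nu> m)"
    unfolding sum_negf[symmetric] sum.distrib[symmetric] by (intro sum.cong refl) auto
  finally show ?thesis by (simp only: b_def q_def Z_def)
qed

text \<open>The expansion terms do not involve \<epsilon>, so the constants below depend neither on
  \<epsilon> nor on time; \<epsilon> enters only through explicit powers.\<close>

lemma residual_bound: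
  assumes V: "admissible_potential V" and f0: "f0 \<in> schwartz"
  shows "\<exists>K\<ge>0. \<forall>\<epsilon> t. 0 < \<epsilon> \<longrightarrow> \<epsilon> \<le> 1 \<longrightarrow> t > 0 \<longrightarrow>
    (\<lambda>p. approx_deriv V f0 N \<epsilon> t p + wigner_op V \<epsilon> (approx V f0 N \<epsilon> t) p) \<in> L2 \<and>
    L2_norm (\<lambda>p. approx_deriv V f0 N \<epsilon> t p + wigner_op V \<epsilon> (approx V f0 N \<epsilon> t) p) \<le> K * sqrt \<epsilon> ^ (N + 1) * exp t"
proof -
  let ?Z = "expansion_term V f0" and ?U = "taylor_remainder V (N + 3)"
  let ?r = "\<lambda>\<epsilon> t p. approx_deriv V f0 N \<epsilon> t p + wigner_op V \<epsilon> (approx V f0 N \<epsilon> t) p"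
  note Z = rot_family_expansion_term[OF f0, of V]
  obtain c m where c: "\<And>x. \<bar>V x\<bar> \<le> c * (1 + \<bar>x\<bar> ^ m)" using V unfolding admissible_potential_def by blast
  have "smooth_real V" using V unfolding admissible_potential_def by blast
  then obtain C where C: "poly_growth (?U) C (N + 3) m"
    using poly_growth_taylor_remainder[OF _ c] by blast
  \<comment> \<open>The exponent that \<open>pot_op_L2\<close> requires for vanishing order N + 3
    and growth \<open>m\<close>.\<close>
  define n where "n = Suc (N + 3 + m)"
  have "\<exists>K1. \<forall>\<nu> l. K1 \<nu> l \<ge> 0 \<and> (\<forall>t\<ge>0. L2_norm (B_op V \<nu> (?Z l t)) \<le> K1 \<nu> l * exp t)"
    by (rule choice, rule allI, rule choice, rule allI) (use rot_family_L2[OF rot_family_B_op[OF Z]] in blast)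
  then obtain K1 where K1: "\<And>\<nu> l. K1 \<nu> l \<ge> 0" "\<And>\<nu> l t. t \<ge> 0 \<Longrightarrow> L2_norm (B_op V \<nu> (?Z l t)) \<le> K1 \<nu> l * exp t"
    by blast
  have "\<exists>K2. \<forall>l. K2 l \<ge> 0 \<and> (\<forall>t\<ge>0. \<forall>x y. (1 + x^2) ^ n * (1 + y^2) ^ n * cmod ((one_minus_d2 ^^ n) (?Z l t) (x, y)) \<le> K2 l * exp t)"
    by (rule choice, rule allI) (use rot_family_decay[OF rot_family_one_minus_d2_power[OF Z]] in blast)
  then obtain K2 where K2: "\<And>l. K2 l \<ge> 0"
    "\<And>l t x y. t \<ge> 0 \<Longrightarrow> (1 + x^2) ^ n * (1 + y^2) ^ n * cmod ((one_minus_d2 ^^ n) (?Z l t) (x, y)) \<le> K2 l * exp t"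
    by blast
  have C0: "C \<ge> 0" using C by (simp add: poly_growth_def)
  define K where "K = (\<Sum>m\<le>N. \<Sum>\<nu>=1..N. K1 \<nu> m) + (\<Sum>l\<le>N. 8 * pi * C * K2 l)"
  have "(?r \<epsilon> t) \<in> L2 \<and>
    L2_norm (?r \<epsilon> t) \<le> K * sqrt \<epsilon> ^ (N + 1) * exp t"
    if \<epsilon>: "0 < \<epsilon>" "\<epsilon> \<le> 1" and t: "t > 0" for \<epsilon> t
  proof -
    define s where "s = sqrt \<epsilon>"
    let ?P = "\<lambda>l p. of_real (s ^ l) * pot_op ?U \<epsilon> (?Z l t) p"
    let ?B = "\<lambda>\<nu> m p. if \<nu> + m \<le> N then 0 else of_real (s ^ (\<nu> + m)) * B_op V \<nu> (?Z m t) p"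
    have s: "0 \<le> s" "s \<le> 1" "s > 0" "s^2 = \<epsilon>" using \<epsilon> by (auto simp: s_def)
    have S: "?Z l t \<in> schwartz" for l using rot_family_schwartz[OF Z] t by simp
    have P: "(?P l) \<in> L2"
      "L2_norm (?P l) \<le> 8 * pi * C * K2 l * (s ^ (N + 1) * exp t)" for l
    proof -
      note p = pot_op_L2[OF C \<epsilon> S n_def K2(2)[OF less_imp_le[OF t]], of l]
      show "(?P l) \<in> L2"
        by (rule L2_cmult[OF p(1)])
      \<comment> \<open>Here the prefactor 1/\<epsilon> consumes two of the powers supplied by the
        Taylor remainder.\<close>
      have e: "s ^ (N + 3) / \<epsilon> = s ^ (N + 1)"
        unfolding s(4)[symmetric] using s(3) by (simp add: power_add power2_eq_square power3_eq_cube)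
      have "L2_norm (?P l)
        = s ^ l * L2_norm (pot_op ?U \<epsilon> (?Z l t))"
        unfolding L2_norm_cmult norm_of_real using s by simp
      also have "\<dots> \<le> 1 * L2_norm (pot_op ?U \<epsilon> (?Z l t))"
        using s by (intro mult_right_mono power_le_one L2_norm_nonneg)
      also have "\<dots> \<le> 8 * pi * C * (K2 l * exp t) * (s ^ (N + 3) / \<epsilon>)"
        using p(2) by (simp add: s_def)
      finally show "L2_norm (?P l) \<le> 8 * pi * C * K2 l * (s ^ (N + 1) * exp t)"
        unfolding e by (simp only: mult_ac)
    qed
    have B: "(?B \<nu> m) \<in> L2"
      "L2_norm (?B \<nu> m) \<le> K1 \<nu> m * (s ^ (N + 1) * exp t)" for \<nu> m
    proof -
      have b: "B_op V \<nu> (?Z m t) \<in> L2"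
        using schwartz_L2[OF rot_family_schwartz[OF rot_family_B_op[OF Z]]] t by simp
      then show "(?B \<nu> m) \<in> L2"
        by (cases "\<nu> + m \<le> N") (simp_all add: L2_zero L2_cmult)
      show "L2_norm (?B \<nu> m) \<le> K1 \<nu> m * (s ^ (N + 1) * exp t)"
      proof (cases "\<nu> + m \<le> N")
        case True
        then show ?thesis using K1(1) s by (simp add: L2_norm_def)
      next
        case False
        then have "L2_norm (?B \<nu> m)
          = s ^ (\<nu> + m) * L2_norm (B_op V \<nu> (?Z m t))"
          using s by (simp add: L2_norm_cmult norm_power)
        also have "\<dots> \<le> s ^ (N + 1) * (K1 \<nu> m * exp t)"
          using False s t by (intro mult_mono power_decreasing K1 L2_norm_nonneg) auto
        finally show ?thesis by (simp only: mult_ac)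
      qed
    qed
    have B_sum: "(\<lambda>p. \<Sum>m\<le>N. \<Sum>\<nu>=1..N. ?B \<nu> m p) \<in> L2 \<and>
      L2_norm (\<lambda>p. \<Sum>m\<le>N. \<Sum>\<nu>=1..N. ?B \<nu> m p)
      \<le> (\<Sum>m\<le>N. \<Sum>\<nu>=1..N. K1 \<nu> m * (s ^ (N + 1) * exp t))"
    proof -
      have inner: "(\<lambda>p. \<Sum>\<nu>=1..N. ?B \<nu> m p) \<in> L2 \<and>
        L2_norm (\<lambda>p. \<Sum>\<nu>=1..N. ?B \<nu> m p)
        \<le> (\<Sum>\<nu>=1..N. K1 \<nu> m * (s ^ (N + 1) * exp t))" for m
        by (rule L2_sum[OF finite_atLeastAtMost B])
      show ?thesis by (rule L2_sum[OF finite_atMost conjunct1[OF inner] conjunct2[OF inner]])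
    qed
    have P_sum: "(\<lambda>p. \<Sum>l\<le>N. ?P l p) \<in> L2 \<and>
      L2_norm (\<lambda>p. \<Sum>l\<le>N. ?P l p)
      \<le> (\<Sum>l\<le>N. 8 * pi * C * K2 l * (s ^ (N + 1) * exp t))"
      by (intro L2_sum P) auto
    have "K * s ^ (N + 1) * exp t = (\<Sum>m\<le>N. \<Sum>\<nu>=1..N. K1 \<nu> m * (s ^ (N + 1) * exp t)) + (\<Sum>l\<le>N. 8 * pi * C * K2 l * (s ^ (N + 1) * exp t))"
      unfolding K_def mult.assoc[of _ "s ^ (N + 1)"] distrib_right by (simp only: sum_distrib_right)
    then show ?thesis
      unfolding residual_eq[OF V f0 \<epsilon> less_imp_le[OF t]] s_def[symmetric]
      using B_sum P_sum L2_norm_triangle[OF conjunct1[OF B_sum] conjunct1[OF P_sum]] by (auto intro: L2_add)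
  qed
  moreover have "K \<ge> 0"
    unfolding K_def using K1 K2 C0 by (intro add_nonneg_nonneg sum_nonneg) auto
  ultimately show ?thesis by blast
qed

text \<open>Formally the derivative of \<open>sqrt (n t)\<close> is at most
  \<open>E * exp t\<close>. The root is not differentiable where \<open>n\<close> vanishes, so a
  constant \<delta> > 0 is added first and sent to 0 at the end. Since \<open>n\<close> is
  differentiable at positive times, monotonicity is used on \<open>{s..t}\<close> with
  \<open>s > 0\<close>, and the initial value enters as a limit.\<close>

lemma energy_growth:
  fixes n n' :: "real \<Rightarrow> real"
  assumes nonneg: "\<And>t. n t \<ge> 0" and E: "E \<ge> 0" and t: "t > 0"
    and deriv: "\<And>t. t > 0 \<Longrightarrow> (n has_real_derivative n' t) (at t)"
    and le: "\<And>t. t > 0 \<Longrightarrow> n' t \<le> 2 * (E * exp t) * sqrt (n t)"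
    and lim: "(n \<longlongrightarrow> 0) (at_right 0)"
  shows "sqrt (n t) \<le> E * exp t"
proof -
  have *: "sqrt (n t) \<le> E * exp t + sqrt \<delta>" if \<delta>: "\<delta> > 0" for \<delta>
  proof -
    define f where "f s = sqrt (n s + \<delta>) - E * exp s" for s
    have pos: "n s + \<delta> > 0" for s using nonneg[of s] \<delta> by simp
    have f: "(f has_real_derivative n' s / (2 * sqrt (n s + \<delta>)) - E * exp s) (at s)" if "s > 0" for s
    proof -
      have "((\<lambda>s. sqrt (n s + \<delta>)) has_real_derivative inverse (sqrt (n s + \<delta>)) / 2 * (n' s + 0)) (at s)"
        by (rule DERIV_chain2[OF DERIV_real_sqrt[OF pos] DERIV_add[OF deriv[OF that] DERIV_const]])
      from DERIV_diff[OF this DERIV_cmult[OF DERIV_exp]] show ?thesis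
        unfolding f_def by (rule DERIV_cong) (simp add: field_simps)
    qed
    have "f t \<le> f s" if s: "0 < s" "s < t" for s
    proof (rule DERIV_nonpos_imp_nonincreasing[where f = f and a = s and b = t])
      fix r assume r: "s \<le> r" "r \<le> t"
      then have r0: "r > 0" using s by simp
      have "sqrt (n r) \<le> sqrt (n r + \<delta>)" using \<delta> by simp
      then have "2 * (E * exp r) * sqrt (n r) \<le> 2 * (E * exp r) * sqrt (n r + \<delta>)"
        using E by (intro mult_left_mono) auto
      with le[OF r0] have "n' r \<le> (E * exp r) * (2 * sqrt (n r + \<delta>))" by (simp add: mult_ac)
      then have "n' r / (2 * sqrt (n r + \<delta>)) \<le> E * exp r"
        using pos[of r] by (simp add: pos_divide_le_eq)
      then show "\<exists>y. (f has_real_derivative y) (at r) \<and> y \<le> 0"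
        using f[OF r0] by (intro exI conjI) auto
    qed (use s in simp)
    then have "\<forall>\<^sub>F s in at_right 0. f t \<le> f s"
      using eventually_at_right_real[OF t] by (auto elim!: eventually_mono)
    moreover have "(f \<longlongrightarrow> sqrt (0 + \<delta>) - E * exp 0) (at_right 0)"
      unfolding f_def by (intro tendsto_intros lim)
    ultimately have "f t \<le> sqrt (0 + \<delta>) - E * exp 0"
      by (intro tendsto_lowerbound) auto
    moreover have "sqrt (n t) \<le> sqrt (n t + \<delta>)" using \<delta> by simp
    ultimately show ?thesis using E unfolding f_def exp_zero add_0_left mult_1_right by linarith
  qed
  have "((\<lambda>\<delta>. E * exp t + sqrt \<delta>) \<longlongrightarrow> E * exp t + sqrt 0) (at_right 0)"
    by (intro tendsto_intros)
  then have "sqrt (n t) \<le> E * exp t + sqrt 0"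
    by (rule tendsto_lowerbound) (use * in \<open>auto simp: eventually_at_filter\<close>)
  then show ?thesis by simp
qed

section \<open>Time derivative and initial value of the truncated expansion\<close>

lemma has_L2_derivative_sum:
  assumes "finite I" "t > 0" "\<And>i. i \<in> I \<Longrightarrow> has_L2_derivative (Z i) (X i) t"
    "\<And>i s. i \<in> I \<Longrightarrow> s > 0 \<Longrightarrow> Z i s \<in> schwartz" "\<And>i. i \<in> I \<Longrightarrow> X i \<in> schwartz"
  shows "has_L2_derivative (\<lambda>t p. \<Sum>i\<in>I. c i * Z i t p) (\<lambda>p. \<Sum>i\<in>I. c i * X i p) t"
  using assms
proof (induction I rule: finite_induct)
  case empty
  then show ?case by (simp add: has_L2_derivative_def L2_norm_def)
next
  case (insert j I)
  have "has_L2_derivative (\<lambda>t p. (\<Sum>i\<in>I. c i * Z i t p) + c j * Z j t p) (\<lambda>p. (\<Sum>i\<in>I. c i * X i p) + c j * X j p) t"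
    using insert by (intro has_L2_derivative_lincomb) (auto intro!: schwartz_L2 schwartz_sum schwartz_cmult)
  then show ?case using insert(1,2) by (simp add: add.commute)
qed

lemma approx_properties:
  assumes f0: "f0 \<in> schwartz"
  shows "t \<ge> 0 \<Longrightarrow> approx V f0 N \<epsilon> t \<in> schwartz" "t > 0 \<Longrightarrow> approx_deriv V f0 N \<epsilon> t \<in> schwartz"
    "t > 0 \<Longrightarrow> has_L2_derivative (approx V f0 N \<epsilon>) (approx_deriv V f0 N \<epsilon> t) t"
    "((\<lambda>t. L2_norm (\<lambda>p. approx V f0 N \<epsilon> t p - f0 p)) \<longlongrightarrow> 0) (at_right 0)"
proof -
  let ?c = "\<lambda>l. of_real (sqrt \<epsilon> ^ l) :: complex" and ?Z = "expansion_term V f0"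
  note Z = rot_family_expansion_term[OF f0, of V]
  note S = rot_family_schwartz[OF Z]
  show A: "approx V f0 N \<epsilon> t \<in> schwartz" if "t \<ge> 0" for t
    unfolding approx_def by (intro schwartz_sum schwartz_cmult S that) simp
  have src: "expansion_source V f0 l t \<in> schwartz" if "t \<ge> 0" for l t
  proof -
    have "(\<lambda>p. (-1) * (\<Sum>\<nu>=1..l. B_op V \<nu> (?Z (l - \<nu>) t) p)) \<in> schwartz"
      by (intro schwartz_cmult schwartz_sum rot_family_schwartz[OF rot_family_B_op[OF Z]] that) simp
    then show ?thesis by (simp add: expansion_source_def)
  qed
  have X: "(\<lambda>p. expansion_source V f0 l t p - L_harm (?Z l t) p) \<in> schwartz" if "t \<ge> 0" for l t
    by (intro schwartz_diff src schwartz_L_harm S that)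
  show "approx_deriv V f0 N \<epsilon> t \<in> schwartz" if "t > 0" for t
    unfolding approx_deriv_def using that by (intro schwartz_sum schwartz_cmult X) auto
  show "has_L2_derivative (approx V f0 N \<epsilon>) (approx_deriv V f0 N \<epsilon> t) t" if "t > 0" for t
    unfolding approx_def[abs_def] approx_deriv_def
    using that by (intro has_L2_derivative_sum expansion_term_derivative f0 S X) auto
  have eq: "approx V f0 N \<epsilon> t = (\<lambda>p. harmonic_term f0 t p + (\<Sum>l=1..N. ?c l * ?Z l t p))" for t
  proof -
    have "{..N} = insert 0 {1..N}" by auto
    then show ?thesis by (simp add: approx_def expansion_term_def)
  qed
  define b where "b t = L2_norm (\<lambda>p. harmonic_term f0 t p - f0 p) + (\<Sum>l=1..N. cmod (?c l) * L2_norm (?Z l t))" for t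
  have bound: "L2_norm (\<lambda>p. approx V f0 N \<epsilon> t p - f0 p) \<le> b t" if "t > 0" for t
  proof -
    have s: "(\<lambda>p. \<Sum>l=1..N. ?c l * ?Z l t p) \<in> L2 \<and>
      L2_norm (\<lambda>p. \<Sum>l=1..N. ?c l * ?Z l t p) \<le> (\<Sum>l=1..N. cmod (?c l) * L2_norm (?Z l t))"
      using that by (intro L2_sum L2_cmult schwartz_L2 S) (auto simp only: L2_norm_cmult order_refl finite_atLeastAtMost less_imp_le)
    have h: "(\<lambda>p. harmonic_term f0 t p - f0 p) \<in> L2"
      by (intro schwartz_L2 schwartz_diff schwartz_harmonic_term f0)
    have "(\<lambda>p. approx V f0 N \<epsilon> t p - f0 p) = (\<lambda>p. (harmonic_term f0 t p - f0 p) + (\<Sum>l=1..N. ?c l * ?Z l t p))"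
      unfolding eq by (simp add: fun_eq_iff)
    then show ?thesis
      unfolding b_def using L2_norm_triangle[OF h conjunct1[OF s]] conjunct2[OF s] by simp
  qed
  have "(b \<longlongrightarrow> 0 + (\<Sum>l=1..N. cmod (?c l) * 0)) (at_right 0)"
    unfolding b_def by (intro tendsto_intros harmonic_term_tendsto expansion_term_tendsto_0 f0) simp
  then have b: "(b \<longlongrightarrow> 0) (at_right 0)" by simp
  show "((\<lambda>t. L2_norm (\<lambda>p. approx V f0 N \<epsilon> t p - f0 p)) \<longlongrightarrow> 0) (at_right 0)"
    by (rule tendsto_sandwich[OF _ _ tendsto_const b])
      (use bound in \<open>auto simp: L2_norm_nonneg eventually_at_filter\<close>)
qed

lemma remainder_eq:
  assumes "\<epsilon> > 0"
  shows "remainder V f0 N \<epsilon> W t = (\<lambda>p. W t p - approx V f0 N \<epsilon> t p)"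
proof -
  have "{..N} = insert 0 {1..N}" by auto
  moreover have "\<epsilon> powr (real l / 2) = sqrt \<epsilon> ^ l" for l
    using assms by (simp add: powr_half_sqrt[symmetric] powr_realpow[symmetric] powr_powr)
  ultimately show ?thesis
    by (simp add: remainder_def approx_def expansion_term_def fun_eq_iff)
qed

theorem theorem2:
  fixes V :: "real \<Rightarrow> real" and f0 :: phase_fun
  assumes "admissible_potential V"
    and "f0 \<in> schwartz"
  shows "\<forall>N::nat. \<exists>C>0. \<exists>\<epsilon>0>0. \<forall>\<epsilon> W.
           0 < \<epsilon> \<and> \<epsilon> < \<epsilon>0 \<and> wigner_solution V \<epsilon> f0 W \<longrightarrow>
             (\<forall>t>0. remainder V f0 N \<epsilon> W t \<in> L2 \<and>
                    L2_norm (remainder V f0 N \<epsilon> W t) \<le> C * exp t * \<epsilon> powr (real (N + 1) / 2))"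
proof
  fix N :: nat
  let ?r = "\<lambda>\<epsilon> t p. approx_deriv V f0 N \<epsilon> t p + wigner_op V \<epsilon> (approx V f0 N \<epsilon> t) p"
  obtain C m where U: "poly_growth V C 0 m" using admissible_poly_growth[OF assms(1)] by blast
  obtain K where K: "K \<ge> 0"
    "\<And>\<epsilon> t. 0 < \<epsilon> \<Longrightarrow> \<epsilon> \<le> 1 \<Longrightarrow> t > 0 \<Longrightarrow> (?r \<epsilon> t) \<in> L2"
    "\<And>\<epsilon> t. 0 < \<epsilon> \<Longrightarrow> \<epsilon> \<le> 1 \<Longrightarrow> t > 0 \<Longrightarrow>
      L2_norm (?r \<epsilon> t) \<le> K * sqrt \<epsilon> ^ (N + 1) * exp t"
    using residual_bound[OF assms, of N] by blast
  \<comment> \<open>The constant is \<open>K + 1\<close> because a positive one is required and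
    \<open>K\<close> may be 0. The threshold is 1: the estimates use just
    \<open>\<epsilon> \<le> 1\<close>.\<close>
  have "remainder V f0 N \<epsilon> W t \<in> L2 \<and> L2_norm (remainder V f0 N \<epsilon> W t) \<le> (K + 1) * exp t * \<epsilon> powr (real (N + 1) / 2)"
    if \<epsilon>: "0 < \<epsilon>" "\<epsilon> < 1" and W: "wigner_solution V \<epsilon> f0 W" and t: "t > 0" for \<epsilon> W t
  proof -
    have \<epsilon>1: "\<epsilon> \<le> 1" using \<epsilon> by simp
    define A where "A = approx V f0 N \<epsilon>"
    define A' where "A' = approx_deriv V f0 N \<epsilon>"
    define R where "R t = (\<lambda>p. W t p + (-1) * A t p)" for t
    define E where "E = K * sqrt \<epsilon> ^ (N + 1)"
    note A = approx_properties[where V = V and N = N and \<epsilon> = \<epsilon>, OF assms(2), folded A_def A'_def]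
    have "\<forall>t. \<exists>G. t > 0 \<longrightarrow> (W t, G) \<in> wigner_graph V \<epsilon> \<and>
        ((\<lambda>h. L2_norm (\<lambda>p. (W (t + h) p - W t p) / of_real h + G p)) \<longlongrightarrow> 0) (at 0)"
      using W unfolding wigner_solution_def by blast
    from choice[OF this] obtain G where G: "\<And>t. t > 0 \<Longrightarrow> (W t, G t) \<in> wigner_graph V \<epsilon>"
      "\<And>t. t > 0 \<Longrightarrow> ((\<lambda>h. L2_norm (\<lambda>p. (W (t + h) p - W t p) / of_real h + G t p)) \<longlongrightarrow> 0) (at 0)"
      by blast
    have WL2: "W t \<in> L2" and GL2: "G t \<in> L2" if "t > 0" for t
      using G(1)[OF that] unfolding wigner_graph_def by auto
    have AL2: "A t \<in> L2" and A'L2: "A' t \<in> L2" and LAL2: "wigner_op V \<epsilon> (A t) \<in> L2" if "t > 0" for t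
      using A(1,2)[of t] that wigner_op_L2(1)[OF U \<epsilon>(1) \<epsilon>1, of "A t"] by (auto intro: schwartz_L2)
    have RL2: "R t \<in> L2" if "t > 0" for t
      unfolding R_def by (intro L2_add L2_cmult WL2 AL2 that)
    have derW: "has_L2_derivative W (\<lambda>p. (-1) * G t p) t" if "t > 0" for t
      using G(2)[OF that] by (simp add: has_L2_derivative_def)
    define X where "X t = (\<lambda>p. (-1) * G t p + (-1) * A' t p)" for t
    have derR: "has_L2_derivative R (X t) t" if "t > 0" for t
      unfolding R_def X_def using that
      by (intro has_L2_derivative_lincomb derW A(3) L2_cmult WL2 AL2 GL2 A'L2) auto
    have XL2: "X t \<in> L2" if "t > 0" for t
      unfolding X_def by (intro L2_add L2_cmult GL2 A'L2 that)
    have "sqrt ((L2_norm (R t))^2) \<le> E * exp t"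
    proof (rule energy_growth[OF _ _ t])
      show "((\<lambda>t. (L2_norm (R t))^2) has_real_derivative 2 * Re (L2_inner (X t) (R t))) (at t)" if "t > 0" for t
        by (rule L2_norm_square_has_derivative[OF RL2 XL2[OF that] that derR[OF that]])
      show "2 * Re (L2_inner (X t) (R t)) \<le> 2 * (E * exp t) * sqrt ((L2_norm (R t))^2)" if "t > 0" for t
      proof -
        define r where "r = (\<lambda>p. A' t p + wigner_op V \<epsilon> (A t) p)"
        have r: "r \<in> L2" "L2_norm r \<le> E * exp t"
          unfolding r_def A_def A'_def E_def using K(2,3)[OF \<epsilon>(1) \<epsilon>1 that] by auto
        have R_eq: "R t = (\<lambda>p. W t p - A t p)" by (simp add: R_def)
        have d: "(\<lambda>p. G t p - wigner_op V \<epsilon> (A t) p) \<in> L2" by (intro L2_diff GL2 LAL2 that)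
        \<comment> \<open>The evolution equation of the error: minus the Wigner generator,
          represented on the solution by the graph element \<open>G t\<close>, minus the residual.
          Paired with \<open>R t\<close>, the first part has no real part, so the residual alone
          drives the energy.\<close>
        have "X t = (\<lambda>p. (-1) * (G t p - wigner_op V \<epsilon> (A t) p) + (-1) * r p)"
          by (simp add: X_def r_def fun_eq_iff)
        then have "L2_inner (X t) (R t) = - L2_inner (\<lambda>p. G t p - wigner_op V \<epsilon> (A t) p) (R t) - L2_inner r (R t)"
          using L2_inner_add_left[OF L2_cmult[OF d, of "-1"] L2_cmult[OF r(1), of "-1"] RL2[OF that]]
          by (simp only: L2_inner_cmult_left) simp
        moreover have "Re (L2_inner (\<lambda>p. G t p - wigner_op V \<epsilon> (A t) p) (R t)) = 0"
          unfolding R_eq using that by (intro wigner_graph_skew[OF U \<epsilon>(1) \<epsilon>1 G(1)] A(1)) auto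
        ultimately have "Re (L2_inner (X t) (R t)) = - Re (L2_inner r (R t))" by simp
        also have "\<dots> \<le> cmod (L2_inner r (R t))" using abs_Re_le_cmod[of "L2_inner r (R t)"] by linarith
        also have "\<dots> \<le> L2_norm r * L2_norm (R t)" by (intro L2_Cauchy_Schwarz r RL2 that)
        also have "\<dots> \<le> (E * exp t) * L2_norm (R t)" by (intro mult_right_mono r L2_norm_nonneg)
        finally show ?thesis by (simp add: L2_norm_nonneg)
      qed
      show "((\<lambda>t. (L2_norm (R t))^2) \<longlongrightarrow> 0) (at_right 0)"
      proof -
        have lim: "((\<lambda>t. L2_norm (\<lambda>p. W t p - f0 p) + L2_norm (\<lambda>p. A t p - f0 p)) \<longlongrightarrow> 0 + 0) (at_right 0)"
          using W A(4) unfolding wigner_solution_def by (intro tendsto_add) auto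
        have "L2_norm (R t) \<le> L2_norm (\<lambda>p. W t p - f0 p) + L2_norm (\<lambda>p. A t p - f0 p)" if "t > 0" for t
        proof -
          have "R t = (\<lambda>p. (W t p - f0 p) - (A t p - f0 p))" by (simp add: R_def fun_eq_iff)
          then show ?thesis
            using L2_norm_triangle_diff[OF L2_diff L2_diff, OF WL2[OF that] schwartz_L2[OF assms(2)] AL2[OF that] schwartz_L2[OF assms(2)]]
            by simp
        qed
        then have "((\<lambda>t. L2_norm (R t)) \<longlongrightarrow> 0) (at_right 0)"
          using lim tendsto_sandwich[of "\<lambda>_. 0" "\<lambda>t. L2_norm (R t)" "at_right 0" "\<lambda>t. L2_norm (\<lambda>p. W t p - f0 p) + L2_norm (\<lambda>p. A t p - f0 p)" 0]
          by (simp add: L2_norm_nonneg eventually_at_filter)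
        from tendsto_power[OF this, of 2] show ?thesis by simp
      qed
      show "E \<ge> 0" using K(1) \<epsilon> by (simp add: E_def)
    qed simp
    then have "L2_norm (R t) \<le> E * exp t" by (simp add: L2_norm_nonneg)
    also have "\<dots> \<le> (K + 1) * exp t * sqrt \<epsilon> ^ (N + 1)"
      using \<epsilon> by (simp add: E_def algebra_simps)
    also have "sqrt \<epsilon> ^ (N + 1) = \<epsilon> powr (real (N + 1) / 2)"
      using \<epsilon> by (simp only: powr_half_sqrt[symmetric, OF less_imp_le] powr_realpow[symmetric] powr_powr powr_gt_zero) simp
    finally show ?thesis
      using RL2[OF t] unfolding remainder_eq[OF \<epsilon>(1)] by (simp add: R_def A_def)
  qed
  then show "\<exists>C>0. \<exists>\<epsilon>0>0. \<forall>\<epsilon> W. 0 < \<epsilon> \<and> \<epsilon> < \<epsilon>0 \<and> wigner_solution V \<epsilon> f0 W \<longrightarrow>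
             (\<forall>t>0. remainder V f0 N \<epsilon> W t \<in> L2 \<and>
                    L2_norm (remainder V f0 N \<epsilon> W t) \<le> C * exp t * \<epsilon> powr (real (N + 1) / 2))"
    using K(1) by (intro exI[of _ "K + 1"] conjI exI[of _ "1::real"] allI impI) auto
qed

end
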